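(* Let $|v_1\rangle=\frac{1}{\sqrt2}(|01\rangle-|10\rangle)$ and $|v_2\rangle=\frac{1}{\sqrt2}(|02\rangle-|20\rangle)$ in $\mathbb{C}^3\otimes\mathbb{C}^3$ (with $\{|0\rangle,|1\rangle,|2\rangle\}$ the standard orthonormal basis of $\mathbb{C}^3$), and let $\rho_v=\frac12(|v_1\rangle\langle v_1|+|v_2\rangle\langle v_2|)$. Then $$E_C(\rho_v)=E_R^\infty(\rho_v)=1,$$ where $E_C$ is the entanglement cost under PPT operations and $E_R^\infty$ is the asymptotic PPT-relative entropy of entanglement.
   Context: All Hilbert spaces are finite-dimensional and $\log=\log_2$. A state is a positive semidefinite operator of trace one. $T_B$ denotes partial transpose on the second (Bob's) system: $(|i_Aj_B\rangle\langle k_Al_B|)^{T_B}=|i_Al_B\rangle\langle k_Aj_B|$. For tensor powers, the bipartition is all of Alice's systems versus all of Bob's systems. $\|\cdot\|_1$ is the trace norm. PPT operations: a CPTP map $\Lambda:\mathcal{L}(A\otimes B)\to\mathcal{L}(A'\otimes B')$ is a PPT operation if $T_{B'}\circ\Lambda\circ T_B$ is completely positive. Let $\Phi=|\phi\rangle\langle\phi|$, $|\phi\rangle=\frac1{\sqrt2}(|00\rangle+|11\rangle)$. The entanglement cost under PPT operations is $$E_C(\rho)=\inf\Big\{r\ge0:\lim_{n\to\infty}\inf_{\Lambda\text{ PPT operation}}\|\rho^{\otimes n}-\Lambda(\Phi^{\otimes\lfloor rn\rfloor})\|_1=0\Big\}.$$ Relative entropy: $S(\rho\|\sigma)=\mathrm{Tr}(\rho\log\rho-\rho\log\sigma)$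 ($+\infty$ if $\mathrm{supp}(\rho)\not\subseteq\mathrm{supp}(\sigma)$). $E_R(\rho)=\min\{S(\rho\|\sigma):\sigma\ge0,\ \sigma^{T_B}\ge0,\ \mathrm{Tr}\,\sigma=1\}$ and $E_R^\infty(\rho)=\inf_{n\ge1}E_R(\rho^{\otimes n})/n$. *)

theory Defs
  imports
    Complex_Main
    "HOL-Library.Extended_Real"
    "Jordan_Normal_Form.Matrix_Kernel"
    "Jordan_Normal_Form.Schur_Decomposition"
begin

text \<open>
  Operators on \<open>\<complex>\<^sup>d\<close> are elements of \<open>carrier_mat d d\<close>.  A bipartite space with local
  dimensions \<open>dA\<close> and \<open>dB\<close> is \<open>\<complex>\<^bsup>dA * dB\<^esup>\<close>, where the product basis vector
  \<open>|i\<rangle> \<otimes> |j\<rangle>\<close> (\<open>i < dA\<close>, \<open>j < dB\<close>) has index \<open>i * dB + j\<close>.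
\<close>

definition mtrace :: "complex mat \<Rightarrow> complex" where
  "mtrace A = (\<Sum>i<dim_row A. A $$ (i, i))"

definition psd :: "nat \<Rightarrow> complex mat \<Rightarrow> bool" where
  "psd d A \<longleftrightarrow> A \<in> carrier_mat d d \<and> mat_adjoint A = A \<and>
     (\<forall>v \<in> carrier_vec d. 0 \<le> Re ((A *\<^sub>v v) \<bullet>c v))"

definition is_state :: "nat \<Rightarrow> complex mat \<Rightarrow> bool" where
  "is_state d A \<longleftrightarrow> psd d A \<and> mtrace A = 1"

definition unitary :: "nat \<Rightarrow> complex mat \<Rightarrow> bool" where
  "unitary d U \<longleftrightarrow> U \<in> carrier_mat d d \<and>
     mat_adjoint U * U = 1\<^sub>m d \<and> U * mat_adjoint U = 1\<^sub>m d"

definition spectral_decomp :: "nat \<Rightarrow> complex mat \<Rightarrow> complex mat \<Rightarrow> (nat \<Rightarrow> real) \<Rightarrow> bool" where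
  "spectral_decomp d A U r \<longleftrightarrow> unitary d U \<and>
     A = U * mat_diag d (\<lambda>i. complex_of_real (r i)) * mat_adjoint U"

text \<open>
  Functional calculus for a Hermitian operator \<open>A\<close>: \<open>f A = U diag(f r) U\<^sup>*\<close> for any spectral
  decomposition \<open>A = U diag(r) U\<^sup>*\<close>.  The result does not depend on the chosen decomposition, see
  \<open>spectral_fun_eq\<close>.
\<close>
definition spectral_fun :: "nat \<Rightarrow> (real \<Rightarrow> real) \<Rightarrow> complex mat \<Rightarrow> complex mat" where
  "spectral_fun d f A = (SOME B. \<exists>U r. spectral_decomp d A U r \<and>
     B = U * mat_diag d (\<lambda>i. complex_of_real (f (r i))) * mat_adjoint U)"

text \<open>\<open>\<parallel>X\<parallel>\<^sub>1 = Tr \<surd>(X\<^sup>* X)\<close>\<close>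
definition trace_norm :: "nat \<Rightarrow> complex mat \<Rightarrow> real" where
  "trace_norm d X = Re (mtrace (spectral_fun d sqrt (mat_adjoint X * X)))"

text \<open>The support is the orthogonal complement of the kernel.\<close>
definition supp :: "nat \<Rightarrow> complex mat \<Rightarrow> complex vec set" where
  "supp d A = {v \<in> carrier_vec d. \<forall>w \<in> mat_kernel A. v \<bullet>c w = 0}"

text \<open>
  Since \<open>log 2 0 = 0\<close> in HOL, \<open>spectral_fun d (log 2) \<sigma>\<close> is the logarithm on the support of \<open>\<sigma>\<close>
  and zero on its kernel; this gives the convention \<open>0 log 0 = 0\<close>, and the kernel of \<open>\<sigma>\<close>
  does not contribute to \<open>Tr \<rho> log \<sigma>\<close> when \<open>supp \<rho> \<subseteq> supp \<sigma>\<close>.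
\<close>
definition rel_entropy :: "nat \<Rightarrow> complex mat \<Rightarrow> complex mat \<Rightarrow> ereal" where
  "rel_entropy d \<rho> \<sigma> =
     (if supp d \<rho> \<subseteq> supp d \<sigma>
      then ereal (Re (mtrace (\<rho> * spectral_fun d (log 2) \<rho> - \<rho> * spectral_fun d (log 2) \<sigma>)))
      else \<infinity>)"

definition linear_op_map ::
    "nat \<Rightarrow> nat \<Rightarrow> (complex mat \<Rightarrow> complex mat) \<Rightarrow> bool" where
  "linear_op_map d d' L \<longleftrightarrow>
     (\<forall>X \<in> carrier_mat d d. L X \<in> carrier_mat d' d') \<and>
     (\<forall>X \<in> carrier_mat d d. \<forall>Y \<in> carrier_mat d d. L (X + Y) = L X + L Y) \<and>
     (\<forall>c. \<forall>X \<in> carrier_mat d d. L (c \<cdot>\<^sub>m X) = c \<cdot>\<^sub>m L X)"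

text \<open>
  The map \<open>id \<otimes> L\<close> on operators over \<open>\<complex>\<^sup>k \<otimes> \<complex>\<^sup>d\<close>: apply \<open>L\<close> to each of the \<open>k * k\<close> blocks of
  size \<open>d\<close>.
\<close>
definition ampliation ::
    "nat \<Rightarrow> nat \<Rightarrow> nat \<Rightarrow> (complex mat \<Rightarrow> complex mat) \<Rightarrow> complex mat \<Rightarrow> complex mat" where
  "ampliation k d d' L X = Matrix.mat (k * d') (k * d') (\<lambda>(p, q).
     L (Matrix.mat d d (\<lambda>(s, t). X $$ ((p div d') * d + s, (q div d') * d + t)))
       $$ (p mod d', q mod d'))"

definition completely_positive ::
    "nat \<Rightarrow> nat \<Rightarrow> (complex mat \<Rightarrow> complex mat) \<Rightarrow> bool" where
  "completely_positive d d' L \<longleftrightarrow> linear_op_map d d' L \<and>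
     (\<forall>k X. psd (k * d) X \<longrightarrow> psd (k * d') (ampliation k d d' L X))"

definition cptp :: "nat \<Rightarrow> nat \<Rightarrow> (complex mat \<Rightarrow> complex mat) \<Rightarrow> bool" where
  "cptp d d' L \<longleftrightarrow> completely_positive d d' L \<and>
     (\<forall>X \<in> carrier_mat d d. mtrace (L X) = mtrace X)"

definition ket :: "nat \<Rightarrow> nat \<Rightarrow> nat \<Rightarrow> nat \<Rightarrow> complex vec" where
  "ket dA dB i j = unit_vec (dA * dB) (i * dB + j)"

definition ket_bra :: "complex vec \<Rightarrow> complex vec \<Rightarrow> complex mat" where
  "ket_bra v w = Matrix.mat (dim_vec v) (dim_vec w) (\<lambda>(i, j). v $ i * cnj (w $ j))"

text \<open>See \<open>ptranspose_ket_bra\<close> for the action on matrix units.\<close>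
definition ptranspose :: "nat \<Rightarrow> nat \<Rightarrow> complex mat \<Rightarrow> complex mat" where
  "ptranspose dA dB X = Matrix.mat (dA * dB) (dA * dB) (\<lambda>(p, q).
     X $$ ((p div dB) * dB + q mod dB, (q div dB) * dB + p mod dB))"

text \<open>
  Tensor product of an operator on \<open>A \<otimes> B\<close> with one on \<open>A' \<otimes> B'\<close>, with the factors reordered
  to \<open>(A \<otimes> A') \<otimes> (B \<otimes> B')\<close>.
\<close>
definition bip_tensor ::
    "nat \<Rightarrow> nat \<Rightarrow> nat \<Rightarrow> nat \<Rightarrow> complex mat \<Rightarrow> complex mat \<Rightarrow> complex mat" where
  "bip_tensor dA dB dA' dB' X Y =
     (let D = (dA * dA') * (dB * dB');
          alice = (\<lambda>p. p div (dB * dB'));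
          bob = (\<lambda>p. p mod (dB * dB'));
          fst_idx = (\<lambda>p. (alice p div dA') * dB + bob p div dB');
          snd_idx = (\<lambda>p. (alice p mod dA') * dB' + bob p mod dB')
      in Matrix.mat D D (\<lambda>(p, q).
           X $$ (fst_idx p, fst_idx q) * Y $$ (snd_idx p, snd_idx q)))"

text \<open>The tensor power has local dimensions \<open>dA ^ n\<close> and \<open>dB ^ n\<close>.\<close>
fun bip_power :: "nat \<Rightarrow> nat \<Rightarrow> complex mat \<Rightarrow> nat \<Rightarrow> complex mat" where
  "bip_power dA dB X 0 = 1\<^sub>m 1"
| "bip_power dA dB X (Suc n) = bip_tensor (dA ^ n) (dB ^ n) dA dB (bip_power dA dB X n) X"

definition ppt_operation ::
    "nat \<Rightarrow> nat \<Rightarrow> nat \<Rightarrow> nat \<Rightarrow> (complex mat \<Rightarrow> complex mat) \<Rightarrow> bool" where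
  "ppt_operation dA dB dA' dB' L \<longleftrightarrow> cptp (dA * dB) (dA' * dB') L \<and>
     completely_positive (dA * dB) (dA' * dB') (ptranspose dA' dB' \<circ> L \<circ> ptranspose dA dB)"

definition phi_plus :: "complex vec" where
  "phi_plus = complex_of_real (1 / sqrt 2) \<cdot>\<^sub>v (ket 2 2 0 0 + ket 2 2 1 1)"

definition Phi :: "complex mat" where
  "Phi = ket_bra phi_plus phi_plus"

text \<open>
  \<open>formation_error dA dB \<rho> n m\<close> is the least trace-norm error in producing \<open>n\<close> copies of \<open>\<rho>\<close>
  from \<open>m\<close> maximally entangled qubit pairs.
\<close>
definition formation_error :: "nat \<Rightarrow> nat \<Rightarrow> complex mat \<Rightarrow> nat \<Rightarrow> nat \<Rightarrow> real" where
  "formation_error dA dB \<rho> n m =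
     (INF L \<in> {L. ppt_operation (2 ^ m) (2 ^ m) (dA ^ n) (dB ^ n) L}.
        trace_norm (dA ^ n * dB ^ n) (bip_power dA dB \<rho> n - L (bip_power 2 2 Phi m)))"

definition entanglement_cost :: "nat \<Rightarrow> nat \<Rightarrow> complex mat \<Rightarrow> ereal" where
  "entanglement_cost dA dB \<rho> = Inf {ereal r | r. 0 \<le> r \<and>
     (\<lambda>n. formation_error dA dB \<rho> n (nat \<lfloor>r * real n\<rfloor>)) \<longlonglongrightarrow> 0}"

definition rel_entropy_ent :: "nat \<Rightarrow> nat \<Rightarrow> complex mat \<Rightarrow> ereal" where
  "rel_entropy_ent dA dB \<rho> =
     (INF \<sigma> \<in> {\<sigma>. is_state (dA * dB) \<sigma> \<and> psd (dA * dB) (ptranspose dA dB \<sigma>)}.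
        rel_entropy (dA * dB) \<rho> \<sigma>)"

definition reg_rel_entropy_ent :: "nat \<Rightarrow> nat \<Rightarrow> complex mat \<Rightarrow> ereal" where
  "reg_rel_entropy_ent dA dB \<rho> =
     (INF n \<in> {1..}. rel_entropy_ent (dA ^ n) (dB ^ n) (bip_power dA dB \<rho> n) / ereal (real n))"

definition v1 :: "complex vec" where
  "v1 = complex_of_real (1 / sqrt 2) \<cdot>\<^sub>v (ket 3 3 0 1 - ket 3 3 1 0)"

definition v2 :: "complex vec" where
  "v2 = complex_of_real (1 / sqrt 2) \<cdot>\<^sub>v (ket 3 3 0 2 - ket 3 3 2 0)"

definition rho_v :: "complex mat" where
  "rho_v = (1 / 2) \<cdot>\<^sub>m (ket_bra v1 v1 + ket_bra v2 v2)"

lemma mat_adjoint_carrier [simp]: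
  "A \<in> carrier_mat m n \<Longrightarrow> mat_adjoint A \<in> carrier_mat n m"
  unfolding mat_adjoint_def carrier_mat_def by auto

lemma spectral_decomp_unique:
  assumes "spectral_decomp d A U r" "spectral_decomp d A V s"
  shows "U * mat_diag d (\<lambda>i. complex_of_real (f (r i))) * mat_adjoint U =
         V * mat_diag d (\<lambda>i. complex_of_real (f (s i))) * mat_adjoint V"
proof -
  define R where "R g = mat_diag d (\<lambda>i. complex_of_real (g (r i)))" for g :: "real \<Rightarrow> real"
  define S where "S g = mat_diag d (\<lambda>i. complex_of_real (g (s i)))" for g :: "real \<Rightarrow> real"
  have [simp]: "R g \<in> carrier_mat d d" "S g \<in> carrier_mat d d" for g
    unfolding R_def S_def by auto
  define U' V' where "U' = mat_adjoint U" and "V' = mat_adjoint V"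
  have U: "U \<in> carrier_mat d d" "U' \<in> carrier_mat d d" "U' * U = 1\<^sub>m d" "U * U' = 1\<^sub>m d"
    and V: "V \<in> carrier_mat d d" "V' \<in> carrier_mat d d" "V' * V = 1\<^sub>m d" "V * V' = 1\<^sub>m d"
    using assms unfolding spectral_decomp_def unitary_def U'_def V'_def by auto
  define W where "W = V' * U"
  have W: "W \<in> carrier_mat d d" unfolding W_def using U V by auto
  have eq: "U * R (\<lambda>x. x) * U' = V * S (\<lambda>x. x) * V'"
    using assms unfolding spectral_decomp_def R_def S_def U'_def V'_def by simp
  have mult_closed: "A * B \<in> carrier_mat d d"
    if "A \<in> carrier_mat d d" "B \<in> carrier_mat d d" for A B :: "complex mat"
    using that by simp
  have cancel: "A * (B * C) = C"
    if "A * B = 1\<^sub>m d" "A \<in> carrier_mat d d" "B \<in> carrier_mat d d" "C \<in> carrier_mat d d"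
    for A B C :: "complex mat"
    using that by (metis assoc_mult_mat left_mult_one_mat)
  note assoc = assoc_mult_mat[of _ d d _ d _ d] mult_closed right_mult_one_mat[of _ d d]
  have left: "V' * (U * R g * U') * U = W * R g" for g
    using U V unfolding W_def by (simp add: assoc)
  have right: "V' * (V * S g * V') * U = S g * W" for g
    using U V unfolding W_def by (simp add: assoc cancel)
  have "W * R (\<lambda>x. x) = S (\<lambda>x. x) * W"
    using left[of "\<lambda>x. x"] right[of "\<lambda>x. x"] eq by simp
  then have ent: "W $$ (i, j) * complex_of_real (r j) = complex_of_real (s i) * W $$ (i, j)"
    if "i < d" "j < d" for i j
    using that unfolding R_def S_def mat_diag_mult_left[OF W] mat_diag_mult_right[OF W]
    by (auto simp: mat_eq_iff)
  have WR: "W * R f = S f * W"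
  proof -
    have "W $$ (i, j) * complex_of_real (f (r j)) = complex_of_real (f (s i)) * W $$ (i, j)"
      if "i < d" "j < d" for i j
    proof (cases "W $$ (i, j) = 0")
      case False
      then have "r j = s i" using ent[OF that] by (simp add: mult.commute)
      then show ?thesis by simp
    qed simp
    then show ?thesis
      unfolding R_def S_def mat_diag_mult_left[OF W] mat_diag_mult_right[OF W]
      by (intro eq_matI) auto
  qed
  have "V * (W * R f) * U' = U * R f * U'"
    using U V unfolding W_def by (simp add: assoc cancel)
  moreover have "V * (S f * W) * U' = V * S f * V'"
    using U V unfolding W_def by (simp add: assoc cancel)
  ultimately show ?thesis using WR unfolding R_def S_def U'_def V'_def by simp
qed

lemma spectral_fun_eq:
  assumes "spectral_decomp d A U r"
  shows "spectral_fun d f A =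
    U * mat_diag d (\<lambda>i. complex_of_real (f (r i))) * mat_adjoint U"
  unfolding spectral_fun_def
  by (rule some_equality) (use assms spectral_decomp_unique in blast)+

lemma ptranspose_ket_bra:
  assumes "i < dA" "j < dB" "k < dA" "l < dB"
  shows "ptranspose dA dB (ket_bra (ket dA dB i j) (ket dA dB k l)) =
         ket_bra (ket dA dB i l) (ket dA dB k j)"
proof -
  have idx: "a * dB + b < dA * dB" if "a < dA" "b < dB" for a b
  proof -
    have "a * dB + b < Suc a * dB" using that by simp
    also have "\<dots> \<le> dA * dB" using that by (intro mult_right_mono) auto
    finally show ?thesis .
  qed
  have split: "a * dB + b = p \<longleftrightarrow> p div dB = a \<and> p mod dB = b" if "b < dB" for a b p
    using that by auto
  show ?thesis
  proof (rule eq_matI)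
    fix p q
    assume "p < dim_row (ket_bra (ket dA dB i l) (ket dA dB k j))"
      and "q < dim_col (ket_bra (ket dA dB i l) (ket dA dB k j))"
    then have pq: "p < dA * dB" "q < dA * dB" by (auto simp: ket_bra_def ket_def)
    have dB: "0 < dB" using assms by simp
    have pq': "p div dB < dA" "q div dB < dA" "p mod dB < dB" "q mod dB < dB"
      using pq dB by (auto simp: less_mult_imp_div_less)
    note idx[OF pq'(1) pq'(4)] idx[OF pq'(2) pq'(3)]
    then show "ptranspose dA dB (ket_bra (ket dA dB i j) (ket dA dB k l)) $$ (p, q) =
          ket_bra (ket dA dB i l) (ket dA dB k j) $$ (p, q)"
      using pq assms pq' idx
      by (auto simp: ptranspose_def ket_bra_def ket_def unit_vec_def split)
  qed (auto simp: ptranspose_def ket_bra_def ket_def)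
qed

end

theory Submission
  imports Defs "Jordan_Normal_Form.Spectral_Radius"
begin

text \<open>
  Write \<open>\<rho>\<close> for \<open>rho_v\<close> and \<open>T\<close> for the partial transpose.  There is an operator \<open>Y\<close> with
  \<open>-Y \<le> \<rho>\<^sup>T \<le> Y\<close> and \<open>-1/4 \<le> Y\<^sup>T \<le> 1/4\<close>.  Such two-sided bounds are stable under tensor
  products, so every PPT state \<open>\<sigma>\<close> on \<open>n\<close> copies satisfies \<open>Tr \<rho>\<^sub>n \<sigma> \<le> 4\<^sup>-\<^sup>n\<close>, where
  \<open>\<rho>\<^sub>n\<close> is the \<open>n\<close>-fold power of \<open>\<rho>\<close>.  As \<open>\<rho>\<^sub>n\<close> is \<open>2\<^sup>-\<^sup>n\<close> times a projection, concavity of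
  the logarithm gives \<open>S(\<rho>\<^sub>n \<parallel> \<sigma>) \<ge> -n + 2n = n\<close>; equality for \<open>n = 1\<close> is attained by an explicit
  PPT state.

  For the cost, \<open>m\<close> maximally entangled pairs are dominated by \<open>2\<^sup>m\<close> times a PPT state, hence
  whatever a PPT operation produces from them has overlap at most \<open>2\<^sup>m 4\<^sup>-\<^sup>n\<close> with \<open>\<rho>\<^sub>n\<close>.  For
  \<open>m \<le> rn\<close> with \<open>r < 1\<close> this keeps the trace norm error away from \<open>0\<close>.  Conversely, \<open>v1\<close> and \<open>v2\<close>
  are maximally entangled qubit states up to local isometries, so applying a random one of two pairs
  of local isometries turns each pair into \<open>\<rho>\<close> exactly.
\<close>

section \<open>The spectral theorem for Hermitian matrices\<close>

text \<open>The PPT states that compete on n copies need not be products, so a state that is good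
  for one copy only yields the upper bound on the regularized quantity. The lower bound needs a
  certificate that multiplies over copies, and \<open>Y\<close> is one. Trace pairings are invariant
  under partial transposition, so for a PPT state sigma one has Tr rho sigma = Tr rho^T sigma^T <=
  Tr Y sigma^T = Tr Y^T sigma <= 1/4. The first inequality uses positivity of sigma^T, the second
  that of sigma; this is weak duality for a semidefinite program. Operator inequalities from one
  side only do not survive tensor products of indefinite operators, which is why both conditions on
  \<open>Y\<close> are two-sided. The constant: 2 rho is the projection onto the span of
  \<open>v1\<close> and \<open>v2\<close>, so 1/4 says that this projection has overlap at most 1/2
  with PPT states, exactly as for a single maximally entangled qubit pair. This is why mixing the
  two vectors makes neither quantity smaller than for one pair.\<close>

lemma index_mat_adjoint [simp]:
  fixes A :: "complex mat"
  assumes "i < dim_col A" "j < dim_row A"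
  shows "mat_adjoint A $$ (i, j) = cnj (A $$ (j, i))"
  using assms by (simp add: mat_adjoint_def mat_of_rows_index)

lemma dim_mat_adjoint [simp]:
  "dim_row (mat_adjoint A) = dim_col A" "dim_col (mat_adjoint A) = dim_row A"
  by (simp_all add: mat_adjoint_def)

lemma index_mult_mat_sum:
  assumes "A \<in> carrier_mat n m" "B \<in> carrier_mat m k" "i < n" "j < k"
  shows "(A * B) $$ (i, j) = (\<Sum>l<m. A $$ (i, l) * B $$ (l, j))"
  using assms by (auto simp: scalar_prod_def lessThan_atLeast0)

lemma index_mult_mat_vec_sum:
  assumes "A \<in> carrier_mat n m" "v \<in> carrier_vec m" "i < n"
  shows "(A *\<^sub>v v) $ i = (\<Sum>l<m. A $$ (i, l) * v $ l)"
  using assms by (auto simp: scalar_prod_def lessThan_atLeast0)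

lemma cscalar_prod_sum:
  fixes v w :: "complex vec"
  assumes "w \<in> carrier_vec n"
  shows "v \<bullet>c w = (\<Sum>i<n. v $ i * cnj (w $ i))"
  using assms by (auto simp: scalar_prod_def lessThan_atLeast0)

lemma hermitian_index:
  fixes A :: "complex mat"
  assumes "A \<in> carrier_mat d d" "mat_adjoint A = A" "i < d" "j < d"
  shows "cnj (A $$ (i, j)) = A $$ (j, i)"
  using index_mat_adjoint[of j A i] assms by auto

lemma mat_adjoint_mult:
  fixes A B :: "complex mat"
  assumes "A \<in> carrier_mat n m" "B \<in> carrier_mat m k"
  shows "mat_adjoint (A * B) = mat_adjoint B * mat_adjoint A"
proof (rule eq_matI)
  fix i j assume ij: "i < dim_row (mat_adjoint B * mat_adjoint A)"
    "j < dim_col (mat_adjoint B * mat_adjoint A)"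
  then have ij: "i < k" "j < n" using assms by auto
  have "mat_adjoint (A * B) $$ (i, j) = cnj ((A * B) $$ (j, i))"
    using ij assms by (subst index_mat_adjoint) auto
  also have "\<dots> = (\<Sum>l<m. mat_adjoint B $$ (i, l) * mat_adjoint A $$ (l, j))"
    using ij assms by (subst index_mult_mat_sum[of _ n m _ k]) (auto intro!: sum.cong)
  also have "\<dots> = (mat_adjoint B * mat_adjoint A) $$ (i, j)"
    using ij assms by (subst index_mult_mat_sum[of _ k m _ n]) auto
  finally show "mat_adjoint (A * B) $$ (i, j) = (mat_adjoint B * mat_adjoint A) $$ (i, j)" .
qed (use assms in auto)

lemma mat_adjoint_adjoint [simp]: "mat_adjoint (mat_adjoint A) = A" for A :: "complex mat"
  by (rule eq_matI) auto

lemma unitary_mult: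
  assumes "unitary d U" "unitary d V"
  shows "unitary d (U * V)"
proof -
  have U: "U \<in> carrier_mat d d" "mat_adjoint U \<in> carrier_mat d d"
    and V: "V \<in> carrier_mat d d" "mat_adjoint V \<in> carrier_mat d d"
    using assms by (auto simp: unitary_def)
  have "mat_adjoint (U * V) * (U * V) = mat_adjoint V * (mat_adjoint U * U) * V"
    using U V by (simp add: mat_adjoint_mult[of _ d d _ d] assoc_mult_mat[of _ d d _ d _ d]
        mult_carrier_mat[of _ d d _ d])
  also have "\<dots> = 1\<^sub>m d"
    using assms V by (simp add: unitary_def)
  finally have *: "mat_adjoint (U * V) * (U * V) = 1\<^sub>m d" .
  have "U * V \<in> carrier_mat d d" "mat_adjoint (U * V) \<in> carrier_mat d d" using U V by auto
  then show ?thesis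
    using * mat_mult_left_right_inverse[of "mat_adjoint (U * V)" d "U * V"] by (simp add: unitary_def)
qed

lemma unitaryI:
  assumes "U \<in> carrier_mat d d"
    and "\<And>i j. i < d \<Longrightarrow> j < d \<Longrightarrow> (\<Sum>k<d. cnj (U $$ (k, i)) * U $$ (k, j)) = (if i = j then 1 else 0)"
  shows "unitary d U"
proof -
  have "mat_adjoint U * U = 1\<^sub>m d"
  proof (rule eq_matI)
    fix i j assume "i < dim_row (1\<^sub>m d)" "j < dim_col (1\<^sub>m d)"
    then show "(mat_adjoint U * U) $$ (i, j) = 1\<^sub>m d $$ (i, j)"
      using assms by (subst index_mult_mat_sum[of _ d d _ d]) auto
  qed (use assms in auto)
  then show ?thesis
    using assms(1) mat_mult_left_right_inverse[of "mat_adjoint U" d U]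
    by (auto simp: unitary_def)
qed

lemma unitary_col_orthonormal:
  assumes "unitary d U" "i < d" "j < d"
  shows "(\<Sum>k<d. cnj (U $$ (k, i)) * U $$ (k, j)) = (if i = j then 1 else 0)"
proof -
  have U: "U \<in> carrier_mat d d" using assms by (simp add: unitary_def)
  have "(\<Sum>k<d. cnj (U $$ (k, i)) * U $$ (k, j)) = (mat_adjoint U * U) $$ (i, j)"
    using U assms by (subst index_mult_mat_sum[of _ d d _ d]) auto
  then show ?thesis using assms by (simp add: unitary_def)
qed

text \<open>Supplies the deflation step of the spectral theorem: an eigenvector is completed to a
  basis, orthogonalized and normalized.\<close>

lemma exists_unitary_with_eigenvector:
  fixes A :: "complex mat"
  assumes A: "A \<in> carrier_mat d d" and d: "d > 0"
  shows "\<exists>U e. unitary d U \<and> A *\<^sub>v col U 0 = e \<cdot>\<^sub>v col U 0"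
proof -
  obtain e where "eigenvalue A e"
    using spectrum_non_empty[OF A d] by (auto simp: spectrum_def)
  then obtain v where v: "v \<in> carrier_vec d" "v \<noteq> 0\<^sub>v d" "A *\<^sub>v v = e \<cdot>\<^sub>v v"
    using A by (auto simp: eigenvalue_def eigenvector_def)
  interpret cof_vec_space d "TYPE(complex)" .
  define b where "b = basis_completion v"
  note bc = basis_completion[OF v(1,2), folded b_def]
  \<comment> \<open>\<open>gram_schmidt\<close> keeps the first vector and does not normalize. Hence
    the eigenvector survives as \<open>ws ! 0\<close>, and the columns of \<open>U\<close> below are
    divided by their norms \<open>sqrt (g j)\<close>.\<close>
  define ws where "ws = gram_schmidt d b"
  have ws: "set ws \<subseteq> carrier_vec d" "corthogonal ws" "length ws = d"
    using gram_schmidt_result[OF bc(2,4,5) ws_def] bc(6) by auto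
  obtain vs where bv: "b = v # vs" using bc(6,7) d by (cases b) auto
  have hd: "ws ! 0 = v"
    using gram_schmidt_hd[OF v(1), of vs, folded bv] ws(3) d
    by (metis ws_def hd_conv_nth length_greater_0_conv)
  have wsc: "ws ! i \<in> carrier_vec d" if "i < d" for i using ws that by auto
  define g where "g i = (\<Sum>k<d. (cmod (ws ! i $ k))\<^sup>2)" for i
  have self: "ws ! i \<bullet>c ws ! i = complex_of_real (g i)" if "i < d" for i
    using that wsc[OF that] by (simp add: cscalar_prod_sum complex_norm_square g_def del: of_real_power)
  have gpos: "g i > 0" if "i < d" for i
  proof -
    have "ws ! i \<bullet>c ws ! i \<noteq> 0" using corthogonalD[OF ws(2), of i i] ws(3) that by simp
    then have "g i \<noteq> 0" using self[OF that] by auto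
    moreover have "g i \<ge> 0" unfolding g_def by (simp add: sum_nonneg)
    ultimately show ?thesis by linarith
  qed
  define U where "U = Matrix.mat d d (\<lambda>(i, j). complex_of_real (1 / sqrt (g j)) * ws ! j $ i)"
  have U: "U \<in> carrier_mat d d" by (simp add: U_def)
  have "unitary d U"
  proof (rule unitaryI[OF U])
    fix i j assume ij: "i < d" "j < d"
    have "(\<Sum>k<d. cnj (U $$ (k, i)) * U $$ (k, j)) =
        complex_of_real (1 / sqrt (g i) * (1 / sqrt (g j))) * (ws ! j \<bullet>c ws ! i)"
      using ij wsc by (simp add: U_def cscalar_prod_sum[of _ d] sum_distrib_left sum_divide_distrib mult_ac)
    also have "\<dots> = (if i = j then 1 else 0)"
    proof (cases "i = j")
      case True
      then show ?thesis using self[OF ij(2)] gpos[OF ij(2)] 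
        by (simp flip: of_real_mult add: real_sqrt_mult_self divide_simps)
    next
      case False
      then show ?thesis using corthogonalD[OF ws(2), of j i] ij ws(3) by simp
    qed
    finally show "(\<Sum>k<d. cnj (U $$ (k, i)) * U $$ (k, j)) = (if i = j then 1 else 0)" .
  qed
  moreover have "A *\<^sub>v col U 0 = e \<cdot>\<^sub>v col U 0"
  proof -
    have c: "col U 0 = complex_of_real (1 / sqrt (g 0)) \<cdot>\<^sub>v v"
      using d hd v(1) by (intro eq_vecI) (auto simp: U_def)
    show ?thesis
      unfolding c using A v by (simp add: mult_mat_vec smult_smult_assoc mult.commute)
  qed
  ultimately show ?thesis by blast
qed

text \<open>Induction on the dimension. In a basis that starts with an eigenvector the first column
  of the matrix is a multiple of the first unit vector; by Hermiticity so is the first row, and the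
  remaining block is Hermitian of smaller size.\<close>

theorem hermitian_spectral_decomp:
  assumes "A \<in> carrier_mat d d" "mat_adjoint A = A"
  shows "\<exists>U r. spectral_decomp d A U r"
  using assms
proof (induction d arbitrary: A)
  case 0
  have "unitary 0 (1\<^sub>m 0)" by (auto simp: unitary_def intro!: eq_matI)
  then show ?case using 0
    by (intro exI[of _ "1\<^sub>m 0"] exI[of _ "\<lambda>_. 0"]) (auto simp: spectral_decomp_def intro!: eq_matI)
next
  case (Suc d)
  note A = Suc.prems(1)
  obtain W e where W: "unitary (Suc d) W" and ev: "A *\<^sub>v col W 0 = e \<cdot>\<^sub>v col W 0"
    using exists_unitary_with_eigenvector[OF A] by auto
  let ?W' = "mat_adjoint W"
  have Wc: "W \<in> carrier_mat (Suc d) (Suc d)" and W'c: "?W' \<in> carrier_mat (Suc d) (Suc d)"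
    and WW: "?W' * W = 1\<^sub>m (Suc d)" "W * ?W' = 1\<^sub>m (Suc d)"
    using W by (auto simp: unitary_def)
  define B where "B = ?W' * A * W"
  have B: "B \<in> carrier_mat (Suc d) (Suc d)" using Wc W'c A by (auto simp: B_def)
  have Bh: "mat_adjoint B = B"
    unfolding B_def using Wc W'c A Suc.prems(2)
    by (simp add: mat_adjoint_mult[of _ "Suc d" "Suc d" _ "Suc d"]
        assoc_mult_mat[of _ "Suc d" "Suc d" _ "Suc d" _ "Suc d"])
  have B0: "B $$ (i, 0) = (if i = 0 then e else 0)" if i: "i < Suc d" for i
  proof -
    have AW: "(A * W) $$ (k, 0) = e * W $$ (k, 0)" if "k < Suc d" for k
    proof -
      have "(A * W) $$ (k, 0) = (A *\<^sub>v col W 0) $ k"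
        using A Wc that by simp
      also have "\<dots> = e * W $$ (k, 0)"
        unfolding ev using Wc that by simp
      finally show ?thesis .
    qed
    have "B $$ (i, 0) = (?W' * (A * W)) $$ (i, 0)"
      unfolding B_def using A Wc W'c by (simp add: assoc_mult_mat[of _ "Suc d" "Suc d" _ "Suc d" _ "Suc d"])
    also have "\<dots> = (\<Sum>k<Suc d. ?W' $$ (i, k) * (A * W) $$ (k, 0))"
      by (rule index_mult_mat_sum[OF W'c mult_carrier_mat[OF A Wc] i]) simp
    also have "\<dots> = (\<Sum>k<Suc d. e * (?W' $$ (i, k) * W $$ (k, 0)))"
      by (intro sum.cong refl) (use AW in auto)
    also have "\<dots> = e * (?W' * W) $$ (i, 0)"
      by (subst index_mult_mat_sum[OF W'c Wc i]) (simp_all add: sum_distrib_left del: sum.lessThan_Suc)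
    finally show ?thesis using i by (simp add: WW)
  qed
  have B0': "B $$ (0, j) = (if j = 0 then e else 0)" if "j < Suc d" for j
    using hermitian_index[OF B Bh that, of 0] hermitian_index[OF B Bh, of 0 0] B0[OF that] B0[of 0] by auto
  \<comment> \<open>The eigenvalue is a diagonal entry of the Hermitian matrix \<open>B\<close>,
    hence real.\<close>
  have ereal: "e = complex_of_real (Re e)"
    using hermitian_index[OF B Bh, of 0 0] B0[of 0] by (simp add: complex_eq_iff)
  define B1 where "B1 = Matrix.mat d d (\<lambda>(i, j). B $$ (Suc i, Suc j))"
  have "B1 \<in> carrier_mat d d" by (simp add: B1_def)
  moreover have "mat_adjoint B1 = B1"
    by (rule eq_matI) (use hermitian_index[OF B Bh] in \<open>auto simp: B1_def\<close>)
  ultimately obtain V r where Vr: "spectral_decomp d B1 V r" using Suc.IH by blast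
  then have V: "unitary d V" "V \<in> carrier_mat d d" "mat_adjoint V \<in> carrier_mat d d"
    and B1: "B1 = V * mat_diag d (\<lambda>i. complex_of_real (r i)) * mat_adjoint V"
    by (auto simp: spectral_decomp_def unitary_def)
  have "B1 * V = V * mat_diag d (\<lambda>i. complex_of_real (r i)) * (mat_adjoint V * V)"
    unfolding B1 using V(2,3)
    by (simp add: assoc_mult_mat[of _ d d _ d _ d] mult_carrier_mat[of _ d d _ d])
  also have "\<dots> = V * mat_diag d (\<lambda>i. complex_of_real (r i))"
    using V by (simp add: unitary_def right_mult_one_mat[of _ d d] mult_carrier_mat[of _ d d _ d])
  finally have B1V: "B1 * V = V * mat_diag d (\<lambda>i. complex_of_real (r i))" .
  have B1V: "(\<Sum>k<d. B $$ (Suc i, Suc k) * V $$ (k, j)) = V $$ (i, j) * complex_of_real (r j)"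
    if "i < d" "j < d" for i j
  proof -
    have "(\<Sum>k<d. B $$ (Suc i, Suc k) * V $$ (k, j)) = (B1 * V) $$ (i, j)"
      using that V \<open>B1 \<in> _\<close> by (subst index_mult_mat_sum[of _ d d _ d]) (auto simp: B1_def)
    then show ?thesis using that V unfolding B1V by (simp add: mat_diag_mult_right[of _ d d])
  qed
  \<comment> \<open>The direct sum of the 1 by 1 identity and \<open>V\<close>; it diagonalizes
    \<open>B\<close>, so \<open>W * V1\<close> diagonalizes \<open>A\<close>.\<close>
  define V1 where "V1 = Matrix.mat (Suc d) (Suc d)
    (\<lambda>(i, j). if i = 0 \<or> j = 0 then (if i = j then 1 else 0) else V $$ (i - 1, j - 1))"
  have V1: "V1 \<in> carrier_mat (Suc d) (Suc d)" by (simp add: V1_def)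
  define s where "s i = (case i of 0 \<Rightarrow> Re e | Suc i \<Rightarrow> r i)" for i
  have "unitary (Suc d) V1"
  proof (rule unitaryI[OF V1])
    fix i j assume "i < Suc d" "j < Suc d"
    then show "(\<Sum>k<Suc d. cnj (V1 $$ (k, i)) * V1 $$ (k, j)) = (if i = j then 1 else 0)"
      using unitary_col_orthonormal[OF V(1)]
      by (cases i; cases j) (auto simp: V1_def sum.lessThan_Suc_shift simp del: sum.lessThan_Suc)
  qed
  define U where "U = W * V1"
  have U: "unitary (Suc d) U"
    unfolding U_def by (rule unitary_mult) fact+
  let ?D = "mat_diag (Suc d) (\<lambda>i. complex_of_real (s i))"
  have BV: "B * V1 = V1 * ?D"
  proof (rule eq_matI)
    fix i j assume "i < dim_row (V1 * ?D)" "j < dim_col (V1 * ?D)"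
    then have ij: "i < Suc d" "j < Suc d" using V1 by (auto simp: mat_diag_def)
    have "(B * V1) $$ (i, j) = (\<Sum>k<Suc d. B $$ (i, k) * V1 $$ (k, j))"
      by (rule index_mult_mat_sum[OF B V1 ij])
    also have "\<dots> = V1 $$ (i, j) * complex_of_real (s j)"
      using ij B1V B0 B0' ereal
      by (cases i; cases j)
        (auto simp: V1_def s_def sum.lessThan_Suc_shift simp del: sum.lessThan_Suc)
    also have "\<dots> = (V1 * ?D) $$ (i, j)"
      using ij V1 by (simp add: mat_diag_mult_right[of _ "Suc d" "Suc d"])
    finally show "(B * V1) $$ (i, j) = (V1 * ?D) $$ (i, j)" .
  qed (use B V1 in \<open>auto simp: mat_diag_def\<close>)
  note carr = A Wc W'c V1 B mult_carrier_mat[of _ "Suc d" "Suc d" _ "Suc d"]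
  note assoc = assoc_mult_mat[of _ "Suc d" "Suc d" _ "Suc d" _ "Suc d"]
  have "W * B = A * W"
  proof -
    have "W * B = (W * ?W') * (A * W)" unfolding B_def using carr by (simp add: assoc)
    then show ?thesis using WW carr by (simp add: left_mult_one_mat[of _ "Suc d" "Suc d"])
  qed
  then have "A * U = W * (B * V1)"
    unfolding U_def
    by (simp only: assoc_mult_mat[OF A Wc V1, symmetric] assoc_mult_mat[OF Wc B V1, symmetric])
  then have AU: "A * U = U * ?D"
    unfolding BV U_def by (simp only: assoc_mult_mat[OF Wc V1 mat_diag_dim])
  have Uc: "U \<in> carrier_mat (Suc d) (Suc d)" "mat_adjoint U \<in> carrier_mat (Suc d) (Suc d)"
    "U * mat_adjoint U = 1\<^sub>m (Suc d)"
    using U by (auto simp: unitary_def)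
  have "A = A * (U * mat_adjoint U)" unfolding Uc using A by simp
  also have "\<dots> = U * ?D * mat_adjoint U" unfolding AU[symmetric] using A Uc(1,2)
    by (simp add: assoc_mult_mat[of A "Suc d" "Suc d" U "Suc d" _ "Suc d"])
  finally show ?case using U by (auto simp: spectral_decomp_def)
qed

section \<open>Positive semidefinite matrices and the trace norm\<close>

lemma spectral_decomp_index:
  assumes "spectral_decomp d A U r" "i < d" "j < d"
  shows "A $$ (i, j) = (\<Sum>k<d. complex_of_real (r k) * U $$ (i, k) * cnj (U $$ (j, k)))"
proof -
  have U: "U \<in> carrier_mat d d" and A: "A = U * mat_diag d (\<lambda>i. complex_of_real (r i)) * mat_adjoint U"
    using assms by (auto simp: spectral_decomp_def unitary_def)
  show ?thesis
    unfolding A mat_diag_mult_right[OF U] using U assms(2,3)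
    by (subst index_mult_mat_sum[of _ d d _ d]) (auto intro!: sum.cong)
qed

lemma spectral_decomp_carrier:
  assumes "spectral_decomp d A U r"
  shows "A \<in> carrier_mat d d"
  using assms by (auto simp: spectral_decomp_def unitary_def)

lemma psd_alt:
  "psd d A \<longleftrightarrow> A \<in> carrier_mat d d \<and> mat_adjoint A = A \<and>
     (\<forall>f. 0 \<le> Re (\<Sum>i<d. \<Sum>j<d. cnj (f i) * A $$ (i, j) * f j))"
proof -
  have *: "(A *\<^sub>v v) \<bullet>c v = (\<Sum>i<d. \<Sum>j<d. cnj (f i) * A $$ (i, j) * f j)"
    if "A \<in> carrier_mat d d" "v = vec d f" for v f
    using that by (simp add: cscalar_prod_sum[of _ d] index_mult_mat_vec_sum[of _ d d]
        sum_distrib_left mult_ac del: index_mult_mat_vec)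
  show ?thesis
  proof (intro iffI conjI allI)
    assume A: "psd d A"
    then show c: "A \<in> carrier_mat d d" and "mat_adjoint A = A"
      by (auto simp: psd_def)
    show "0 \<le> Re (\<Sum>i<d. \<Sum>j<d. cnj (f i) * A $$ (i, j) * f j)" for f
      unfolding *[OF c refl, symmetric] using A by (auto simp: psd_def)
  next
    assume A: "A \<in> carrier_mat d d \<and> mat_adjoint A = A \<and>
      (\<forall>f. 0 \<le> Re (\<Sum>i<d. \<Sum>j<d. cnj (f i) * A $$ (i, j) * f j))"
    have "0 \<le> Re ((A *\<^sub>v v) \<bullet>c v)" if "v \<in> carrier_vec d" for v
    proof -
      have "v = vec d (\<lambda>i. v $ i)" using that by auto
      from *[OF _ this] A show ?thesis by simp
    qed
    then show "psd d A" using A by (simp add: psd_def)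
  qed
qed

text \<open>With a Gram factorization the quadratic form is a sum of squared moduli. The index set
  is an arbitrary finite set so that tensor products and Kraus maps can use pairs as
  indices.\<close>

lemma psd_gramI:
  assumes A: "A \<in> carrier_mat d d" and "finite K"
    and Z: "\<And>i j. i < d \<Longrightarrow> j < d \<Longrightarrow> A $$ (i, j) = (\<Sum>k\<in>K. Z i k * cnj (Z j k))"
  shows "psd d A"
proof -
  have "mat_adjoint A = A"
    by (rule eq_matI) (use A Z in \<open>auto simp: mult.commute\<close>)
  moreover have "0 \<le> Re (\<Sum>i<d. \<Sum>j<d. cnj (f i) * A $$ (i, j) * f j)" for f
  proof -
    have "(\<Sum>i<d. \<Sum>j<d. cnj (f i) * A $$ (i, j) * f j) =
        (\<Sum>i<d. \<Sum>j<d. \<Sum>k\<in>K. (cnj (f i) * Z i k) * cnj (cnj (f j) * Z j k))"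
      by (intro sum.cong refl) (simp add: Z sum_distrib_left sum_distrib_right mult_ac)
    also have "\<dots> = (\<Sum>i<d. \<Sum>k\<in>K. \<Sum>j<d. (cnj (f i) * Z i k) * cnj (cnj (f j) * Z j k))"
      by (intro sum.cong refl sum.swap)
    also have "\<dots> = (\<Sum>k\<in>K. \<Sum>i<d. \<Sum>j<d. (cnj (f i) * Z i k) * cnj (cnj (f j) * Z j k))"
      by (rule sum.swap)
    also have "\<dots> = (\<Sum>k\<in>K. (\<Sum>i<d. cnj (f i) * Z i k) * cnj (\<Sum>j<d. cnj (f j) * Z j k))"
      by (simp only: sum_product cnj_sum)
    also have "\<dots> = complex_of_real (\<Sum>k\<in>K. (cmod (\<Sum>i<d. cnj (f i) * Z i k))\<^sup>2)"
      by (simp only: of_real_sum complex_norm_square)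
    finally show ?thesis by (simp add: sum_nonneg)
  qed
  ultimately show ?thesis using A by (simp add: psd_alt)
qed

lemma psd_hermitian:
  assumes "psd d A"
  shows "A \<in> carrier_mat d d" "mat_adjoint A = A"
  using assms by (auto simp: psd_def)

text \<open>By orthonormality of the columns of \<open>U\<close>, the quadratic form of
  \<open>A\<close> at the k-th column is \<open>r k\<close>.\<close>

lemma spectral_decomp_psd_nonneg:
  assumes "psd d A" "spectral_decomp d A U r" "k < d"
  shows "0 \<le> r k"
proof -
  have U: "unitary d U" using assms by (simp add: spectral_decomp_def)
  have "(\<Sum>i<d. \<Sum>j<d. cnj (U $$ (i, k)) * A $$ (i, j) * U $$ (j, k)) =
     (\<Sum>i<d. \<Sum>j<d. \<Sum>l<d. complex_of_real (r l) * (cnj (U $$ (i, k)) * U $$ (i, l)) * (cnj (U $$ (j, l)) * U $$ (j, k)))"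
    by (intro sum.cong refl)
      (simp add: spectral_decomp_index[OF assms(2)] sum_distrib_left sum_distrib_right mult_ac)
  also have "\<dots> = (\<Sum>i<d. \<Sum>l<d. \<Sum>j<d. complex_of_real (r l) * (cnj (U $$ (i, k)) * U $$ (i, l)) * (cnj (U $$ (j, l)) * U $$ (j, k)))"
    by (intro sum.cong refl sum.swap)
  also have "\<dots> = (\<Sum>l<d. \<Sum>i<d. \<Sum>j<d. complex_of_real (r l) * (cnj (U $$ (i, k)) * U $$ (i, l)) * (cnj (U $$ (j, l)) * U $$ (j, k)))"
    by (rule sum.swap)
  also have "\<dots> = (\<Sum>l<d. complex_of_real (r l) * ((\<Sum>i<d. cnj (U $$ (i, k)) * U $$ (i, l)) * (\<Sum>j<d. cnj (U $$ (j, l)) * U $$ (j, k))))"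
    by (intro sum.cong refl, subst sum_product) (simp add: sum_distrib_left mult_ac)
  also have "\<dots> = (\<Sum>l<d. if l = k then complex_of_real (r l) else 0)"
    using assms(3) by (intro sum.cong refl) (auto simp: unitary_col_orthonormal[OF U])
  also have "\<dots> = complex_of_real (r k)"
    using assms(3) by simp
  finally have *: "(\<Sum>i<d. \<Sum>j<d. cnj (U $$ (i, k)) * A $$ (i, j) * U $$ (j, k)) = complex_of_real (r k)" .
  have "0 \<le> Re (\<Sum>i<d. \<Sum>j<d. cnj (U $$ (i, k)) * A $$ (i, j) * U $$ (j, k))"
    using assms(1) unfolding psd_alt by (elim conjE allE[where x = "\<lambda>i. U $$ (i, k)"])
  then show ?thesis by (simp only: * Re_complex_of_real)
qed

text \<open>The converse of \<open>psd_gramI\<close>: scale the k-th eigenvector by the square root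
  of its eigenvalue.\<close>

lemma psd_gram:
  assumes "psd d A"
  obtains Z :: "nat \<Rightarrow> nat \<Rightarrow> complex"
  where "\<And>i j. i < d \<Longrightarrow> j < d \<Longrightarrow> A $$ (i, j) = (\<Sum>k<d. Z i k * cnj (Z j k))"
proof -
  obtain U r where Ur: "spectral_decomp d A U r"
    using hermitian_spectral_decomp[OF psd_hermitian[OF assms]] by blast
  have "A $$ (i, j) = (\<Sum>k<d. (complex_of_real (sqrt (r k)) * U $$ (i, k)) *
      cnj (complex_of_real (sqrt (r k)) * U $$ (j, k)))" if "i < d" "j < d" for i j
    unfolding spectral_decomp_index[OF Ur that]
  proof (intro sum.cong refl)
    fix k assume "k \<in> {..<d}"
    then have "r k \<ge> 0" using spectral_decomp_psd_nonneg[OF assms Ur] by simp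
    then have "complex_of_real (r k) = complex_of_real (sqrt (r k)) * complex_of_real (sqrt (r k))"
      by (simp flip: of_real_mult)
    then show "complex_of_real (r k) * U $$ (i, k) * cnj (U $$ (j, k)) =
      (complex_of_real (sqrt (r k)) * U $$ (i, k)) * cnj (complex_of_real (sqrt (r k)) * U $$ (j, k))"
      by simp
  qed
  then show ?thesis by (rule that)
qed

lemma psd_add:
  assumes "psd d A" "psd d B"
  shows "psd d (A + B)"
proof -
  have c: "A \<in> carrier_mat d d" "B \<in> carrier_mat d d" using assms by (auto simp: psd_def)
  have "mat_adjoint (A + B) = A + B"
    by (rule eq_matI)
      (use c hermitian_index[OF psd_hermitian[OF assms(1)]] hermitian_index[OF psd_hermitian[OF assms(2)]] in auto)
  moreover have "(\<Sum>i<d. \<Sum>j<d. cnj (f i) * (A + B) $$ (i, j) * f j) =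
     (\<Sum>i<d. \<Sum>j<d. cnj (f i) * A $$ (i, j) * f j) + (\<Sum>i<d. \<Sum>j<d. cnj (f i) * B $$ (i, j) * f j)" for f
    using c by (simp add: algebra_simps sum.distrib)
  ultimately show ?thesis
    using assms c by (auto simp: psd_alt)
qed

lemma psd_smult:
  assumes "psd d A" "0 \<le> c"
  shows "psd d (complex_of_real c \<cdot>\<^sub>m A)"
proof -
  have A: "A \<in> carrier_mat d d" using assms by (auto simp: psd_def)
  obtain Z where Z: "\<And>i j. i < d \<Longrightarrow> j < d \<Longrightarrow> A $$ (i, j) = (\<Sum>k<d. Z i k * cnj (Z j k))"
    using psd_gram[OF assms(1)] by blast
  have c: "complex_of_real c = complex_of_real (sqrt c) * complex_of_real (sqrt c)"
    using assms(2) by (simp flip: of_real_mult)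
  show ?thesis
    by (rule psd_gramI[of _ _ "{..<d}" "\<lambda>i k. complex_of_real (sqrt c) * Z i k"])
      (use A in \<open>auto simp: Z c sum_distrib_left mult_ac\<close>)
qed

lemma mtrace_mult:
  assumes "A \<in> carrier_mat d d" "B \<in> carrier_mat d d"
  shows "mtrace (A * B) = (\<Sum>i<d. \<Sum>j<d. A $$ (i, j) * B $$ (j, i))"
proof -
  have "mtrace (A * B) = (\<Sum>i<d. (A * B) $$ (i, i))" using assms by (simp add: mtrace_def)
  also have "\<dots> = (\<Sum>i<d. \<Sum>j<d. A $$ (i, j) * B $$ (j, i))"
    by (intro sum.cong refl index_mult_mat_sum[of _ d d _ d]) (use assms in auto)
  finally show ?thesis .
qed

lemma mtrace_minus:
  assumes "A \<in> carrier_mat d d" "B \<in> carrier_mat d d"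
  shows "mtrace (A - B) = mtrace A - mtrace B"
  using assms by (simp add: mtrace_def sum_subtractf)

text \<open>After a Gram factorization of \<open>A\<close> the trace is a sum of values of the
  quadratic form of \<open>B\<close>, one for each column of the factor.\<close>

lemma mtrace_mult_psd:
  assumes "psd d A" "psd d B"
  shows "0 \<le> Re (mtrace (A * B))"
proof -
  obtain Z where Z: "\<And>i j. i < d \<Longrightarrow> j < d \<Longrightarrow> A $$ (i, j) = (\<Sum>k<d. Z i k * cnj (Z j k))"
    using psd_gram[OF assms(1)] by blast
  have B: "0 \<le> Re (\<Sum>i<d. \<Sum>j<d. cnj (f i) * B $$ (i, j) * f j)" for f
    using assms by (simp add: psd_alt)
  have "mtrace (A * B) = (\<Sum>j<d. \<Sum>i<d. A $$ (i, j) * B $$ (j, i))"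
    using assms by (subst mtrace_mult[of _ d]) (auto simp: psd_def intro: sum.swap)
  also have "\<dots> = (\<Sum>j<d. \<Sum>i<d. \<Sum>k<d. cnj (Z j k) * B $$ (j, i) * Z i k)"
    by (intro sum.cong refl) (simp add: Z sum_distrib_left sum_distrib_right mult_ac)
  also have "\<dots> = (\<Sum>j<d. \<Sum>k<d. \<Sum>i<d. cnj (Z j k) * B $$ (j, i) * Z i k)"
    by (intro sum.cong refl sum.swap)
  also have "\<dots> = (\<Sum>k<d. \<Sum>j<d. \<Sum>i<d. cnj (Z j k) * B $$ (j, i) * Z i k)"
    by (rule sum.swap)
  finally show ?thesis by (simp only:) (subst Re_sum, intro sum_nonneg B)
qed

lemma mtrace_mult_psd_mono:
  assumes "psd d (B - A)" "psd d C" "A \<in> carrier_mat d d" "B \<in> carrier_mat d d"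
  shows "Re (mtrace (A * C)) \<le> Re (mtrace (B * C))"
proof -
  have C: "C \<in> carrier_mat d d" using assms by (simp add: psd_def)
  have "mtrace ((B - A) * C) = mtrace (B * C) - mtrace (A * C)"
    using assms(3,4) C by (simp add: minus_mult_distrib_mat[of _ d d _ _ d] mtrace_minus[of _ d])
  then show ?thesis using mtrace_mult_psd[OF assms(1,2)] by simp
qed

section \<open>Traces evaluated in an eigenbasis\<close>

lemma mtrace_comm:
  assumes "A \<in> carrier_mat d d" "B \<in> carrier_mat d d"
  shows "mtrace (A * B) = mtrace (B * A)"
  using assms by (subst (1 2) mtrace_mult[of _ d]) (auto simp: mult.commute intro: sum.swap)

lemma mtrace_smult:
  assumes "A \<in> carrier_mat d d"
  shows "mtrace (c \<cdot>\<^sub>m A) = c * mtrace A"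
  using assms by (simp add: mtrace_def sum_distrib_left)

text \<open>The diagonal entry of \<open>M\<close> at the k-th column of \<open>U\<close>. For a
  state \<open>M\<close> and unitary \<open>U\<close> these are the outcome probabilities of
  measuring \<open>M\<close> in the basis of columns, which turns the later trace estimates into
  scalar ones.\<close>

definition eigen_weight :: "nat \<Rightarrow> complex mat \<Rightarrow> complex mat \<Rightarrow> nat \<Rightarrow> complex" where
  "eigen_weight d M U k = (\<Sum>i<d. \<Sum>j<d. cnj (U $$ (i, k)) * M $$ (i, j) * U $$ (j, k))"

lemma mtrace_mult_spectral:
  assumes M: "M \<in> carrier_mat d d" and "spectral_decomp d A U r"
  shows "mtrace (M * A) = (\<Sum>k<d. complex_of_real (r k) * eigen_weight d M U k)"
proof -
  note A = spectral_decomp_carrier[OF assms(2)]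
  have "mtrace (M * A) = (\<Sum>i<d. \<Sum>j<d. \<Sum>k<d. complex_of_real (r k) * (cnj (U $$ (i, k)) * M $$ (i, j) * U $$ (j, k)))"
    unfolding mtrace_mult[OF M A]
    by (intro sum.cong refl) (simp add: spectral_decomp_index[OF assms(2)] sum_distrib_left mult_ac)
  also have "\<dots> = (\<Sum>i<d. \<Sum>k<d. \<Sum>j<d. complex_of_real (r k) * (cnj (U $$ (i, k)) * M $$ (i, j) * U $$ (j, k)))"
    by (intro sum.cong refl sum.swap)
  also have "\<dots> = (\<Sum>k<d. \<Sum>i<d. \<Sum>j<d. complex_of_real (r k) * (cnj (U $$ (i, k)) * M $$ (i, j) * U $$ (j, k)))"
    by (rule sum.swap)
  finally show ?thesis by (simp only: eigen_weight_def sum_distrib_left)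
qed

lemma spectral_decomp_spectral_fun:
  assumes "spectral_decomp d A U r"
  shows "spectral_decomp d (spectral_fun d f A) U (\<lambda>i. f (r i))"
  using assms spectral_fun_eq[OF assms] by (simp add: spectral_decomp_def)

lemma spectral_decomp_one:
  assumes "spectral_decomp d A U r"
  shows "spectral_decomp d (1\<^sub>m d) U (\<lambda>_. 1)"
proof -
  have U: "U \<in> carrier_mat d d" "U * mat_adjoint U = 1\<^sub>m d"
    using assms by (auto simp: spectral_decomp_def unitary_def)
  have "mat_diag d (\<lambda>_. 1 :: complex) = 1\<^sub>m d" by (rule eq_matI) (auto simp: mat_diag_def)
  then show ?thesis using U assms by (simp add: spectral_decomp_def)
qed

text \<open>The identity is diagonal in every orthonormal basis, with all eigenvalues 1.\<close>

lemma sum_eigen_weight: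
  assumes "M \<in> carrier_mat d d" "spectral_decomp d A U r"
  shows "(\<Sum>k<d. eigen_weight d M U k) = mtrace M"
  using mtrace_mult_spectral[OF assms(1) spectral_decomp_one[OF assms(2)]] assms(1) by simp

lemma eigen_weight_nonneg:
  assumes "psd d M"
  shows "0 \<le> Re (eigen_weight d M U k)"
  using assms by (simp add: psd_alt eigen_weight_def)

lemma spectral_decomp_eigen:
  assumes "spectral_decomp d A U r" "i < d" "k < d"
  shows "(\<Sum>j<d. A $$ (i, j) * U $$ (j, k)) = complex_of_real (r k) * U $$ (i, k)"
proof -
  have U: "unitary d U" using assms by (simp add: spectral_decomp_def)
  have "(\<Sum>j<d. A $$ (i, j) * U $$ (j, k)) =
     (\<Sum>j<d. \<Sum>l<d. complex_of_real (r l) * U $$ (i, l) * (cnj (U $$ (j, l)) * U $$ (j, k)))"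
    by (intro sum.cong refl)
      (simp add: spectral_decomp_index[OF assms(1,2)] sum_distrib_left sum_distrib_right mult_ac)
  also have "\<dots> = (\<Sum>l<d. \<Sum>j<d. complex_of_real (r l) * U $$ (i, l) * (cnj (U $$ (j, l)) * U $$ (j, k)))"
    by (rule sum.swap)
  also have "\<dots> = (\<Sum>l<d. complex_of_real (r l) * U $$ (i, l) * (if l = k then 1 else 0))"
    using assms(3) by (intro sum.cong refl)
      (simp add: unitary_col_orthonormal[OF U] flip: sum_distrib_left)
  also have "\<dots> = (\<Sum>l<d. if l = k then complex_of_real (r l) * U $$ (i, l) else 0)"
    by (intro sum.cong) auto
  finally show ?thesis using assms(3) by simp
qed

lemma mult_col_spectral:
  assumes "spectral_decomp d A U r" "k < d"
  shows "A *\<^sub>v col U k = complex_of_real (r k) \<cdot>\<^sub>v col U k"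
proof (rule eq_vecI)
  have U: "U \<in> carrier_mat d d" using assms by (simp add: spectral_decomp_def unitary_def)
  note A = spectral_decomp_carrier[OF assms(1)]
  show "dim_vec (A *\<^sub>v col U k) = dim_vec (complex_of_real (r k) \<cdot>\<^sub>v col U k)" using A U by simp
  fix i assume "i < dim_vec (complex_of_real (r k) \<cdot>\<^sub>v col U k)"
  then have i: "i < d" using U by simp
  have "(A *\<^sub>v col U k) $ i = (\<Sum>j<d. A $$ (i, j) * U $$ (j, k))"
    using A U i assms(2) by (subst index_mult_mat_vec_sum[of _ d d]) auto
  then show "(A *\<^sub>v col U k) $ i = (complex_of_real (r k) \<cdot>\<^sub>v col U k) $ i"
    using spectral_decomp_eigen[OF assms(1) i assms(2)] U i assms(2) by simp
qed

lemma eigen_weight_eigen: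
  assumes "spectral_decomp d A U r" "k < d"
  shows "eigen_weight d A U k = complex_of_real (r k)"
proof -
  have U: "unitary d U" using assms by (simp add: spectral_decomp_def)
  have "eigen_weight d A U k = (\<Sum>i<d. cnj (U $$ (i, k)) * (\<Sum>j<d. A $$ (i, j) * U $$ (j, k)))"
    by (simp add: eigen_weight_def sum_distrib_left mult_ac)
  also have "\<dots> = (\<Sum>i<d. complex_of_real (r k) * (cnj (U $$ (i, k)) * U $$ (i, k)))"
    by (intro sum.cong refl) (use spectral_decomp_eigen[OF assms(1) _ assms(2)] in simp)
  also have "\<dots> = complex_of_real (r k) * (\<Sum>i<d. cnj (U $$ (i, k)) * U $$ (i, k))"
    by (rule sum_distrib_left[symmetric])
  finally show ?thesis using unitary_col_orthonormal[OF U assms(2,2)] by simp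
qed

lemma spectral_decomp_mult:
  assumes "spectral_decomp d A U r" "spectral_decomp d B U s"
  shows "spectral_decomp d (A * B) U (\<lambda>i. r i * s i)"
proof -
  have U: "U \<in> carrier_mat d d" "mat_adjoint U \<in> carrier_mat d d" "mat_adjoint U * U = 1\<^sub>m d"
    using assms by (auto simp: spectral_decomp_def unitary_def)
  define R S where "R = mat_diag d (\<lambda>i. complex_of_real (r i))" and "S = mat_diag d (\<lambda>i. complex_of_real (s i))"
  have RS: "R \<in> carrier_mat d d" "S \<in> carrier_mat d d" by (auto simp: R_def S_def)
  note carr = U(1,2) RS
  note assoc = assoc_mult_mat[of _ d d _ d _ d] mult_carrier_mat[of _ d d _ d]
  have "A * B = (U * R * mat_adjoint U) * (U * S * mat_adjoint U)"
    using assms by (simp add: spectral_decomp_def R_def S_def)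
  also have "\<dots> = (U * R) * (mat_adjoint U * U) * (S * mat_adjoint U)"
    using carr by (simp add: assoc)
  also have "\<dots> = U * (R * S) * mat_adjoint U"
    unfolding U(3) using carr by (simp add: assoc)
  also have "R * S = mat_diag d (\<lambda>i. complex_of_real (r i * s i))"
    by (simp add: R_def S_def mat_diag_diag)
  finally show ?thesis using assms by (simp add: spectral_decomp_def)
qed

text \<open>For Hermitian \<open>X\<close> the operator under the square root is the square of
  \<open>X\<close>, which has eigenvalues \<open>r i * r i\<close> in the same basis.\<close>

lemma trace_norm_hermitian:
  assumes "spectral_decomp d X U r"
  shows "trace_norm d X = (\<Sum>k<d. \<bar>r k\<bar>)"
proof -
  have herm: "mat_adjoint X = X"
    by (rule eq_matI)
      (use spectral_decomp_carrier[OF assms] spectral_decomp_index[OF assms] in \<open>auto simp: mult_ac\<close>)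
  have "spectral_decomp d (spectral_fun d sqrt (mat_adjoint X * X)) U (\<lambda>i. sqrt (r i * r i))"
    unfolding herm by (rule spectral_decomp_spectral_fun[OF spectral_decomp_mult[OF assms assms]])
  then have sd: "spectral_decomp d (spectral_fun d sqrt (mat_adjoint X * X)) U (\<lambda>i. \<bar>r i\<bar>)" by simp
  have "mtrace (spectral_fun d sqrt (mat_adjoint X * X)) = (\<Sum>k<d. complex_of_real \<bar>r k\<bar>)"
    using sum_eigen_weight[OF spectral_decomp_carrier[OF sd] sd]
      eigen_weight_eigen[OF sd] by simp
  then show ?thesis by (simp add: trace_norm_def)
qed

lemma trace_norm_zero: "trace_norm d (0\<^sub>m d d) = 0"
proof -
  have "mat_adjoint (0\<^sub>m d d :: complex mat) = 0\<^sub>m d d" by (rule eq_matI) auto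
  then obtain U r where sd: "spectral_decomp d (0\<^sub>m d d) U r"
    using hermitian_spectral_decomp[of "0\<^sub>m d d" d] by auto
  have "r k = 0" if "k < d" for k
    using eigen_weight_eigen[OF sd that] that by (simp add: eigen_weight_def)
  then show ?thesis using trace_norm_hermitian[OF sd] by simp
qed

text \<open>In the eigenbasis of \<open>X\<close> the weights of a test \<open>Q\<close> between 0
  and 1 lie in [0,1], so each eigenvalue contributes at most its absolute value. Used to bound the
  formation error from below by a single test.\<close>

lemma mtrace_le_trace_norm:
  assumes Q: "psd d Q" "psd d (1\<^sub>m d - Q)" and X: "X \<in> carrier_mat d d" "mat_adjoint X = X"
  shows "Re (mtrace (Q * X)) \<le> trace_norm d X"
proof -
  obtain U r where sd: "spectral_decomp d X U r" using hermitian_spectral_decomp[OF X] by blast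
  have Qc: "Q \<in> carrier_mat d d" using Q by (simp add: psd_def)
  have "r k * Re (eigen_weight d Q U k) \<le> \<bar>r k\<bar>" if "k < d" for k
  proof -
    have "eigen_weight d (1\<^sub>m d) U k - eigen_weight d Q U k = eigen_weight d (1\<^sub>m d - Q) U k"
      using Qc by (simp add: eigen_weight_def algebra_simps sum_subtractf)
    moreover have "eigen_weight d (1\<^sub>m d) U k = 1"
      using eigen_weight_eigen[OF spectral_decomp_one[OF sd] that] by simp
    ultimately have "Re (eigen_weight d Q U k) \<le> 1"
      using eigen_weight_nonneg[OF Q(2), of U k] by (simp add: complex_eq_iff)
    then have "\<bar>r k\<bar> * Re (eigen_weight d Q U k) \<le> \<bar>r k\<bar>" by (simp add: mult_left_le)
    moreover have "r k * Re (eigen_weight d Q U k) \<le> \<bar>r k\<bar> * Re (eigen_weight d Q U k)"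
      using eigen_weight_nonneg[OF Q(1), of U k] by (intro mult_right_mono) auto
    ultimately show ?thesis by linarith
  qed
  then show ?thesis
    unfolding mtrace_mult_spectral[OF Qc sd] trace_norm_hermitian[OF sd]
    by (auto intro!: sum_mono)
qed

section \<open>Partial transposes and bipartite tensor powers\<close>

lemma pair_index_less:
  assumes "a < m" "b < n"
  shows "a * n + b < m * (n :: nat)"
proof -
  have "a * n + b < Suc a * n" using assms by simp
  also have "\<dots> \<le> m * n" using assms by (intro mult_right_mono) auto
  finally show ?thesis .
qed

lemma pair_index_div_mod:
  assumes "b < n"
  shows "(a * n + b) div n = a" "(a * n + b) mod n = (b :: nat)"
  using assms by simp_all

lemma sum_pair_index:
  fixes f :: "nat \<Rightarrow> 'a :: comm_monoid_add"
  shows "(\<Sum>p<m * n. f p) = (\<Sum>a<m. \<Sum>b<n. f (a * n + b))"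
proof -
  have "sum f {a * n..<a * n + n} = (\<Sum>b<n. f (a * n + b))" for a
    by (rule sum.reindex_bij_witness[where i = "\<lambda>b. a * n + b" and j = "\<lambda>p. p - a * n"]) auto
  then show ?thesis by (simp flip: sum.nat_group)
qed

text \<open>Alice's part of \<open>p\<close> with Bob's part of \<open>q\<close>. The map from (p,
  q) to (\<open>pt_index dB p q\<close>, \<open>pt_index dB q p\<close>) is an involution on index
  pairs; facts about partial transposes reduce to reindexing by it.\<close>

definition pt_index :: "nat \<Rightarrow> nat \<Rightarrow> nat \<Rightarrow> nat" where
  "pt_index dB p q = (p div dB) * dB + q mod dB"

lemma index_ptranspose:
  assumes "p < dA * dB" "q < dA * dB"
  shows "ptranspose dA dB X $$ (p, q) = X $$ (pt_index dB p q, pt_index dB q p)"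
  using assms by (simp add: ptranspose_def pt_index_def)

lemma ptranspose_carrier [simp]: "ptranspose dA dB X \<in> carrier_mat (dA * dB) (dA * dB)"
  by (simp add: ptranspose_def)

lemma dim_ptranspose [simp]:
  "dim_row (ptranspose dA dB X) = dA * dB" "dim_col (ptranspose dA dB X) = dA * dB"
  by (simp_all add: ptranspose_def)

lemma pt_index_less:
  assumes "p < dA * dB" "q < dA * dB"
  shows "pt_index dB p q < dA * dB"
proof -
  have "0 < dB" using assms by (cases dB) auto
  then show ?thesis
    using assms unfolding pt_index_def by (intro pair_index_less) (auto simp: less_mult_imp_div_less)
qed

lemma pt_index_inverse:
  "pt_index dB (pt_index dB p q) (pt_index dB q p) = p"
  by (cases "dB = 0") (simp_all add: pt_index_def)

lemma sum_pt_index: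
  "(\<Sum>p<dA * dB. \<Sum>q<dA * dB. f (pt_index dB p q) (pt_index dB q p)) =
   (\<Sum>p<dA * dB. \<Sum>q<dA * dB. f p q)"
  unfolding sum.cartesian_product
  by (rule sum.reindex_bij_witness
      [where i = "\<lambda>(p, q). (pt_index dB p q, pt_index dB q p)"
        and j = "\<lambda>(p, q). (pt_index dB p q, pt_index dB q p)"])
    (auto simp: pt_index_inverse pt_index_less)

lemma ptranspose_ptranspose:
  assumes "X \<in> carrier_mat (dA * dB) (dA * dB)"
  shows "ptranspose dA dB (ptranspose dA dB X) = X"
  by (rule eq_matI) (use assms in \<open>auto simp: index_ptranspose pt_index_less pt_index_inverse\<close>)

text \<open>The trace of a product sums over all pairs (row, column), and partial transposition of
  both factors only permutes these pairs.\<close>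

lemma mtrace_mult_ptranspose:
  assumes "X \<in> carrier_mat (dA * dB) (dA * dB)" "Y \<in> carrier_mat (dA * dB) (dA * dB)"
  shows "mtrace (ptranspose dA dB X * ptranspose dA dB Y) = mtrace (X * Y)"
proof -
  have "mtrace (ptranspose dA dB X * ptranspose dA dB Y) =
    (\<Sum>p<dA * dB. \<Sum>q<dA * dB. X $$ (pt_index dB p q, pt_index dB q p) * Y $$ (pt_index dB q p, pt_index dB p q))"
    by (subst mtrace_mult[of _ "dA * dB"]) (auto simp: index_ptranspose intro!: sum.cong)
  also have "\<dots> = (\<Sum>p<dA * dB. \<Sum>q<dA * dB. X $$ (p, q) * Y $$ (q, p))"
    by (rule sum_pt_index)
  also have "\<dots> = mtrace (X * Y)" using assms by (simp add: mtrace_mult)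
  finally show ?thesis .
qed

text \<open>\<open>fst_index\<close> and \<open>snd_index\<close> are the local index maps inside
  \<open>bip_tensor\<close>; together they form a bijection onto pairs of indices of the two
  factors, with inverse \<open>join_index\<close>.\<close>

definition fst_index :: "nat \<Rightarrow> nat \<Rightarrow> nat \<Rightarrow> nat \<Rightarrow> nat" where
  "fst_index dB dA' dB' p = (p div (dB * dB') div dA') * dB + p mod (dB * dB') div dB'"

definition snd_index :: "nat \<Rightarrow> nat \<Rightarrow> nat \<Rightarrow> nat \<Rightarrow> nat" where
  "snd_index dB dA' dB' p = (p div (dB * dB') mod dA') * dB' + p mod (dB * dB') mod dB'"

definition join_index :: "nat \<Rightarrow> nat \<Rightarrow> nat \<Rightarrow> nat \<Rightarrow> nat \<Rightarrow> nat" where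
  "join_index dB dA' dB' x y =
     ((x div dB) * dA' + y div dB') * (dB * dB') + ((x mod dB) * dB' + y mod dB')"

lemma fst_index_less:
  assumes "p < (dA * dA') * (dB * dB')"
  shows "fst_index dB dA' dB' p < dA * dB"
proof -
  have pos: "0 < dB * dB'" using assms by (cases "dB * dB' = 0") auto
  show ?thesis
    unfolding fst_index_def
    by (intro pair_index_less less_mult_imp_div_less)
      (use assms pos mod_less_divisor[of "dB * dB'" p] in \<open>auto simp: mult_ac simp del: mod_less_divisor\<close>)
qed

lemma snd_index_less:
  assumes "p < (dA * dA') * (dB * dB')"
  shows "snd_index dB dA' dB' p < dA' * dB'"
proof -
  have "0 < dB'" "0 < dA'" using assms by (auto intro!: gr0I)
  then show ?thesis unfolding snd_index_def by (intro pair_index_less) auto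
qed

lemma join_index_less:
  assumes "x < dA * dB" "y < dA' * dB'"
  shows "join_index dB dA' dB' x y < (dA * dA') * (dB * dB')"
proof -
  have "0 < dB" "0 < dB'" using assms by (auto intro!: gr0I)
  then show ?thesis
    using assms unfolding join_index_def
    by (intro pair_index_less) (auto simp: less_mult_imp_div_less)
qed

lemma fst_index_join:
  assumes "x < dA * dB" "y < dA' * dB'"
  shows "fst_index dB dA' dB' (join_index dB dA' dB' x y) = x"
    and "snd_index dB dA' dB' (join_index dB dA' dB' x y) = y"
proof -
  have pos: "0 < dB" "0 < dB'" "0 < dA'" using assms by (auto intro!: gr0I)
  define b where "b = (x mod dB) * dB' + y mod dB'"
  define a where "a = (x div dB) * dA' + y div dB'"
  have b: "b < dB * dB'" unfolding b_def using pos by (intro pair_index_less) auto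
  have y: "y div dB' < dA'" using assms by (simp add: less_mult_imp_div_less)
  have j: "join_index dB dA' dB' x y = a * (dB * dB') + b" by (simp add: join_index_def a_def b_def)
  have p: "(a * (dB * dB') + b) div (dB * dB') = a" "(a * (dB * dB') + b) mod (dB * dB') = b"
    by (rule pair_index_div_mod[OF b])+
  have a': "a div dA' = x div dB" "a mod dA' = y div dB'"
    unfolding a_def using y by simp_all
  have b': "b div dB' = x mod dB" "b mod dB' = y mod dB'"
    unfolding b_def using pos by simp_all
  show "fst_index dB dA' dB' (join_index dB dA' dB' x y) = x"
    "snd_index dB dA' dB' (join_index dB dA' dB' x y) = y"
    unfolding j fst_index_def snd_index_def p a' b' by simp_all
qed

lemma join_index_fst_snd:
  assumes "p < (dA * dA') * (dB * dB')"
  shows "join_index dB dA' dB' (fst_index dB dA' dB' p) (snd_index dB dA' dB' p) = p"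
proof -
  have pos: "0 < dB" "0 < dB'" "0 < dA'" using assms by (auto intro!: gr0I)
  have b: "p mod (dB * dB') div dB' < dB"
    using pos by (intro less_mult_imp_div_less) simp
  show ?thesis
    unfolding join_index_def fst_index_def snd_index_def using pos b by (simp add: div_mult_mod_eq)
qed

lemma sum_fst_snd_index:
  "(\<Sum>p<(dA * dA') * (dB * dB'). f (fst_index dB dA' dB' p) (snd_index dB dA' dB' p)) =
   (\<Sum>x<dA * dB. \<Sum>y<dA' * dB'. f x y)"
  unfolding sum.cartesian_product
  by (rule sum.reindex_bij_witness
      [where i = "\<lambda>(x, y). join_index dB dA' dB' x y"
        and j = "\<lambda>p. (fst_index dB dA' dB' p, snd_index dB dA' dB' p)"])
    (auto simp: fst_index_join join_index_fst_snd fst_index_less snd_index_less join_index_less)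

section \<open>Tensor products across the bipartition\<close>

lemma bip_tensor_carrier [simp]:
  "bip_tensor dA dB dA' dB' X Y \<in> carrier_mat ((dA * dA') * (dB * dB')) ((dA * dA') * (dB * dB'))"
  by (simp add: bip_tensor_def Let_def)

lemma dim_bip_tensor [simp]:
  "dim_row (bip_tensor dA dB dA' dB' X Y) = (dA * dA') * (dB * dB')"
  "dim_col (bip_tensor dA dB dA' dB' X Y) = (dA * dA') * (dB * dB')"
  by (simp_all add: bip_tensor_def Let_def)

lemma index_bip_tensor:
  assumes "p < (dA * dA') * (dB * dB')" "q < (dA * dA') * (dB * dB')"
  shows "bip_tensor dA dB dA' dB' X Y $$ (p, q) =
    X $$ (fst_index dB dA' dB' p, fst_index dB dA' dB' q) *
    Y $$ (snd_index dB dA' dB' p, snd_index dB dA' dB' q)"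
  using assms by (simp add: bip_tensor_def Let_def fst_index_def snd_index_def)

lemma mtrace_bip_tensor:
  assumes "X \<in> carrier_mat (dA * dB) (dA * dB)" "Y \<in> carrier_mat (dA' * dB') (dA' * dB')"
  shows "mtrace (bip_tensor dA dB dA' dB' X Y) = mtrace X * mtrace Y"
proof -
  have "mtrace (bip_tensor dA dB dA' dB' X Y) =
    (\<Sum>p<(dA * dA') * (dB * dB'). X $$ (fst_index dB dA' dB' p, fst_index dB dA' dB' p) *
      Y $$ (snd_index dB dA' dB' p, snd_index dB dA' dB' p))"
    by (simp add: mtrace_def index_bip_tensor)
  also have "\<dots> = (\<Sum>x<dA * dB. \<Sum>y<dA' * dB'. X $$ (x, x) * Y $$ (y, y))"
    by (rule sum_fst_snd_index)
  finally show ?thesis using assms by (simp add: mtrace_def sum_product)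
qed

lemma bip_tensor_mult:
  assumes "X \<in> carrier_mat (dA * dB) (dA * dB)" "Y \<in> carrier_mat (dA' * dB') (dA' * dB')"
    "X' \<in> carrier_mat (dA * dB) (dA * dB)" "Y' \<in> carrier_mat (dA' * dB') (dA' * dB')"
  shows "bip_tensor dA dB dA' dB' X Y * bip_tensor dA dB dA' dB' X' Y' =
    bip_tensor dA dB dA' dB' (X * X') (Y * Y')" (is "?L = ?R")
proof (rule eq_matI)
  let ?D = "(dA * dA') * (dB * dB')"
  let ?f = "fst_index dB dA' dB'" and ?s = "snd_index dB dA' dB'"
  fix p q assume "p < dim_row ?R" "q < dim_col ?R"
  then have pq: "p < ?D" "q < ?D" by auto
  note less = fst_index_less[OF pq(1)] fst_index_less[OF pq(2)] snd_index_less[OF pq(1)] snd_index_less[OF pq(2)]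
  have "?L $$ (p, q) = (\<Sum>l<?D. X $$ (?f p, ?f l) * Y $$ (?s p, ?s l) * (X' $$ (?f l, ?f q) * Y' $$ (?s l, ?s q)))"
    using pq by (subst index_mult_mat_sum[of _ ?D ?D _ ?D]) (auto simp: index_bip_tensor)
  also have "\<dots> = (\<Sum>x<dA * dB. \<Sum>y<dA' * dB'. X $$ (?f p, x) * Y $$ (?s p, y) * (X' $$ (x, ?f q) * Y' $$ (y, ?s q)))"
    by (rule sum_fst_snd_index)
  also have "\<dots> = (\<Sum>x<dA * dB. X $$ (?f p, x) * X' $$ (x, ?f q)) * (\<Sum>y<dA' * dB'. Y $$ (?s p, y) * Y' $$ (y, ?s q))"
    by (simp add: sum_product mult_ac)
  also have "\<dots> = ?R $$ (p, q)"
    using pq less assms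
    by (simp add: index_bip_tensor index_mult_mat_sum[of X "dA * dB" "dA * dB" X' "dA * dB"]
        index_mult_mat_sum[of Y "dA' * dB'" "dA' * dB'" Y' "dA' * dB'"] del: index_mult_mat)
  finally show "?L $$ (p, q) = ?R $$ (p, q)" .
qed auto

lemma psd_bip_tensor:
  assumes "psd (dA * dB) X" "psd (dA' * dB') Y"
  shows "psd ((dA * dA') * (dB * dB')) (bip_tensor dA dB dA' dB' X Y)"
proof -
  let ?f = "fst_index dB dA' dB'" and ?s = "snd_index dB dA' dB'"
  obtain Z where Z: "\<And>i j. i < dA * dB \<Longrightarrow> j < dA * dB \<Longrightarrow> X $$ (i, j) = (\<Sum>k<dA * dB. Z i k * cnj (Z j k))"
    using psd_gram[OF assms(1)] by blast
  obtain W where W: "\<And>i j. i < dA' * dB' \<Longrightarrow> j < dA' * dB' \<Longrightarrow> Y $$ (i, j) = (\<Sum>k<dA' * dB'. W i k * cnj (W j k))"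
    using psd_gram[OF assms(2)] by blast
  show ?thesis
  proof (rule psd_gramI[where K = "{..<dA * dB} \<times> {..<dA' * dB'}" and Z = "\<lambda>p (k, l). Z (?f p) k * W (?s p) l"])
    fix p q assume pq: "p < (dA * dA') * (dB * dB')" "q < (dA * dA') * (dB * dB')"
    show "bip_tensor dA dB dA' dB' X Y $$ (p, q) =
      (\<Sum>k\<in>{..<dA * dB} \<times> {..<dA' * dB'}. (case k of (k, l) \<Rightarrow> Z (?f p) k * W (?s p) l) *
        cnj (case k of (k, l) \<Rightarrow> Z (?f q) k * W (?s q) l))"
      unfolding index_bip_tensor[OF pq] Z[OF fst_index_less[OF pq(1)] fst_index_less[OF pq(2)]]
        W[OF snd_index_less[OF pq(1)] snd_index_less[OF pq(2)]] sum_product sum.cartesian_product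
      by (intro sum.cong refl) (simp add: case_prod_unfold mult_ac)
  qed auto
qed

text \<open>Exchanging Bob's parts of two composite indices exchanges them in each factor
  separately. This is the index form of the fact that partial transposition factorizes.\<close>

lemma fst_snd_pt_index:
  assumes "p < (dA * dA') * (dB * dB')" "q < (dA * dA') * (dB * dB')"
  shows "fst_index dB dA' dB' (pt_index (dB * dB') p q) =
      pt_index dB (fst_index dB dA' dB' p) (fst_index dB dA' dB' q)"
    and "snd_index dB dA' dB' (pt_index (dB * dB') p q) =
      pt_index dB' (snd_index dB dA' dB' p) (snd_index dB dA' dB' q)"
proof -
  have pos: "0 < dB" "0 < dB'" "0 < dA'" using assms by (auto intro!: gr0I)
  have b: "r mod (dB * dB') div dB' < dB" for r
    using pos by (intro less_mult_imp_div_less) simp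
  have "pt_index (dB * dB') p q div (dB * dB') = p div (dB * dB')"
    "pt_index (dB * dB') p q mod (dB * dB') = q mod (dB * dB')"
    using pos by (simp_all add: pt_index_def)
  then show "fst_index dB dA' dB' (pt_index (dB * dB') p q) =
      pt_index dB (fst_index dB dA' dB' p) (fst_index dB dA' dB' q)"
    "snd_index dB dA' dB' (pt_index (dB * dB') p q) =
      pt_index dB' (snd_index dB dA' dB' p) (snd_index dB dA' dB' q)"
    using pos b by (simp_all add: fst_index_def snd_index_def pt_index_def)
qed

lemma ptranspose_bip_tensor:
  "ptranspose (dA * dA') (dB * dB') (bip_tensor dA dB dA' dB' X Y) =
   bip_tensor dA dB dA' dB' (ptranspose dA dB X) (ptranspose dA' dB' Y)"
proof (rule eq_matI; simp?)
  fix p q assume pq: "p < (dA * dA') * (dB * dB')" "q < (dA * dA') * (dB * dB')"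
  then show "ptranspose (dA * dA') (dB * dB') (bip_tensor dA dB dA' dB' X Y) $$ (p, q) =
    bip_tensor dA dB dA' dB' (ptranspose dA dB X) (ptranspose dA' dB' Y) $$ (p, q)"
    by (simp add: index_ptranspose index_bip_tensor pt_index_less fst_index_less snd_index_less
        fst_snd_pt_index)
qed

lemma bip_tensor_one:
  "bip_tensor dA dB dA' dB' (1\<^sub>m (dA * dB)) (1\<^sub>m (dA' * dB')) = 1\<^sub>m ((dA * dA') * (dB * dB'))"
proof (rule eq_matI)
  let ?D = "(dA * dA') * (dB * dB')"
  fix p q assume "p < dim_row (1\<^sub>m ?D)" "q < dim_col (1\<^sub>m ?D)"
  then have pq: "p < (dA * dA') * (dB * dB')" "q < (dA * dA') * (dB * dB')"
    by simp_all
  have "p = q \<longleftrightarrow> fst_index dB dA' dB' p = fst_index dB dA' dB' q \<and> snd_index dB dA' dB' p = snd_index dB dA' dB' q"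
    using join_index_fst_snd[OF pq(1)] join_index_fst_snd[OF pq(2)] by metis
  then show "bip_tensor dA dB dA' dB' (1\<^sub>m (dA * dB)) (1\<^sub>m (dA' * dB')) $$ (p, q) = 1\<^sub>m ?D $$ (p, q)"
    using pq fst_index_less[OF pq(1)] fst_index_less[OF pq(2)] snd_index_less[OF pq(1)] snd_index_less[OF pq(2)]
    by (simp add: index_bip_tensor[OF pq])
qed simp_all

lemma bip_tensor_smult:
  assumes "X \<in> carrier_mat (dA * dB) (dA * dB)" "Y \<in> carrier_mat (dA' * dB') (dA' * dB')"
  shows "bip_tensor dA dB dA' dB' (c \<cdot>\<^sub>m X) (c' \<cdot>\<^sub>m Y) = (c * c') \<cdot>\<^sub>m bip_tensor dA dB dA' dB' X Y"
  by (rule eq_matI) (use assms in \<open>simp_all add: index_bip_tensor fst_index_less snd_index_less\<close>)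

section \<open>Tensor powers\<close>

lemma bip_power_carrier [simp]:
  "bip_power dA dB X n \<in> carrier_mat (dA ^ n * dB ^ n) (dA ^ n * dB ^ n)"
proof (cases n)
  case (Suc m)
  show ?thesis unfolding Suc bip_power.simps power_Suc2 by (rule bip_tensor_carrier)
qed simp

lemma bip_power_dim [simp]:
  "dim_row (bip_power dA dB X n) = dA ^ n * dB ^ n"
  "dim_col (bip_power dA dB X n) = dA ^ n * dB ^ n"
  using bip_power_carrier[of dA dB X n] by blast+

lemma mtrace_bip_power:
  assumes "X \<in> carrier_mat (dA * dB) (dA * dB)"
  shows "mtrace (bip_power dA dB X n) = mtrace X ^ n"
proof (induction n)
  case 0
  show ?case by (simp add: mtrace_def)
next
  case (Suc n)
  then show ?case using assms by (simp add: mtrace_bip_tensor)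
qed

lemma bip_power_mult:
  assumes "X \<in> carrier_mat (dA * dB) (dA * dB)" "Y \<in> carrier_mat (dA * dB) (dA * dB)"
  shows "bip_power dA dB X n * bip_power dA dB Y n = bip_power dA dB (X * Y) n"
  by (induction n) (use assms in \<open>simp_all add: bip_tensor_mult\<close>)

lemma bip_power_smult:
  assumes "X \<in> carrier_mat (dA * dB) (dA * dB)"
  shows "bip_power dA dB (c \<cdot>\<^sub>m X) n = c ^ n \<cdot>\<^sub>m bip_power dA dB X n"
proof (induction n)
  case 0
  show ?case by (auto intro!: eq_matI)
next
  case (Suc n)
  then show ?case using assms by (simp add: bip_tensor_smult mult.commute[of c])
qed

lemma bip_power_one: "bip_power dA dB (1\<^sub>m (dA * dB)) n = 1\<^sub>m (dA ^ n * dB ^ n)"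
  by (induction n) (simp_all add: bip_tensor_one power_Suc2 del: power_Suc)

lemma ptranspose_bip_power:
  "ptranspose (dA ^ n) (dB ^ n) (bip_power dA dB X n) = bip_power dA dB (ptranspose dA dB X) n"
proof (induction n)
  case 0
  show ?case by (auto intro!: eq_matI simp: ptranspose_def)
next
  case (Suc n)
  then show ?case
    using ptranspose_bip_tensor[of "dA ^ n" dA "dB ^ n" dB "bip_power dA dB X n" X]
    by (simp add: power_Suc2 del: power_Suc)
qed

lemma psd_one: "psd d (1\<^sub>m d)"
proof (rule psd_gramI[of _ _ "{..<d}" "\<lambda>i k. if i = k then 1 else 0"])
  fix i j assume "i < d" "j < d"
  have "(\<Sum>k<d. (if i = k then 1 else 0) * cnj (if j = k then 1 else 0)) =
      (\<Sum>k<d. if i = k then (if j = k then 1 else 0) else (0 :: complex))"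
    by (intro sum.cong) auto
  then show "1\<^sub>m d $$ (i, j) = (\<Sum>k<d. (if i = k then 1 else 0) * cnj (if j = k then 1 else 0))"
    using \<open>i < d\<close> \<open>j < d\<close> by auto
qed auto

lemma psd_bip_power:
  assumes "psd (dA * dB) X"
  shows "psd (dA ^ n * dB ^ n) (bip_power dA dB X n)"
proof (induction n)
  case 0
  show ?case using psd_one[of 1] by simp
next
  case (Suc n)
  then show ?case
    using psd_bip_tensor[OF Suc assms] by (simp add: power_Suc2 del: power_Suc)
qed

text \<open>The two-sided operator bound -A <= B <= A.\<close>

definition dominates :: "nat \<Rightarrow> complex mat \<Rightarrow> complex mat \<Rightarrow> bool" where
  "dominates d A B \<longleftrightarrow> A \<in> carrier_mat d d \<and> B \<in> carrier_mat d d \<and> psd d (A + B) \<and> psd d (A - B)"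

text \<open>Writing x for the tensor product, twice A x A' + B x B' is (A+B) x (A'+B') + (A-B) x
  (A'-B'), and twice A x A' - B x B' is (A+B) x (A'-B') + (A-B) x (A'+B'). Every factor on the right
  is positive. With B <= A alone this fails, because negative parts of B and B' multiply to
  something positive.\<close>

lemma dominates_bip_tensor:
  assumes "dominates (dA * dB) A B" "dominates (dA' * dB') A' B'"
  shows "dominates ((dA * dA') * (dB * dB')) (bip_tensor dA dB dA' dB' A A') (bip_tensor dA dB dA' dB' B B')"
proof -
  let ?t = "bip_tensor dA dB dA' dB'" and ?D = "(dA * dA') * (dB * dB')"
  have c: "A \<in> carrier_mat (dA * dB) (dA * dB)" "B \<in> carrier_mat (dA * dB) (dA * dB)"
    "A' \<in> carrier_mat (dA' * dB') (dA' * dB')" "B' \<in> carrier_mat (dA' * dB') (dA' * dB')"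
    and p: "psd (dA * dB) (A + B)" "psd (dA * dB) (A - B)"
      "psd (dA' * dB') (A' + B')" "psd (dA' * dB') (A' - B')"
    using assms by (auto simp: dominates_def)
  have "psd ?D (complex_of_real (1 / 2) \<cdot>\<^sub>m (?t (A + B) (A' + B') + ?t (A - B) (A' - B')))"
    by (intro psd_smult psd_add psd_bip_tensor p) simp
  also have "complex_of_real (1 / 2) \<cdot>\<^sub>m (?t (A + B) (A' + B') + ?t (A - B) (A' - B')) = ?t A A' + ?t B B'"
    by (rule eq_matI, insert c, simp_all add: index_bip_tensor fst_index_less snd_index_less)
      (simp add: algebra_simps)
  finally have 1: "psd ?D (?t A A' + ?t B B')" .
  have "psd ?D (complex_of_real (1 / 2) \<cdot>\<^sub>m (?t (A + B) (A' - B') + ?t (A - B) (A' + B')))"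
    by (intro psd_smult psd_add psd_bip_tensor p) simp
  also have "complex_of_real (1 / 2) \<cdot>\<^sub>m (?t (A + B) (A' - B') + ?t (A - B) (A' + B')) = ?t A A' - ?t B B'"
    by (rule eq_matI, insert c, simp_all add: index_bip_tensor fst_index_less snd_index_less)
      (simp add: algebra_simps)
  finally show ?thesis using 1 by (simp add: dominates_def)
qed

lemma dominates_bip_power:
  assumes "dominates (dA * dB) A B"
  shows "dominates (dA ^ n * dB ^ n) (bip_power dA dB A n) (bip_power dA dB B n)"
proof (induction n)
  case 0
  have "psd 1 (1\<^sub>m 1 - 1\<^sub>m 1)"
    by (rule psd_gramI[of _ _ "{}" "\<lambda>_ _. 0"]) auto
  then show ?case
    using psd_add[OF psd_one[of 1] psd_one[of 1]] by (simp add: dominates_def)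
next
  case (Suc n)
  then show ?case
    using dominates_bip_tensor[OF Suc assms] by (simp add: power_Suc2 del: power_Suc)
qed

section \<open>Relative entropy to a fixed state\<close>

lemma eigen_weight_smult:
  assumes "M \<in> carrier_mat d d"
  shows "eigen_weight d (c \<cdot>\<^sub>m M) U k = c * eigen_weight d M U k"
  using assms by (simp add: eigen_weight_def sum_distrib_left mult_ac)

text \<open>The k-th column of \<open>U\<close> is an eigenvector of \<open>A\<close>, so the right
  factor acts on it as the scalar \<open>r k\<close>.\<close>

lemma eigen_weight_mult:
  assumes M: "M \<in> carrier_mat d d" and sd: "spectral_decomp d A U r" and k: "k < d"
  shows "eigen_weight d (M * A) U k = complex_of_real (r k) * eigen_weight d M U k"
proof -
  note A = spectral_decomp_carrier[OF sd]
  have "(\<Sum>j<d. (M * A) $$ (i, j) * U $$ (j, k)) =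
      complex_of_real (r k) * (\<Sum>j<d. M $$ (i, j) * U $$ (j, k))" if "i < d" for i
  proof -
    have "(\<Sum>j<d. (M * A) $$ (i, j) * U $$ (j, k)) =
        (\<Sum>j<d. \<Sum>l<d. M $$ (i, l) * (A $$ (l, j) * U $$ (j, k)))"
      using that by (intro sum.cong refl)
        (simp add: index_mult_mat_sum[OF M A] sum_distrib_left sum_distrib_right mult_ac del: index_mult_mat)
    also have "\<dots> = (\<Sum>l<d. M $$ (i, l) * (\<Sum>j<d. A $$ (l, j) * U $$ (j, k)))"
      unfolding sum_distrib_left by (rule sum.swap)
    also have "\<dots> = (\<Sum>l<d. M $$ (i, l) * (complex_of_real (r k) * U $$ (l, k)))"
      by (intro sum.cong refl) (simp add: spectral_decomp_eigen[OF sd _ k])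
    finally show ?thesis by (simp add: sum_distrib_left mult_ac)
  qed
  then have "(\<Sum>i<d. cnj (U $$ (i, k)) * (\<Sum>j<d. (M * A) $$ (i, j) * U $$ (j, k))) =
      (\<Sum>i<d. cnj (U $$ (i, k)) * (complex_of_real (r k) * (\<Sum>j<d. M $$ (i, j) * U $$ (j, k))))"
    by (intro sum.cong refl) simp
  then show ?thesis by (simp add: eigen_weight_def sum_distrib_left mult_ac)
qed

lemma eigen_weight_cscalar_prod:
  assumes "M \<in> carrier_mat d d" "U \<in> carrier_mat d d" "k < d"
  shows "(M *\<^sub>v col U k) \<bullet>c col U k = eigen_weight d M U k"
  using assms by (simp add: cscalar_prod_sum[of _ d] index_mult_mat_vec_sum[of _ d d] eigen_weight_def
      sum_distrib_left mult_ac del: index_mult_mat_vec)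

text \<open>The range of a Hermitian matrix is orthogonal to its kernel. This makes an inclusion of
  supports usable for vectors of the form \<open>A\<close> times \<open>v\<close>.\<close>

lemma mult_vec_in_supp:
  assumes A: "A \<in> carrier_mat d d" "mat_adjoint A = A" and v: "v \<in> carrier_vec d"
  shows "A *\<^sub>v v \<in> supp d A"
proof -
  have "(A *\<^sub>v v) \<bullet>c w = 0" if "w \<in> mat_kernel A" for w
  proof -
    have w: "w \<in> carrier_vec d" "A *\<^sub>v w = 0\<^sub>v d" using that A by (auto simp: mat_kernel_def)
    have "(A *\<^sub>v v) \<bullet>c w = (\<Sum>i<d. \<Sum>j<d. A $$ (i, j) * v $ j * cnj (w $ i))"
      using w(1) A v by (simp add: cscalar_prod_sum[of _ d] index_mult_mat_vec_sum[of _ d d]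
          sum_distrib_left sum_distrib_right mult_ac del: index_mult_mat_vec)
    also have "\<dots> = (\<Sum>j<d. \<Sum>i<d. A $$ (i, j) * v $ j * cnj (w $ i))" by (rule sum.swap)
    also have "\<dots> = (\<Sum>j<d. v $ j * cnj (\<Sum>i<d. A $$ (j, i) * w $ i))"
      by (intro sum.cong refl) (simp add: hermitian_index[OF A] sum_distrib_left mult_ac)
    also have "\<dots> = (\<Sum>j<d. v $ j * cnj ((A *\<^sub>v w) $ j))"
      by (intro sum.cong refl) (simp add: index_mult_mat_vec_sum[OF A(1) w(1)] del: index_mult_mat_vec)
    also have "\<dots> = 0" unfolding w(2) by simp
    finally show ?thesis .
  qed
  then show ?thesis using A v by (simp add: supp_def)
qed

text \<open>The quadratic equation forces every eigenvalue to be 0 or \<open>c\<close>, so the state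
  is uniform on its support.\<close>

lemma mtrace_mult_log_self:
  assumes \<rho>: "psd d \<rho>" "mtrace \<rho> = 1" and sq: "\<rho> * \<rho> = complex_of_real c \<cdot>\<^sub>m \<rho>"
  shows "mtrace (\<rho> * spectral_fun d (log 2) \<rho>) = complex_of_real (log 2 c)"
proof -
  note c = psd_hermitian[OF \<rho>(1)]
  obtain U r where sd: "spectral_decomp d \<rho> U r" using hermitian_spectral_decomp[OF c] by blast
  have r: "r k * log 2 (r k) = r k * log 2 c" if "k < d" for k
  proof -
    have "complex_of_real (r k) * complex_of_real (r k) = complex_of_real c * complex_of_real (r k)"
      using eigen_weight_mult[OF c(1) sd that] eigen_weight_smult[OF c(1), of "complex_of_real c" U k]
      unfolding sq eigen_weight_eigen[OF sd that] by auto
    then have "r k = 0 \<or> c = r k" by (auto simp flip: of_real_mult)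
    then show ?thesis by auto
  qed
  have "mtrace (\<rho> * spectral_fun d (log 2) \<rho>) = (\<Sum>k<d. complex_of_real (r k * log 2 (r k)))"
    unfolding mtrace_mult_spectral[OF c(1) spectral_decomp_spectral_fun[OF sd]]
    by (intro sum.cong refl) (simp add: eigen_weight_eigen[OF sd] mult.commute)
  also have "\<dots> = complex_of_real (log 2 c) * (\<Sum>k<d. eigen_weight d \<rho> U k)"
    unfolding sum_distrib_left by (intro sum.cong refl) (simp add: eigen_weight_eigen[OF sd] r mult.commute)
  finally show ?thesis unfolding sum_eigen_weight[OF c(1) sd] \<rho>(2) by simp
qed

text \<open>Jensen's inequality in tangent form: the logarithm is bounded by its tangent at
  \<open>t\<close> and averaged over the weights of \<open>\<rho>\<close> in the eigenbasis of
  \<open>\<sigma>\<close>. The linear term averages to a nonpositive number because the mean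
  eigenvalue is the trace of \<open>\<rho> * \<sigma>\<close>, at most \<open>t\<close>.\<close>

lemma rel_entropy_ge:
  assumes \<rho>: "psd d \<rho>" "mtrace \<rho> = 1" and sq: "\<rho> * \<rho> = complex_of_real c \<cdot>\<^sub>m \<rho>"
    and \<sigma>: "psd d \<sigma>" and t: "Re (mtrace (\<rho> * \<sigma>)) \<le> t" "0 < t"
  shows "ereal (log 2 c - log 2 t) \<le> rel_entropy d \<rho> \<sigma>"
proof (cases "supp d \<rho> \<subseteq> supp d \<sigma>")
  case True
  note c = psd_hermitian[OF \<rho>(1)] and c' = psd_hermitian[OF \<sigma>]
  obtain U s where sd: "spectral_decomp d \<sigma> U s" using hermitian_spectral_decomp[OF c'] by blast
  have U: "U \<in> carrier_mat d d" using sd by (simp add: spectral_decomp_def unitary_def)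
  note sdl = spectral_decomp_spectral_fun[OF sd, of "log 2"]
  define w where "w k = Re (eigen_weight d \<rho> U k)" for k
  have w0: "w k = 0" if "k < d" "s k = 0" for k
  proof -
    have col: "col U k \<in> carrier_vec d" using U that(1) by auto
    have "\<sigma> *\<^sub>v col U k = 0\<^sub>v d" using mult_col_spectral[OF sd that(1)] that U by auto
    then have "col U k \<in> mat_kernel \<sigma>" using c' col by (auto simp: mat_kernel_def)
    moreover have "\<rho> *\<^sub>v col U k \<in> supp d \<sigma>"
      using mult_vec_in_supp[OF c col] True by auto
    ultimately have "(\<rho> *\<^sub>v col U k) \<bullet>c col U k = 0" by (auto simp: supp_def)
    then show ?thesis unfolding eigen_weight_cscalar_prod[OF c(1) U that(1)] w_def by simp
  qed
  have le: "log 2 (s k) * w k \<le> log 2 t * w k + (s k * w k / t - w k) / ln 2" if k: "k < d" for k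
  proof (cases "s k = 0")
    case False
    then have pos: "s k > 0" using spectral_decomp_psd_nonneg[OF \<sigma> sd k] by simp
    have "ln (s k / t) \<le> s k / t - 1" using pos t by (intro ln_le_minus_one) simp
    then have "log 2 (s k) \<le> log 2 t + (s k / t - 1) / ln 2"
      using pos t by (simp add: log_def ln_div field_simps)
    then have "log 2 (s k) * w k \<le> (log 2 t + (s k / t - 1) / ln 2) * w k"
      using eigen_weight_nonneg[OF \<rho>(1)] by (intro mult_right_mono) (simp_all add: w_def)
    then show ?thesis by (simp add: field_simps)
  qed (use w0[OF k] in simp)
  have "(\<Sum>k<d. w k) = 1"
    using sum_eigen_weight[OF c(1) sd] \<rho>(2) by (simp add: w_def flip: Re_sum)
  have st: "(\<Sum>k<d. s k * w k) \<le> t"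
    using mtrace_mult_spectral[OF c(1) sd] t by (simp add: w_def)
  have "Re (mtrace (\<rho> * spectral_fun d (log 2) \<sigma>)) = (\<Sum>k<d. log 2 (s k) * w k)"
    unfolding mtrace_mult_spectral[OF c(1) sdl] by (simp add: w_def)
  also have "\<dots> \<le> (\<Sum>k<d. log 2 t * w k + (s k * w k / t - w k) / ln 2)"
    by (intro sum_mono) (use le in auto)
  also have "\<dots> = log 2 t * (\<Sum>k<d. w k) + ((\<Sum>k<d. s k * w k) / t - (\<Sum>k<d. w k)) / ln 2"
    by (simp add: sum.distrib sum_subtractf sum_distrib_left sum_divide_distrib diff_divide_distrib)
  also have "\<dots> \<le> log 2 t"
    unfolding \<open>(\<Sum>k<d. w k) = 1\<close> using st t by (simp add: divide_simps)
  finally have le_t: "Re (mtrace (\<rho> * spectral_fun d (log 2) \<sigma>)) \<le> log 2 t" .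
  have "log 2 c - log 2 t \<le> Re (mtrace (\<rho> * spectral_fun d (log 2) \<rho> - \<rho> * spectral_fun d (log 2) \<sigma>))"
  proof -
    obtain V r where "spectral_decomp d \<rho> V r" using hermitian_spectral_decomp[OF c] by blast
    note spectral_decomp_carrier[OF spectral_decomp_spectral_fun[OF this, of "log 2"]]
    then have "mtrace (\<rho> * spectral_fun d (log 2) \<rho> - \<rho> * spectral_fun d (log 2) \<sigma>) =
        complex_of_real (log 2 c) - mtrace (\<rho> * spectral_fun d (log 2) \<sigma>)"
      using mtrace_mult_log_self[OF \<rho> sq] c(1) spectral_decomp_carrier[OF sdl]
      by (simp add: mtrace_minus[of _ d])
    then show ?thesis
      using le_t by simp
  qed
  then show ?thesis using True by (simp add: rel_entropy_def)
qed (simp add: rel_entropy_def)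

text \<open>The product condition says that \<open>\<rho>\<close> lives on the eigenspace of
  \<open>\<sigma>\<close> for the eigenvalue \<open>s\<close>, where the logarithm of
  \<open>\<sigma>\<close> is the scalar \<open>log 2 s\<close>.\<close>

lemma rel_entropy_eigen:
  assumes \<rho>: "psd d \<rho>" "mtrace \<rho> = 1" and sq: "\<rho> * \<rho> = complex_of_real c \<cdot>\<^sub>m \<rho>"
    and \<sigma>: "psd d \<sigma>" and s: "\<rho> * \<sigma> = complex_of_real s \<cdot>\<^sub>m \<rho>" "s \<noteq> 0"
  shows "rel_entropy d \<rho> \<sigma> = ereal (log 2 c - log 2 s)"
proof -
  note c = psd_hermitian[OF \<rho>(1)] and c' = psd_hermitian[OF \<sigma>]
  \<comment> \<open>Supports are orthogonal complements of kernels, so the inclusion of supports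
    follows from the reverse inclusion of kernels.\<close>
  have "w \<in> mat_kernel \<rho>" if "w \<in> mat_kernel \<sigma>" for w
  proof -
    have w: "w \<in> carrier_vec d" "\<sigma> *\<^sub>v w = 0\<^sub>v d" using that c' by (auto simp: mat_kernel_def)
    have "complex_of_real s \<cdot>\<^sub>v (\<rho> *\<^sub>v w) = (\<rho> * \<sigma>) *\<^sub>v w"
      unfolding s using c w by (auto intro!: eq_vecI)
    also have "\<dots> = 0\<^sub>v d"
      using c c' w by (subst assoc_mult_mat_vec[of _ d d _ d]) (auto intro!: eq_vecI simp: scalar_prod_def)
    finally have "complex_of_real s \<cdot>\<^sub>v (\<rho> *\<^sub>v w) = 0\<^sub>v d" .
    then have "(complex_of_real s \<cdot>\<^sub>v (\<rho> *\<^sub>v w)) $ i = 0" if "i < d" for i using that by simp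
    then have "\<rho> *\<^sub>v w = 0\<^sub>v d" using c w s(2) by (intro eq_vecI) auto
    then show ?thesis using c w by (simp add: mat_kernel_def)
  qed
  then have supp: "supp d \<rho> \<subseteq> supp d \<sigma>" by (auto simp: supp_def)
  obtain U r where sd: "spectral_decomp d \<sigma> U r" using hermitian_spectral_decomp[OF c'] by blast
  note sdl = spectral_decomp_spectral_fun[OF sd, of "log 2"]
  \<comment> \<open>Either the weight vanishes or \<open>r k = s\<close>, so the eigenvalue may be
    replaced by \<open>s\<close> under any function.\<close>
  have "complex_of_real (log 2 (r k)) * eigen_weight d \<rho> U k = complex_of_real (log 2 s) * eigen_weight d \<rho> U k"
    if "k < d" for k
  proof -
    have "complex_of_real (r k) * eigen_weight d \<rho> U k = complex_of_real s * eigen_weight d \<rho> U k"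
      using eigen_weight_mult[OF c(1) sd that] eigen_weight_smult[OF c(1), of "complex_of_real s" U k]
      unfolding s by auto
    then show ?thesis by auto
  qed
  then have "mtrace (\<rho> * spectral_fun d (log 2) \<sigma>) = (\<Sum>k<d. complex_of_real (log 2 s) * eigen_weight d \<rho> U k)"
    unfolding mtrace_mult_spectral[OF c(1) sdl] by (intro sum.cong refl) auto
  then have "mtrace (\<rho> * spectral_fun d (log 2) \<sigma>) = complex_of_real (log 2 s)"
    using sum_eigen_weight[OF c(1) sd] \<rho>(2) by (simp flip: sum_distrib_left)
  moreover obtain V q where "spectral_decomp d \<rho> V q" using hermitian_spectral_decomp[OF c] by blast
  note spectral_decomp_carrier[OF spectral_decomp_spectral_fun[OF this, of "log 2"]]
  ultimately have "mtrace (\<rho> * spectral_fun d (log 2) \<rho> - \<rho> * spectral_fun d (log 2) \<sigma>) =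
      complex_of_real (log 2 c - log 2 s)"
    using mtrace_mult_log_self[OF \<rho> sq] c(1) spectral_decomp_carrier[OF sdl]
    by (simp add: mtrace_minus[of _ d])
  then show ?thesis using supp by (simp add: rel_entropy_def)
qed

section \<open>The regularized relative entropy of entanglement\<close>

text \<open>A sum of rank-one terms c |v><v| with real v. The explicit matrices are written this way
  so that positivity can be read off the weights and equalities are checked entry by entry. For 9
  entries, position 3i+j stands for |ij>; for 4 entries, position 2i+j.\<close>

definition weighted_gram :: "nat \<Rightarrow> (real \<times> real list) list \<Rightarrow> complex mat" where
  "weighted_gram d ws = Matrix.mat d d (\<lambda>(p, q). complex_of_real (\<Sum>(c, v)\<leftarrow>ws. c * v ! p * v ! q))"

lemma psd_weighted_gram:
  assumes "\<forall>(c, v) \<in> set ws. 0 \<le> c"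
  shows "psd d (weighted_gram d ws)"
proof (rule psd_gramI[where K = "{..<length ws}"
      and Z = "\<lambda>p k. complex_of_real (sqrt (fst (ws ! k)) * snd (ws ! k) ! p)"])
  fix p q assume pq: "p < d" "q < d"
  have "(\<Sum>(c, v)\<leftarrow>ws. c * v ! p * v ! q) =
      (\<Sum>k<length ws. fst (ws ! k) * snd (ws ! k) ! p * snd (ws ! k) ! q)"
    by (simp add: sum_list_sum_nth case_prod_unfold lessThan_atLeast0)
  also have "\<dots> = (\<Sum>k<length ws. sqrt (fst (ws ! k)) * snd (ws ! k) ! p * (sqrt (fst (ws ! k)) * snd (ws ! k) ! q))"
  proof (intro sum.cong refl)
    fix k assume "k \<in> {..<length ws}"
    then have "0 \<le> fst (ws ! k)" using assms nth_mem[of k ws] by (auto simp: case_prod_unfold)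
    then have e: "sqrt (fst (ws ! k)) * sqrt (fst (ws ! k)) = fst (ws ! k)" by simp
    have "sqrt c * x * (sqrt c * y) = (sqrt c * sqrt c) * x * y" for c x y by (simp only: mult_ac)
    then show "fst (ws ! k) * snd (ws ! k) ! p * snd (ws ! k) ! q =
      sqrt (fst (ws ! k)) * snd (ws ! k) ! p * (sqrt (fst (ws ! k)) * snd (ws ! k) ! q)"
      by (simp only: e)
  qed
  finally show "weighted_gram d ws $$ (p, q) = (\<Sum>k<length ws.
      complex_of_real (sqrt (fst (ws ! k)) * snd (ws ! k) ! p) *
      cnj (complex_of_real (sqrt (fst (ws ! k)) * snd (ws ! k) ! q)))"
    using pq by (simp add: weighted_gram_def)
qed (auto simp: weighted_gram_def)

section \<open>Explicit matrices for a single copy\<close>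

lemma less_9_cases:
  assumes "(p :: nat) < 9"
  obtains "p = 0" | "p = 1" | "p = 2" | "p = 3" | "p = 4" | "p = 5" | "p = 6" | "p = 7" | "p = 8"
  using assms by linarith

lemma rho_v_eq:
  "rho_v = weighted_gram 9 [(1/4, [0,1,0,-1,0,0,0,0,0]), (1/4, [0,0,1,0,0,0,-1,0,0])]"
proof (rule eq_matI)
  \<comment> \<open>The normalization of each vector enters twice and gives 1/2; with the mixing
    weight 1/2 this is the coefficient 1/4.\<close>
  have half: "complex_of_real (1 / sqrt 2) * complex_of_real (1 / sqrt 2) = 1 / 2"
    by (simp flip: of_real_mult)
  have v1: "v1 $ p = complex_of_real (1 / sqrt 2) * complex_of_real ([0,1,0,-1,0,0,0,0,0] ! p)" if "p < 9" for p
    using that by (cases rule: less_9_cases) (simp_all add: v1_def ket_def)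
  have v2: "v2 $ p = complex_of_real (1 / sqrt 2) * complex_of_real ([0,0,1,0,0,0,-1,0,0] ! p)" if "p < 9" for p
    using that by (cases rule: less_9_cases) (simp_all add: v2_def ket_def)
  have dim: "dim_vec v1 = 9" "dim_vec v2 = 9" by (simp_all add: v1_def v2_def ket_def)
  fix p q assume "p < dim_row (weighted_gram 9 [(1/4, [0,1,0,-1,0,0,0,0,0]), (1/4, [0,0,1,0,0,0,-1,0,0])])"
    "q < dim_col (weighted_gram 9 [(1/4, [0,1,0,-1,0,0,0,0,0]), (1/4, [0,0,1,0,0,0,-1,0,0])])"
  then have pq: "p < 9" "q < 9" by (simp_all add: weighted_gram_def)
  have prod: "complex_of_real (1 / sqrt 2) * a * cnj (complex_of_real (1 / sqrt 2) * b) = (1 / 2) * (a * cnj b)" for a b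
  proof -
    have "complex_of_real (1 / sqrt 2) * a * cnj (complex_of_real (1 / sqrt 2) * b) =
        complex_of_real (1 / sqrt 2) * complex_of_real (1 / sqrt 2) * (a * cnj b)"
      by simp
    then show ?thesis unfolding half .
  qed
  have "rho_v $$ (p, q) = (1 / 2) * (v1 $ p * cnj (v1 $ q) + v2 $ p * cnj (v2 $ q))"
    using pq by (simp add: rho_v_def ket_bra_def dim)
  also have "\<dots> = (1 / 2) * ((1 / 2) * (complex_of_real ([0,1,0,-1,0,0,0,0,0] ! p) * cnj (complex_of_real ([0,1,0,-1,0,0,0,0,0] ! q)))
      + (1 / 2) * (complex_of_real ([0,0,1,0,0,0,-1,0,0] ! p) * cnj (complex_of_real ([0,0,1,0,0,0,-1,0,0] ! q))))"
    unfolding v1[OF pq(1)] v1[OF pq(2)] v2[OF pq(1)] v2[OF pq(2)] prod ..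
  finally have e: "rho_v $$ (p, q) = \<dots>" .
  show "rho_v $$ (p, q) = weighted_gram 9 [(1/4, [0,1,0,-1,0,0,0,0,0]), (1/4, [0,0,1,0,0,0,-1,0,0])] $$ (p, q)"
    unfolding e using pq by (simp add: weighted_gram_def)
qed (simp_all add: weighted_gram_def rho_v_def ket_bra_def v1_def v2_def ket_def)

lemma weighted_gram_carrier [simp]: "weighted_gram d ws \<in> carrier_mat d d"
  by (simp add: weighted_gram_def)

lemma dim_weighted_gram [simp]:
  "dim_row (weighted_gram d ws) = d" "dim_col (weighted_gram d ws) = d"
  by (simp_all add: weighted_gram_def)

lemma index_weighted_gram:
  assumes "p < d" "q < d"
  shows "weighted_gram d ws $$ (p, q) = complex_of_real (\<Sum>(c, v)\<leftarrow>ws. c * v ! p * v ! q)"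
  using assms by (simp add: weighted_gram_def)

lemma rho_v_carrier [simp]: "rho_v \<in> carrier_mat 9 9"
  by (simp add: rho_v_eq)

lemma eq_mat_9I:
  assumes "A \<in> carrier_mat 9 9" "B \<in> carrier_mat 9 9"
    and "\<And>p q. p < 9 \<Longrightarrow> q < 9 \<Longrightarrow> A $$ (p, q) = B $$ (p, q)"
  shows "A = B"
  using assms by (intro eq_matI) auto

lemma index_ptranspose_9:
  assumes "p < 9" "q < 9"
  shows "ptranspose 3 3 X $$ (p, q) = X $$ (p div 3 * 3 + q mod 3, q div 3 * 3 + p mod 3)"
  using assms by (simp add: index_ptranspose pt_index_def)

lemma psd_rho_v: "psd 9 rho_v"
  unfolding rho_v_eq by (rule psd_weighted_gram) simp

lemma mtrace_rho_v: "mtrace rho_v = 1"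
  by (simp add: rho_v_eq mtrace_def index_weighted_gram eval_nat_numeral)

text \<open>\<open>v1\<close> and \<open>v2\<close> are orthonormal, so \<open>rho_v\<close> is half
  a projection.\<close>

lemma rho_v_square: "rho_v * rho_v = complex_of_real (1 / 2) \<cdot>\<^sub>m rho_v"
proof (rule eq_mat_9I)
  fix p q :: nat assume pq: "p < 9" "q < 9"
  have "(rho_v * rho_v) $$ (p, q) = (\<Sum>l<9. rho_v $$ (p, l) * rho_v $$ (l, q))"
    using pq by (simp add: index_mult_mat_sum[of _ 9 9 _ 9] del: index_mult_mat)
  also have "\<dots> = rho_v $$ (p, 0) * rho_v $$ (0, q) + rho_v $$ (p, 1) * rho_v $$ (1, q) +
     rho_v $$ (p, 2) * rho_v $$ (2, q) + rho_v $$ (p, 3) * rho_v $$ (3, q) + rho_v $$ (p, 4) * rho_v $$ (4, q) +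
     rho_v $$ (p, 5) * rho_v $$ (5, q) + rho_v $$ (p, 6) * rho_v $$ (6, q) + rho_v $$ (p, 7) * rho_v $$ (7, q) +
     rho_v $$ (p, 8) * rho_v $$ (8, q)"
    by (simp add: eval_nat_numeral)
  also have "\<dots> = (complex_of_real (1 / 2) \<cdot>\<^sub>m rho_v) $$ (p, q)"
    by (rule less_9_cases[OF pq(1)]; rule less_9_cases[OF pq(2)])
      (simp_all add: rho_v_eq index_weighted_gram)
  finally show "(rho_v * rho_v) $$ (p, q) = (complex_of_real (1 / 2) \<cdot>\<^sub>m rho_v) $$ (p, q)" .
qed (auto intro!: mult_carrier_mat[of _ 9 9])

text \<open>
  The operator \<open>Y\<close>.  On the span of \<open>|00\<rangle>, |11\<rangle>, |22\<rangle>\<close> the modulus of \<open>\<rho>\<^sup>T\<close> would bound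
  \<open>\<plusminus>\<rho>\<^sup>T\<close> as well, but its partial transpose has norm above \<open>1/4\<close>; the weights of \<open>|00\<rangle>\<close> and
  \<open>|11\<rangle> + |22\<rangle>\<close> are therefore rebalanced.
\<close>
definition rho_v_cover :: "complex mat" where
  "rho_v_cover = weighted_gram 9
    [(1/4, [1,0,0,0,0,0,0,0,0]), (1/4, [0,1,0,0,0,0,0,0,0]), (1/4, [0,0,1,0,0,0,0,0,0]),
     (1/4, [0,0,0,1,0,0,0,0,0]), (1/4, [0,0,0,0,0,0,1,0,0]), (1/4, [0,0,0,0,1,0,0,0,1])]"

text \<open>With weights a for |00> and b for |11> + |22>, the off-diagonal part of the transposed
  state, of size 1/4, is covered exactly when ab >= 1/16. The partial transpose of the cover has
  diagonal entries a and b, which must not exceed 1/4. Only a = b = 1/4 satisfies both.\<close>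

lemma rho_v_cover_dominates: "dominates 9 rho_v_cover (ptranspose 3 3 rho_v)"
proof -
  have pt: "ptranspose 3 3 rho_v \<in> carrier_mat 9 9" using ptranspose_carrier[of 3 3] by simp
  have "rho_v_cover + ptranspose 3 3 rho_v = weighted_gram 9
    [(1/2, [0,1,0,0,0,0,0,0,0]), (1/2, [0,0,1,0,0,0,0,0,0]), (1/2, [0,0,0,1,0,0,0,0,0]),
     (1/2, [0,0,0,0,0,0,1,0,0]), (1/4, [1,0,0,0,-1,0,0,0,-1])]"
  proof (rule eq_mat_9I)
    fix p q :: nat assume pq: "p < 9" "q < 9"
    show "(rho_v_cover + ptranspose 3 3 rho_v) $$ (p, q) = weighted_gram 9
    [(1/2, [0,1,0,0,0,0,0,0,0]), (1/2, [0,0,1,0,0,0,0,0,0]), (1/2, [0,0,0,1,0,0,0,0,0]),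
     (1/2, [0,0,0,0,0,0,1,0,0]), (1/4, [1,0,0,0,-1,0,0,0,-1])] $$ (p, q)"
      by (rule less_9_cases[OF pq(1)]; rule less_9_cases[OF pq(2)])
        (simp_all add: rho_v_eq rho_v_cover_def index_weighted_gram index_ptranspose_9)
  qed (use pt in \<open>auto simp: rho_v_cover_def\<close>)
  moreover have "rho_v_cover - ptranspose 3 3 rho_v = weighted_gram 9 [(1/4, [1,0,0,0,1,0,0,0,1])]"
  proof (rule eq_mat_9I)
    fix p q :: nat assume pq: "p < 9" "q < 9"
    show "(rho_v_cover - ptranspose 3 3 rho_v) $$ (p, q) =
        weighted_gram 9 [(1/4, [1,0,0,0,1,0,0,0,1])] $$ (p, q)"
      by (rule less_9_cases[OF pq(1)]; rule less_9_cases[OF pq(2)])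
        (simp_all add: rho_v_eq rho_v_cover_def index_weighted_gram index_ptranspose_9)
  qed (use pt in \<open>auto simp: rho_v_cover_def\<close>)
  ultimately show ?thesis
    using pt by (auto simp: dominates_def rho_v_cover_def intro!: psd_weighted_gram)
qed

text \<open>Partial transposition sends the coupling of |11> and |22> to a coupling of |12> and |21>
  with eigenvalues 1/4 and -1/4; all other diagonal entries are already 1/4.\<close>

lemma quarter_dominates: "dominates 9 (complex_of_real (1 / 4) \<cdot>\<^sub>m 1\<^sub>m 9) (ptranspose 3 3 rho_v_cover)"
proof -
  have pt: "ptranspose 3 3 rho_v_cover \<in> carrier_mat 9 9" using ptranspose_carrier[of 3 3] by simp
  have "complex_of_real (1 / 4) \<cdot>\<^sub>m 1\<^sub>m 9 + ptranspose 3 3 rho_v_cover = weighted_gram 9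
    [(1/2, [1,0,0,0,0,0,0,0,0]), (1/2, [0,1,0,0,0,0,0,0,0]), (1/2, [0,0,1,0,0,0,0,0,0]),
     (1/2, [0,0,0,1,0,0,0,0,0]), (1/2, [0,0,0,0,0,0,1,0,0]), (1/2, [0,0,0,0,1,0,0,0,0]),
     (1/2, [0,0,0,0,0,0,0,0,1]), (1/4, [0,0,0,0,0,1,0,1,0])]" (is "?L = ?R")
  proof (rule eq_mat_9I)
    fix p q :: nat assume pq: "p < 9" "q < 9"
    show "?L $$ (p, q) = ?R $$ (p, q)"
      by (rule less_9_cases[OF pq(1)]; rule less_9_cases[OF pq(2)])
        (simp_all add: rho_v_cover_def index_weighted_gram index_ptranspose_9)
  qed (use pt in auto)
  moreover have "complex_of_real (1 / 4) \<cdot>\<^sub>m 1\<^sub>m 9 - ptranspose 3 3 rho_v_cover =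
      weighted_gram 9 [(1/4, [0,0,0,0,0,1,0,-1,0])]" (is "?L = ?R")
  proof (rule eq_mat_9I)
    fix p q :: nat assume pq: "p < 9" "q < 9"
    show "?L $$ (p, q) = ?R $$ (p, q)"
      by (rule less_9_cases[OF pq(1)]; rule less_9_cases[OF pq(2)])
        (simp_all add: rho_v_cover_def index_weighted_gram index_ptranspose_9)
  qed (use pt in auto)
  ultimately show ?thesis
    using pt by (auto simp: dominates_def intro!: psd_weighted_gram)
qed

text \<open>The overlap bound shared by both halves of the theorem. Each partial transposition moves
  to the side where the next operator inequality is available.\<close>

lemma ppt_overlap_le:
  assumes "is_state (3 ^ n * 3 ^ n) \<sigma>" "psd (3 ^ n * 3 ^ n) (ptranspose (3 ^ n) (3 ^ n) \<sigma>)"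
  shows "Re (mtrace (bip_power 3 3 rho_v n * \<sigma>)) \<le> (1 / 4) ^ n"
proof -
  let ?D = "3 ^ n * 3 ^ n :: nat" and ?T = "ptranspose (3 ^ n) (3 ^ n)"
  let ?R = "bip_power 3 3 rho_v n" and ?Y = "bip_power 3 3 rho_v_cover n"
  have \<sigma>: "psd ?D \<sigma>" "\<sigma> \<in> carrier_mat ?D ?D" "mtrace \<sigma> = 1"
    using assms by (auto simp: is_state_def psd_def)
  have "dominates ?D ?Y (?T ?R)"
    unfolding ptranspose_bip_power by (rule dominates_bip_power) (use rho_v_cover_dominates in simp)
  then have 1: "psd ?D (?Y - ?T ?R)" by (simp add: dominates_def)
  have "bip_power 3 3 (complex_of_real (1 / 4) \<cdot>\<^sub>m 1\<^sub>m (3 * 3)) n = complex_of_real (1 / 4) ^ n \<cdot>\<^sub>m 1\<^sub>m ?D"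
    by (subst bip_power_smult) (simp_all only: bip_power_one one_carrier_mat)
  moreover have "dominates ?D (bip_power 3 3 (complex_of_real (1 / 4) \<cdot>\<^sub>m 1\<^sub>m (3 * 3)) n) (?T ?Y)"
    unfolding ptranspose_bip_power by (rule dominates_bip_power) (use quarter_dominates in simp)
  ultimately have 2: "psd ?D (complex_of_real (1 / 4) ^ n \<cdot>\<^sub>m 1\<^sub>m ?D - ?T ?Y)" by (simp add: dominates_def)
  have "Re (mtrace (?R * \<sigma>)) = Re (mtrace (?T ?R * ?T \<sigma>))"
    using \<sigma> by (simp add: mtrace_mult_ptranspose)
  also have "\<dots> \<le> Re (mtrace (?Y * ?T \<sigma>))"
    by (rule mtrace_mult_psd_mono[OF 1 assms(2)]) auto
  also have "\<dots> = Re (mtrace (?T ?Y * \<sigma>))"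
    using mtrace_mult_ptranspose[of ?Y "3 ^ n" "3 ^ n" "?T \<sigma>"] ptranspose_ptranspose[OF \<sigma>(2)] by simp
  also have "\<dots> \<le> Re (mtrace ((complex_of_real (1 / 4) ^ n \<cdot>\<^sub>m 1\<^sub>m ?D) * \<sigma>))"
    by (rule mtrace_mult_psd_mono[OF 2 \<sigma>(1)]) auto
  also have "(complex_of_real (1 / 4) ^ n \<cdot>\<^sub>m 1\<^sub>m ?D) * \<sigma> = complex_of_real ((1 / 4) ^ n) \<cdot>\<^sub>m \<sigma>"
    using \<sigma>(2) by (simp add: mult_smult_assoc_mat[of _ ?D ?D])
  also have "mtrace (complex_of_real ((1 / 4) ^ n) \<cdot>\<^sub>m \<sigma>) = complex_of_real ((1 / 4) ^ n)"
    using \<sigma> by (simp add: mtrace_smult)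
  finally show ?thesis by simp
qed

section \<open>Relative entropy on n copies\<close>

lemma bip_power_rho_v:
  shows "psd (3 ^ n * 3 ^ n) (bip_power 3 3 rho_v n)"
    and "mtrace (bip_power 3 3 rho_v n) = 1"
    and "bip_power 3 3 rho_v n * bip_power 3 3 rho_v n = complex_of_real ((1 / 2) ^ n) \<cdot>\<^sub>m bip_power 3 3 rho_v n"
proof -
  show "psd (3 ^ n * 3 ^ n) (bip_power 3 3 rho_v n)"
    by (rule psd_bip_power) (use psd_rho_v in simp)
  show "mtrace (bip_power 3 3 rho_v n) = 1"
    by (subst mtrace_bip_power) (simp_all add: mtrace_rho_v)
  have c: "rho_v \<in> carrier_mat (3 * 3) (3 * 3)" by simp
  show "bip_power 3 3 rho_v n * bip_power 3 3 rho_v n = complex_of_real ((1 / 2) ^ n) \<cdot>\<^sub>m bip_power 3 3 rho_v n"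
    unfolding bip_power_mult[OF c c] rho_v_square bip_power_smult[OF c] by simp
qed

lemma rel_entropy_ent_rho_v_ge:
  "ereal (real n) \<le> rel_entropy_ent (3 ^ n) (3 ^ n) (bip_power 3 3 rho_v n)"
  unfolding rel_entropy_ent_def
proof (rule INF_greatest)
  fix \<sigma> assume "\<sigma> \<in> {\<sigma>. is_state (3 ^ n * 3 ^ n) \<sigma> \<and> psd (3 ^ n * 3 ^ n) (ptranspose (3 ^ n) (3 ^ n) \<sigma>)}"
  then have \<sigma>: "is_state (3 ^ n * 3 ^ n) \<sigma>" "psd (3 ^ n * 3 ^ n) (ptranspose (3 ^ n) (3 ^ n) \<sigma>)" by auto
  then have "psd (3 ^ n * 3 ^ n) \<sigma>" by (simp add: is_state_def)
  from rel_entropy_ge[OF bip_power_rho_v this ppt_overlap_le[OF \<sigma>]]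
  have "ereal (log 2 ((1 / 2) ^ n) - log 2 ((1 / 4) ^ n)) \<le> rel_entropy (3 ^ n * 3 ^ n) (bip_power 3 3 rho_v n) \<sigma>"
    by simp
  moreover have "log 2 ((1 / 2) ^ n) - log 2 ((1 / 4) ^ n) = real n"
  proof -
    have "log 2 (1 / 4 :: real) = - 2" "log 2 (1 / 2 :: real) = - 1"
      using log_pow_cancel[of 2 2] by (simp_all add: log_divide)
    then show ?thesis by (simp add: log_nat_power)
  qed
  ultimately show "ereal (real n) \<le> rel_entropy (3 ^ n * 3 ^ n) (bip_power 3 3 rho_v n) \<sigma>" by simp
qed

text \<open>\<open>bip_power\<close> starts from the 1 by 1 identity; this identifies the first
  power with the state itself, as needed for the term n = 1 of the infimum.\<close>

lemma bip_tensor_one_left: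
  assumes "X \<in> carrier_mat (dA * dB) (dA * dB)"
  shows "bip_tensor 1 1 dA dB (1\<^sub>m 1) X = X"
proof (rule eq_matI)
  fix p q assume "p < dim_row X" "q < dim_col X"
  then have pq: "p < dA * dB" "q < dA * dB" using assms by auto
  then have "p div dB < dA" "q div dB < dA" by (auto simp: less_mult_imp_div_less)
  moreover have "p mod dB < dB" "q mod dB < dB" using pq by (auto intro!: mod_less_divisor gr0I)
  ultimately have "fst_index 1 dA dB p = 0" "fst_index 1 dA dB q = 0"
    "snd_index 1 dA dB p = p" "snd_index 1 dA dB q = q"
    by (simp_all add: fst_index_def snd_index_def)
  then show "bip_tensor 1 1 dA dB (1\<^sub>m 1) X $$ (p, q) = X $$ (p, q)"
    using pq by (simp add: index_bip_tensor)
qed (use assms in auto)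

text \<open>
  An average of two product states dephased with respect to the number of systems in \<open>|0\<rangle>\<close>,
  namely \<open>(|0\<rangle> + |e\<rangle>) \<otimes> (|0\<rangle> - |e\<rangle>)\<close> for \<open>e = 1, 2\<close>.
\<close>
definition rho_v_closest :: "complex mat" where
  "rho_v_closest = weighted_gram 9
    [(1/8, [0,1,0,-1,0,0,0,0,0]), (1/8, [0,0,1,0,0,0,-1,0,0]), (1/4, [1,0,0,0,0,0,0,0,0]),
     (1/8, [0,0,0,0,1,0,0,0,0]), (1/8, [0,0,0,0,0,0,0,0,1])]"

lemma rho_v_closest_state: "is_state 9 rho_v_closest"
proof -
  have "mtrace rho_v_closest = 1"
    by (simp add: rho_v_closest_def mtrace_def index_weighted_gram eval_nat_numeral)
  then show ?thesis by (auto simp: is_state_def rho_v_closest_def intro!: psd_weighted_gram)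
qed

lemma psd_ptranspose_rho_v_closest: "psd 9 (ptranspose 3 3 rho_v_closest)"
proof -
  have "ptranspose 3 3 rho_v_closest = weighted_gram 9
    [(1/8, [0,1,0,0,0,0,0,0,0]), (1/8, [0,0,1,0,0,0,0,0,0]), (1/8, [0,0,0,1,0,0,0,0,0]),
     (1/8, [0,0,0,0,0,0,1,0,0]), (1/8, [1,0,0,0,-1,0,0,0,0]), (1/8, [1,0,0,0,0,0,0,0,-1])]" (is "?L = ?R")
  proof (rule eq_mat_9I)
    fix p q :: nat assume pq: "p < 9" "q < 9"
    show "?L $$ (p, q) = ?R $$ (p, q)"
      by (rule less_9_cases[OF pq(1)]; rule less_9_cases[OF pq(2)])
        (simp_all add: rho_v_closest_def index_weighted_gram index_ptranspose_9)
  qed (use ptranspose_carrier[of 3 3] in auto)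
  then show ?thesis by (auto intro!: psd_weighted_gram)
qed

text \<open>The coefficient 1/8 multiplies vectors of squared length 2, so \<open>v1\<close> and
  \<open>v2\<close> are eigenvectors of \<open>rho_v_closest\<close> with eigenvalue 1/4. The
  overlap bound 1/4 is thereby attained.\<close>

lemma rho_v_mult_closest: "rho_v * rho_v_closest = complex_of_real (1 / 4) \<cdot>\<^sub>m rho_v"
proof (rule eq_mat_9I)
  let ?s = "rho_v_closest"
  have c: "?s \<in> carrier_mat 9 9" by (simp add: rho_v_closest_def)
  then show "rho_v * ?s \<in> carrier_mat 9 9" by (auto intro!: mult_carrier_mat[of _ 9 9])
  fix p q :: nat assume pq: "p < 9" "q < 9"
  have "(rho_v * ?s) $$ (p, q) = (\<Sum>l<9. rho_v $$ (p, l) * ?s $$ (l, q))"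
    using pq c by (simp add: index_mult_mat_sum[of _ 9 9 _ 9] del: index_mult_mat)
  also have "\<dots> = rho_v $$ (p, 0) * ?s $$ (0, q) + rho_v $$ (p, 1) * ?s $$ (1, q) +
     rho_v $$ (p, 2) * ?s $$ (2, q) + rho_v $$ (p, 3) * ?s $$ (3, q) + rho_v $$ (p, 4) * ?s $$ (4, q) +
     rho_v $$ (p, 5) * ?s $$ (5, q) + rho_v $$ (p, 6) * ?s $$ (6, q) + rho_v $$ (p, 7) * ?s $$ (7, q) +
     rho_v $$ (p, 8) * ?s $$ (8, q)"
    by (simp add: eval_nat_numeral)
  also have "\<dots> = (complex_of_real (1 / 4) \<cdot>\<^sub>m rho_v) $$ (p, q)"
    by (rule less_9_cases[OF pq(1)]; rule less_9_cases[OF pq(2)])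
      (simp_all add: rho_v_eq rho_v_closest_def index_weighted_gram)
  finally show "(rho_v * ?s) $$ (p, q) = (complex_of_real (1 / 4) \<cdot>\<^sub>m rho_v) $$ (p, q)" .
qed auto

lemma rel_entropy_ent_rho_v_le: "rel_entropy_ent 3 3 rho_v \<le> 1"
proof -
  have "log 2 (1 / 4 :: real) = - 2" "log 2 (1 / 2 :: real) = - 1"
    using log_pow_cancel[of 2 2] by (simp_all add: log_divide)
  then have "rel_entropy 9 rho_v rho_v_closest = 1"
    using rel_entropy_eigen[OF psd_rho_v mtrace_rho_v rho_v_square _ rho_v_mult_closest]
      rho_v_closest_state by (simp add: is_state_def one_ereal_def)
  then show ?thesis
    unfolding rel_entropy_ent_def
    using rho_v_closest_state psd_ptranspose_rho_v_closest
    by (intro INF_lower2[of rho_v_closest]) auto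
qed

lemma reg_rel_entropy_ent_rho_v: "reg_rel_entropy_ent 3 3 rho_v = 1"
proof (rule antisym)
  have "bip_power 3 3 rho_v 1 = rho_v"
    using bip_tensor_one_left[of rho_v 3 3] by simp
  then have "rel_entropy_ent (3 ^ 1) (3 ^ 1) (bip_power 3 3 rho_v 1) / ereal (real 1) \<le> 1"
    using rel_entropy_ent_rho_v_le by (simp flip: one_ereal_def)
  then show "reg_rel_entropy_ent 3 3 rho_v \<le> 1"
    unfolding reg_rel_entropy_ent_def by (intro INF_lower2[of 1]) auto
  show "1 \<le> reg_rel_entropy_ent 3 3 rho_v"
    unfolding reg_rel_entropy_ent_def
  proof (rule INF_greatest)
    fix n :: nat assume "n \<in> {1..}"
    then show "1 \<le> rel_entropy_ent (3 ^ n) (3 ^ n) (bip_power 3 3 rho_v n) / ereal (real n)"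
      using rel_entropy_ent_rho_v_ge[of n] by (simp add: ereal_le_divide_pos)
  qed
qed

section \<open>Kraus maps and PPT operations\<close>

text \<open>The operators are functions of indices rather than matrices, so that local products and
  n-fold powers of them are plain index arithmetic.\<close>

definition kraus_map ::
    "nat \<Rightarrow> nat \<Rightarrow> 'k set \<Rightarrow> ('k \<Rightarrow> nat \<Rightarrow> nat \<Rightarrow> complex) \<Rightarrow> complex mat \<Rightarrow> complex mat" where
  "kraus_map d d' S K X = Matrix.mat d' d' (\<lambda>(p, q).
     \<Sum>s\<in>S. \<Sum>i<d. \<Sum>j<d. K s p i * X $$ (i, j) * cnj (K s q j))"

lemma kraus_map_carrier [simp]: "kraus_map d d' S K X \<in> carrier_mat d' d'"
  by (simp add: kraus_map_def)

lemma index_kraus_map: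
  assumes "p < d'" "q < d'"
  shows "kraus_map d d' S K X $$ (p, q) = (\<Sum>s\<in>S. \<Sum>i<d. \<Sum>j<d. K s p i * X $$ (i, j) * cnj (K s q j))"
  using assms by (simp add: kraus_map_def)

lemma linear_kraus_map: "linear_op_map d d' (kraus_map d d' S K)"
proof -
  have "kraus_map d d' S K (X + Y) = kraus_map d d' S K X + kraus_map d d' S K Y"
    if "X \<in> carrier_mat d d" "Y \<in> carrier_mat d d" for X Y
    using that by (intro eq_matI) (auto simp: kraus_map_def algebra_simps sum.distrib)
  moreover have "kraus_map d d' S K (c \<cdot>\<^sub>m X) = c \<cdot>\<^sub>m kraus_map d d' S K X"
    if "X \<in> carrier_mat d d" for X c
    using that by (intro eq_matI) (auto simp: kraus_map_def sum_distrib_left mult_ac)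
  ultimately show ?thesis by (simp add: linear_op_map_def)
qed

text \<open>A Gram factor of the input is pushed through each Kraus operator; the images, indexed by
  operator and column, form a Gram factor of the output.\<close>

lemma completely_positive_kraus_map:
  assumes "finite S"
  shows "completely_positive d d' (kraus_map d d' S K)"
  unfolding completely_positive_def
proof (intro conjI allI impI linear_kraus_map)
  fix k X assume X: "psd (k * d) X"
  obtain Z where Z: "\<And>i j. i < k * d \<Longrightarrow> j < k * d \<Longrightarrow> X $$ (i, j) = (\<Sum>l<k * d. Z i l * cnj (Z j l))"
    using psd_gram[OF X] by blast
  define W where "W p = (\<lambda>(s, l). \<Sum>i<d. K s (p mod d') i * Z (p div d' * d + i) l)" for p
  show "psd (k * d') (ampliation k d d' (kraus_map d d' S K) X)"
  proof (rule psd_gramI[where K = "S \<times> {..<k * d}" and Z = W])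
    fix p q assume pq: "p < k * d'" "q < k * d'"
    have mod: "p mod d' < d'" "q mod d' < d'" using pq by (auto intro!: mod_less_divisor gr0I)
    have "p div d' < k" "q div d' < k" using pq by (auto simp: less_mult_imp_div_less)
    note less = pair_index_less[OF this(1)] pair_index_less[OF this(2)]
    have "ampliation k d d' (kraus_map d d' S K) X $$ (p, q) =
      (\<Sum>s\<in>S. \<Sum>i<d. \<Sum>j<d. K s (p mod d') i * X $$ (p div d' * d + i, q div d' * d + j) * cnj (K s (q mod d') j))"
      using pq mod by (simp add: ampliation_def index_kraus_map)
    also have "\<dots> = (\<Sum>s\<in>S. \<Sum>i<d. \<Sum>j<d. \<Sum>l<k * d.
        (K s (p mod d') i * Z (p div d' * d + i) l) * cnj (K s (q mod d') j * Z (q div d' * d + j) l))"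
    proof (intro sum.cong refl)
      fix s i j assume "i \<in> {..<d}" "j \<in> {..<d}"
      then have "X $$ (p div d' * d + i, q div d' * d + j) =
          (\<Sum>l<k * d. Z (p div d' * d + i) l * cnj (Z (q div d' * d + j) l))"
        by (intro Z less) auto
      then show "K s (p mod d') i * X $$ (p div d' * d + i, q div d' * d + j) * cnj (K s (q mod d') j) =
          (\<Sum>l<k * d. (K s (p mod d') i * Z (p div d' * d + i) l) * cnj (K s (q mod d') j * Z (q div d' * d + j) l))"
        by (simp only:) (simp add: sum_distrib_left sum_distrib_right mult_ac)
    qed
    also have "\<dots> = (\<Sum>s\<in>S. \<Sum>i<d. \<Sum>l<k * d. \<Sum>j<d.
        (K s (p mod d') i * Z (p div d' * d + i) l) * cnj (K s (q mod d') j * Z (q div d' * d + j) l))"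
      by (intro sum.cong refl sum.swap)
    also have "\<dots> = (\<Sum>s\<in>S. \<Sum>l<k * d. \<Sum>i<d. \<Sum>j<d.
        (K s (p mod d') i * Z (p div d' * d + i) l) * cnj (K s (q mod d') j * Z (q div d' * d + j) l))"
      by (intro sum.cong refl sum.swap)
    also have "\<dots> = (\<Sum>s\<in>S. \<Sum>l<k * d. W p (s, l) * cnj (W q (s, l)))"
      by (intro sum.cong refl) (simp only: W_def prod.case sum_product cnj_sum)
    finally show "ampliation k d d' (kraus_map d d' S K) X $$ (p, q) =
        (\<Sum>sl\<in>S \<times> {..<k * d}. W p sl * cnj (W q sl))"
      by (simp add: sum.cartesian_product case_prod_unfold)
  qed (use assms in \<open>auto simp: ampliation_def\<close>)
qed

lemma completely_positive_cong:
  assumes "completely_positive d d' L" "\<And>X. X \<in> carrier_mat d d \<Longrightarrow> L X = L' X"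
  shows "completely_positive d d' L'"
proof -
  have "linear_op_map d d' L'"
    using assms(1) by (simp add: completely_positive_def linear_op_map_def flip: assms(2))
  moreover have "ampliation k d d' L X = ampliation k d d' L' X" for k X
    unfolding ampliation_def by (intro cong_mat refl) (simp add: assms(2))
  ultimately show ?thesis using assms(1) by (simp add: completely_positive_def)
qed

definition product_kraus ::
    "nat \<Rightarrow> nat \<Rightarrow> ('k \<Rightarrow> nat \<Rightarrow> nat \<Rightarrow> complex) \<Rightarrow> ('k \<Rightarrow> nat \<Rightarrow> nat \<Rightarrow> complex) \<Rightarrow> 'k \<Rightarrow> nat \<Rightarrow> nat \<Rightarrow> complex" where
  "product_kraus dB dB' A B s p i = A s (p div dB') (i div dB) * B s (p mod dB') (i mod dB)"

lemma pt_index_div_mod: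
  assumes "0 < dB"
  shows "pt_index dB p q div dB = p div dB" "pt_index dB p q mod dB = q mod dB"
  using assms by (simp_all add: pt_index_def)

text \<open>The transposes before and after the map exchange Bob's row and column indices, so his
  operator and its conjugate trade places while Alice's stay put.\<close>

lemma ptranspose_kraus_map_product:
  assumes "0 < dB" "0 < dB'"
  shows "ptranspose dA' dB' (kraus_map (dA * dB) (dA' * dB') S (product_kraus dB dB' A B) (ptranspose dA dB X)) =
    kraus_map (dA * dB) (dA' * dB') S (product_kraus dB dB' A (\<lambda>s b j. cnj (B s b j))) X"
proof (rule eq_matI)
  let ?D = "dA * dB" and ?D' = "dA' * dB'"
  fix p q assume "p < dim_row (kraus_map ?D ?D' S (product_kraus dB dB' A (\<lambda>s b j. cnj (B s b j))) X)"
    "q < dim_col (kraus_map ?D ?D' S (product_kraus dB dB' A (\<lambda>s b j. cnj (B s b j))) X)"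
  then have pq: "p < ?D'" "q < ?D'" by (simp_all add: kraus_map_def)
  define f where "f s i j = A s (p div dB') (i div dB) * cnj (B s (p mod dB') (i mod dB)) * X $$ (i, j) *
      (cnj (A s (q div dB') (j div dB)) * B s (q mod dB') (j mod dB))" for s i j
  have "ptranspose dA' dB' (kraus_map ?D ?D' S (product_kraus dB dB' A B) (ptranspose dA dB X)) $$ (p, q) =
      (\<Sum>s\<in>S. \<Sum>i<?D. \<Sum>j<?D. f s (pt_index dB i j) (pt_index dB j i))"
    unfolding index_ptranspose[OF pq] index_kraus_map[OF pt_index_less[OF pq] pt_index_less[OF pq(2,1)]]
    using assms by (intro sum.cong refl)
      (simp add: index_ptranspose product_kraus_def pt_index_div_mod f_def mult_ac)
  also have "\<dots> = (\<Sum>s\<in>S. \<Sum>i<?D. \<Sum>j<?D. f s i j)"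
    by (intro sum.cong refl sum_pt_index)
  also have "\<dots> = kraus_map ?D ?D' S (product_kraus dB dB' A (\<lambda>s b j. cnj (B s b j))) X $$ (p, q)"
    using pq by (simp add: index_kraus_map product_kraus_def f_def)
  finally show "ptranspose dA' dB' (kraus_map ?D ?D' S (product_kraus dB dB' A B) (ptranspose dA dB X)) $$ (p, q) =
    kraus_map ?D ?D' S (product_kraus dB dB' A (\<lambda>s b j. cnj (B s b j))) X $$ (p, q)" .
qed (simp_all add: kraus_map_def)

lemma mtrace_kraus_map:
  assumes X: "X \<in> carrier_mat d d"
    and tp: "\<And>i j. i < d \<Longrightarrow> j < d \<Longrightarrow> (\<Sum>s\<in>S. \<Sum>p<d'. K s p i * cnj (K s p j)) = (if i = j then 1 else 0)"
  shows "mtrace (kraus_map d d' S K X) = mtrace X"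
proof -
  have "mtrace (kraus_map d d' S K X) = (\<Sum>p<d'. \<Sum>s\<in>S. \<Sum>i<d. \<Sum>j<d. K s p i * X $$ (i, j) * cnj (K s p j))"
    by (simp add: mtrace_def kraus_map_def)
  also have "\<dots> = (\<Sum>s\<in>S. \<Sum>p<d'. \<Sum>i<d. \<Sum>j<d. K s p i * X $$ (i, j) * cnj (K s p j))"
    by (rule sum.swap)
  also have "\<dots> = (\<Sum>s\<in>S. \<Sum>i<d. \<Sum>p<d'. \<Sum>j<d. K s p i * X $$ (i, j) * cnj (K s p j))"
    by (intro sum.cong refl sum.swap)
  also have "\<dots> = (\<Sum>s\<in>S. \<Sum>i<d. \<Sum>j<d. \<Sum>p<d'. K s p i * X $$ (i, j) * cnj (K s p j))"
    by (intro sum.cong refl sum.swap)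
  also have "\<dots> = (\<Sum>i<d. \<Sum>s\<in>S. \<Sum>j<d. \<Sum>p<d'. K s p i * X $$ (i, j) * cnj (K s p j))"
    by (rule sum.swap)
  also have "\<dots> = (\<Sum>i<d. \<Sum>j<d. \<Sum>s\<in>S. \<Sum>p<d'. K s p i * X $$ (i, j) * cnj (K s p j))"
    by (intro sum.cong refl sum.swap)
  also have "\<dots> = (\<Sum>i<d. \<Sum>j<d. X $$ (i, j) * (\<Sum>s\<in>S. \<Sum>p<d'. K s p i * cnj (K s p j)))"
    by (simp add: sum_distrib_left mult_ac)
  also have "\<dots> = (\<Sum>i<d. \<Sum>j<d. if i = j then X $$ (i, j) else 0)"
    by (intro sum.cong refl) (simp add: tp)
  also have "\<dots> = mtrace X" using X by (simp add: mtrace_def)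
  finally show ?thesis .
qed

text \<open>
  The partial transposes turn Bob's Kraus operators into their complex conjugates; for real ones the
  map does not change.
\<close>
lemma ppt_operation_product_kraus:
  assumes "finite S" and pos: "0 < dB" "0 < dB'"
    and real: "\<And>s b j. cnj (B s b j) = B s b j"
    and tp: "\<And>i i' j j'. i < dA \<Longrightarrow> i' < dA \<Longrightarrow> j < dB \<Longrightarrow> j' < dB \<Longrightarrow>
      (\<Sum>s\<in>S. (\<Sum>a<dA'. A s a i * cnj (A s a i')) * (\<Sum>b<dB'. B s b j * cnj (B s b j'))) =
      (if i = i' \<and> j = j' then 1 else 0)"
  shows "ppt_operation dA dB dA' dB' (kraus_map (dA * dB) (dA' * dB') S (product_kraus dB dB' A B))"
proof -
  let ?K = "product_kraus dB dB' A B"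
  let ?L = "kraus_map (dA * dB) (dA' * dB') S ?K"
  note cp = completely_positive_kraus_map[OF assms(1), of "dA * dB" "dA' * dB'" ?K]
  have "completely_positive (dA * dB) (dA' * dB') (ptranspose dA' dB' \<circ> ?L \<circ> ptranspose dA dB)"
    by (rule completely_positive_cong[OF cp]) (simp add: ptranspose_kraus_map_product[OF pos] real)
  moreover have "(\<Sum>s\<in>S. \<Sum>p<dA' * dB'. ?K s p i * cnj (?K s p j)) = (if i = j then 1 else 0)"
    if "i < dA * dB" "j < dA * dB" for i j
  proof -
    have less: "i div dB < dA" "j div dB < dA" "i mod dB < dB" "j mod dB < dB"
      using that pos by (auto simp: less_mult_imp_div_less)
    have "(\<Sum>p<dA' * dB'. ?K s p i * cnj (?K s p j)) =
        (\<Sum>a<dA'. A s a (i div dB) * cnj (A s a (j div dB))) * (\<Sum>b<dB'. B s b (i mod dB) * cnj (B s b (j mod dB)))" for s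
      unfolding sum_pair_index sum_product
      by (intro sum.cong refl) (simp add: product_kraus_def mult_ac)
    moreover have "i = j \<longleftrightarrow> i div dB = j div dB \<and> i mod dB = j mod dB"
      by (metis div_mult_mod_eq)
    ultimately show ?thesis using tp[OF less] by simp
  qed
  ultimately show ?thesis
    using cp by (simp add: ppt_operation_def cptp_def mtrace_kraus_map)
qed

text \<open>Discard the input and prepare |00>, with Kraus operators |0><k| for Alice and |0><l| for
  Bob. It makes the set of operations nonempty, without which the real infimum in
  \<open>formation_error\<close> could not be bounded below.\<close>

lemma ppt_operation_exists:
  assumes "0 < dB" "0 < dA'" "0 < dB'"
  shows "\<exists>L. ppt_operation dA dB dA' dB' L"
proof -
  define A :: "nat \<times> nat \<Rightarrow> nat \<Rightarrow> nat \<Rightarrow> complex"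
    where "A = (\<lambda>(k, l) a i. if a = 0 then (if i = k then 1 else 0) else 0)"
  define B :: "nat \<times> nat \<Rightarrow> nat \<Rightarrow> nat \<Rightarrow> complex"
    where "B = (\<lambda>(k, l) b j. if b = 0 then (if j = l then 1 else 0) else 0)"
  have A: "(\<Sum>a<dA'. A (k, l) a i * cnj (A (k, l) a i')) = (if i = k then (if i' = k then 1 else 0) else 0)" for k l i i'
  proof -
    have "(\<Sum>a<dA'. A (k, l) a i * cnj (A (k, l) a i')) =
        (\<Sum>a<dA'. if a = 0 then (if i = k then (if i' = k then 1 else 0) else 0) else 0)"
      by (intro sum.cong refl) (simp add: A_def)
    then show ?thesis using assms by simp
  qed
  have B: "(\<Sum>b<dB'. B (k, l) b j * cnj (B (k, l) b j')) = (if j = l then (if j' = l then 1 else 0) else 0)" for k l j j'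
  proof -
    have "(\<Sum>b<dB'. B (k, l) b j * cnj (B (k, l) b j')) =
        (\<Sum>b<dB'. if b = 0 then (if j = l then (if j' = l then 1 else 0) else 0) else 0)"
      by (intro sum.cong refl) (simp add: B_def)
    then show ?thesis using assms by simp
  qed
  have "ppt_operation dA dB dA' dB' (kraus_map (dA * dB) (dA' * dB') ({..<dA} \<times> {..<dB}) (product_kraus dB dB' A B))"
  proof (rule ppt_operation_product_kraus)
    fix i i' j j' assume ij: "i < dA" "i' < dA" "j < dB" "j' < dB"
    have "(\<Sum>s\<in>{..<dA} \<times> {..<dB}. (\<Sum>a<dA'. A s a i * cnj (A s a i')) * (\<Sum>b<dB'. B s b j * cnj (B s b j'))) =
        (\<Sum>(k, l)\<in>{..<dA} \<times> {..<dB}. (if i = k then (if i' = k then 1 else 0) else 0) * (if j = l then (if j' = l then 1 else 0) else 0))"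
      by (intro sum.cong refl) (auto simp: A B)
    also have "\<dots> =
        (\<Sum>k<dA. if i = k then (if i' = k then 1 else 0) else 0) * (\<Sum>l<dB. if j = l then (if j' = l then 1 else 0) else 0)"
      by (simp only: sum_product sum.cartesian_product)
    also have "\<dots> = (if i = i' \<and> j = j' then 1 else 0)" using ij by auto
    finally show "(\<Sum>s\<in>{..<dA} \<times> {..<dB}. (\<Sum>a<dA'. A s a i * cnj (A s a i')) * (\<Sum>b<dB'. B s b j * cnj (B s b j'))) =
        (if i = i' \<and> j = j' then 1 else 0)" .
  qed (use assms in \<open>auto simp: B_def\<close>)
  then show ?thesis by blast
qed

text \<open>
  Indices of the factors are combined as in \<open>bip_power\<close>; per factor, the family index \<open>s\<close> has \<open>d\<close>
  values and the matrices have size \<open>m\<close> times \<open>k\<close>.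
\<close>
fun family_power :: "nat \<Rightarrow> nat \<Rightarrow> nat \<Rightarrow> (nat \<Rightarrow> nat \<Rightarrow> nat \<Rightarrow> complex) \<Rightarrow> nat \<Rightarrow> nat \<Rightarrow> nat \<Rightarrow> nat \<Rightarrow> complex" where
  "family_power d m k C 0 s a b = 1"
| "family_power d m k C (Suc n) s a b =
     family_power d m k C n (s div d) (a div m) (b div k) * C (s mod d) (a mod m) (b mod k)"

text \<open>A decomposition into rank-one terms passes to powers: the vectors of the power are the
  products of the single-copy vectors. \<open>C s a b\<close> is the coefficient of the s-th vector
  at Alice's index \<open>a\<close> and Bob's index \<open>b\<close>.\<close>

lemma bip_power_family:
  assumes pos: "0 < d" "0 < dA" "0 < dB"
    and X: "\<And>p q. p < dA * dB \<Longrightarrow> q < dA * dB \<Longrightarrow>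
      X $$ (p, q) = (\<Sum>s<d. C s (p div dB) (p mod dB) * cnj (C s (q div dB) (q mod dB)))"
    and pq: "p < dA ^ n * dB ^ n" "q < dA ^ n * dB ^ n"
  shows "bip_power dA dB X n $$ (p, q) =
    (\<Sum>s<d ^ n. family_power d dA dB C n s (p div dB ^ n) (p mod dB ^ n) *
       cnj (family_power d dA dB C n s (q div dB ^ n) (q mod dB ^ n)))"
  using pq
proof (induction n arbitrary: p q)
  case 0
  then show ?case by simp
next
  case (Suc n)
  let ?f = "fst_index (dB ^ n) dA dB" and ?s = "snd_index (dB ^ n) dA dB"
  let ?P = "family_power d dA dB C"
  have pq: "p < (dA ^ n * dA) * (dB ^ n * dB)" "q < (dA ^ n * dA) * (dB ^ n * dB)"
    using Suc.prems by (simp_all add: mult.commute)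
  note less = fst_index_less[OF pq(1)] fst_index_less[OF pq(2)] snd_index_less[OF pq(1)] snd_index_less[OF pq(2)]
  \<comment> \<open>The newest factor is the least significant digit on each side, in base
    \<open>dA\<close> for Alice and \<open>dB\<close> for Bob, matching the recursion of
    \<open>family_power\<close>.\<close>
  have idx: "?f r div dB ^ n = r div dB ^ Suc n div dA" "?f r mod dB ^ n = r mod dB ^ Suc n div dB"
    "?s r div dB = r div dB ^ Suc n mod dA" "?s r mod dB = r mod dB ^ Suc n mod dB" for r
  proof -
    have 1: "r mod (dB ^ n * dB) div dB < dB ^ n"
      using pos by (intro less_mult_imp_div_less) simp
    have 2: "r mod (dB ^ n * dB) mod dB < dB" using pos by simp
    show "?f r div dB ^ n = r div dB ^ Suc n div dA" "?f r mod dB ^ n = r mod dB ^ Suc n div dB"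
      "?s r div dB = r div dB ^ Suc n mod dA" "?s r mod dB = r mod dB ^ Suc n mod dB"
      unfolding fst_index_def snd_index_def power_Suc2
      using pair_index_div_mod[OF 1] pair_index_div_mod[OF 2] by simp_all
  qed
  have "bip_power dA dB X (Suc n) $$ (p, q) =
    (\<Sum>s<d ^ n. ?P n s (?f p div dB ^ n) (?f p mod dB ^ n) * cnj (?P n s (?f q div dB ^ n) (?f q mod dB ^ n))) *
    (\<Sum>t<d. C t (?s p div dB) (?s p mod dB) * cnj (C t (?s q div dB) (?s q mod dB)))"
    using index_bip_tensor[OF pq] Suc.IH[OF less(1,2)] X[OF less(3,4)] by simp
  also have "\<dots> = (\<Sum>s<d ^ n. \<Sum>t<d.
      ?P (Suc n) (s * d + t) (p div dB ^ Suc n) (p mod dB ^ Suc n) *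
      cnj (?P (Suc n) (s * d + t) (q div dB ^ Suc n) (q mod dB ^ Suc n)))"
    unfolding sum_product idx by (intro sum.cong refl) (simp add: mult_ac)
  also have "\<dots> = (\<Sum>s<d ^ n * d. ?P (Suc n) s (p div dB ^ Suc n) (p mod dB ^ Suc n) *
      cnj (?P (Suc n) s (q div dB ^ Suc n) (q mod dB ^ Suc n)))"
    by (rule sum_pair_index[symmetric])
  finally show ?case by (simp only: power_Suc2)
qed

text \<open>Here the last two indices are output and input of a local operator, and \<open>c\<close>
  is the squared scale of a multiple of an isometry.\<close>

lemma family_power_isometry:
  assumes iso: "\<And>s i i'. s < d \<Longrightarrow> i < k \<Longrightarrow> i' < k \<Longrightarrow>
      (\<Sum>a<m. C s a i * cnj (C s a i')) = (if i = i' then c else 0)"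
    and "s < d ^ n" "i < k ^ n" "i' < k ^ n"
  shows "(\<Sum>a<m ^ n. family_power d m k C n s a i * cnj (family_power d m k C n s a i')) =
    (if i = i' then c ^ n else 0)"
  using assms(2-)
proof (induction n arbitrary: s i i')
  case 0
  then show ?case by simp
next
  case (Suc n)
  let ?P = "family_power d m k C"
  have pos: "0 < d" "0 < k" using Suc.prems by (auto intro!: gr0I)
  have less: "s div d < d ^ n" "i div k < k ^ n" "i' div k < k ^ n" "s mod d < d" "i mod k < k" "i' mod k < k"
    using Suc.prems pos unfolding power_Suc2 by (auto simp: less_mult_imp_div_less)
  have "(\<Sum>a<m ^ Suc n. ?P (Suc n) s a i * cnj (?P (Suc n) s a i')) =
      (\<Sum>a<m ^ n. \<Sum>b<m. ?P (Suc n) s (a * m + b) i * cnj (?P (Suc n) s (a * m + b) i'))"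
    unfolding power_Suc2 by (rule sum_pair_index)
  also have "\<dots> = (\<Sum>a<m ^ n. ?P n (s div d) a (i div k) * cnj (?P n (s div d) a (i' div k))) *
      (\<Sum>b<m. C (s mod d) b (i mod k) * cnj (C (s mod d) b (i' mod k)))"
    unfolding sum_product by (intro sum.cong refl) (simp add: mult_ac)
  also have "\<dots> = (if i div k = i' div k then c ^ n else 0) * (if i mod k = i' mod k then c else 0)"
    unfolding Suc.IH[OF less(1-3)] iso[OF less(4-6)] ..
  also have "\<dots> = (if i = i' then c ^ Suc n else 0)"
  proof -
    have "i = i' \<longleftrightarrow> i div k = i' div k \<and> i mod k = i' mod k" by (metis div_mult_mod_eq)
    then show ?thesis by simp
  qed
  finally show ?case .
qed

lemma family_power_cnj:
  assumes "\<And>s a b. cnj (C s a b) = C s a b"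
  shows "cnj (family_power d m k C n s a b) = family_power d m k C n s a b"
  by (induction n arbitrary: s a b) (simp_all add: assms)

text \<open>The mixed-product rule: local operators applied to a product vector act factor by
  factor. \<open>F\<close> is a family of size 1, so its index stays 0 throughout.\<close>

lemma family_power_contract:
  fixes F :: "nat \<Rightarrow> nat \<Rightarrow> nat \<Rightarrow> complex"
  assumes base: "\<And>s a b. s < d \<Longrightarrow> a < mA \<Longrightarrow> b < mB \<Longrightarrow>
      (\<Sum>i<kA. \<Sum>j<kB. A s a i * B s b j * F 0 i j) = C s a b"
    and "s < d ^ n" "a < mA ^ n" "b < mB ^ n"
  shows "(\<Sum>i<kA ^ n. \<Sum>j<kB ^ n. family_power d mA kA A n s a i * family_power d mB kB B n s b j *
      family_power 1 kA kB F n 0 i j) = family_power d mA mB C n s a b"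
  using assms(2-)
proof (induction n arbitrary: s a b)
  case 0
  then show ?case by simp
next
  case (Suc n)
  let ?A = "family_power d mA kA A" and ?B = "family_power d mB kB B"
    and ?F = "family_power 1 kA kB F" and ?C = "family_power d mA mB C"
  have pos: "0 < d" "0 < mA" "0 < mB" using Suc.prems by (auto intro!: gr0I)
  have less: "s div d < d ^ n" "a div mA < mA ^ n" "b div mB < mB ^ n" "s mod d < d" "a mod mA < mA" "b mod mB < mB"
    using Suc.prems pos unfolding power_Suc2 by (auto simp: less_mult_imp_div_less)
  have "(\<Sum>i<kA ^ Suc n. \<Sum>j<kB ^ Suc n. ?A (Suc n) s a i * ?B (Suc n) s b j * ?F (Suc n) 0 i j) =
      (\<Sum>i<kA ^ n. \<Sum>i'<kA. \<Sum>j<kB ^ n. \<Sum>j'<kB.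
        ?A (Suc n) s a (i * kA + i') * ?B (Suc n) s b (j * kB + j') * ?F (Suc n) 0 (i * kA + i') (j * kB + j'))"
    unfolding power_Suc2 sum_pair_index ..
  also have "\<dots> = (\<Sum>i<kA ^ n. \<Sum>i'<kA. \<Sum>j<kB ^ n. \<Sum>j'<kB.
        (?A n (s div d) (a div mA) i * ?B n (s div d) (b div mB) j * ?F n 0 i j) *
        (A (s mod d) (a mod mA) i' * B (s mod d) (b mod mB) j' * F 0 i' j'))"
    by (intro sum.cong refl) (simp add: mult_ac)
  also have "\<dots> = (\<Sum>i<kA ^ n. \<Sum>j<kB ^ n. \<Sum>i'<kA. \<Sum>j'<kB.
        (?A n (s div d) (a div mA) i * ?B n (s div d) (b div mB) j * ?F n 0 i j) *
        (A (s mod d) (a mod mA) i' * B (s mod d) (b mod mB) j' * F 0 i' j'))"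
    by (intro sum.cong refl sum.swap)
  also have "\<dots> = (\<Sum>i<kA ^ n. \<Sum>j<kB ^ n. ?A n (s div d) (a div mA) i * ?B n (s div d) (b div mB) j * ?F n 0 i j) *
      (\<Sum>i'<kA. \<Sum>j'<kB. A (s mod d) (a mod mA) i' * B (s mod d) (b mod mB) j' * F 0 i' j')"
    by (simp only: sum_distrib_right) (simp only: sum_distrib_left)
  also have "\<dots> = ?C (Suc n) s a b"
    unfolding Suc.IH[OF less(1-3)] base[OF less(4-6)] by simp
  finally show ?case .
qed

text \<open>The input is pure with coefficients \<open>F\<close>; each Kraus operator sends it to
  one vector of the decomposition of the target, so the output sums to the target.\<close>

lemma product_kraus_family_output:
  fixes F :: "nat \<Rightarrow> nat \<Rightarrow> nat \<Rightarrow> complex"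
  assumes pos: "0 < d" "0 < mA" "0 < mB" "0 < kA" "0 < kB"
    and base: "\<And>s a b. s < d \<Longrightarrow> a < mA \<Longrightarrow> b < mB \<Longrightarrow>
      (\<Sum>i<kA. \<Sum>j<kB. A s a i * B s b j * F 0 i j) = C s a b"
    and X: "\<And>p q. p < kA * kB \<Longrightarrow> q < kA * kB \<Longrightarrow>
      X $$ (p, q) = F 0 (p div kB) (p mod kB) * cnj (F 0 (q div kB) (q mod kB))"
    and Y: "\<And>p q. p < mA * mB \<Longrightarrow> q < mA * mB \<Longrightarrow>
      Y $$ (p, q) = (\<Sum>s<d. C s (p div mB) (p mod mB) * cnj (C s (q div mB) (q mod mB)))"
  shows "kraus_map (kA ^ n * kB ^ n) (mA ^ n * mB ^ n) {..<d ^ n}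
      (product_kraus (kB ^ n) (mB ^ n) (family_power d mA kA A n) (family_power d mB kB B n))
      (bip_power kA kB X n) = bip_power mA mB Y n" (is "?L = _")
proof (rule eq_matI)
  let ?D = "kA ^ n * kB ^ n" and ?D' = "mA ^ n * mB ^ n"
  let ?K = "product_kraus (kB ^ n) (mB ^ n) (family_power d mA kA A n) (family_power d mB kB B n)"
  let ?F = "\<lambda>i. family_power 1 kA kB F n 0 (i div kB ^ n) (i mod kB ^ n)"
  let ?C = "\<lambda>s p. family_power d mA mB C n s (p div mB ^ n) (p mod mB ^ n)"
  fix p q assume "p < dim_row (bip_power mA mB Y n)" "q < dim_col (bip_power mA mB Y n)"
  then have pq: "p < ?D'" "q < ?D'" by simp_all
  have X': "bip_power kA kB X n $$ (i, j) = ?F i * cnj (?F j)" if "i < ?D" "j < ?D" for i j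
    using bip_power_family[of 1 kA kB X F i n j] pos X that by simp
  have contract: "(\<Sum>i<?D. ?K s r i * ?F i) = ?C s r" if "s < d ^ n" "r < ?D'" for s r
  proof -
    have "0 < mB ^ n" using pos by simp
    then have "r div mB ^ n < mA ^ n" "r mod mB ^ n < mB ^ n"
      using that by (auto simp: less_mult_imp_div_less)
    from family_power_contract[where d = d and mA = mA and mB = mB and kA = kA and kB = kB
        and A = A and B = B and F = F and C = C, OF base that(1) this]
    show ?thesis
      unfolding sum_pair_index using pos by (simp add: product_kraus_def)
  qed
  have "?L $$ (p, q) = (\<Sum>s<d ^ n. \<Sum>i<?D. \<Sum>j<?D. (?K s p i * ?F i) * cnj (?K s q j * ?F j))"
    unfolding index_kraus_map[OF pq] by (intro sum.cong refl) (simp add: X' mult_ac)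
  also have "\<dots> = (\<Sum>s<d ^ n. (\<Sum>i<?D. ?K s p i * ?F i) * cnj (\<Sum>j<?D. ?K s q j * ?F j))"
    by (simp only: sum_product cnj_sum)
  also have "\<dots> = (\<Sum>s<d ^ n. ?C s p * cnj (?C s q))"
    by (intro sum.cong refl) (simp only: contract pq lessThan_iff)
  also have "\<dots> = bip_power mA mB Y n $$ (p, q)"
    using bip_power_family[of d mA mB Y C p n q] pos Y pq by simp
  finally show "?L $$ (p, q) = bip_power mA mB Y n $$ (p, q)" .
qed (simp_all add: kraus_map_def)

section \<open>The entanglement cost\<close>

lemma less_4_cases:
  assumes "(p :: nat) < 4"
  obtains "p = 0" | "p = 1" | "p = 2" | "p = 3"
  using assms by linarith

text \<open>The first argument is the family index required by \<open>family_power\<close>; its only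
  value is 0 because the state is pure.\<close>

definition phi_coeff :: "nat \<Rightarrow> nat \<Rightarrow> nat \<Rightarrow> complex" where
  "phi_coeff s i j = (if i = j then complex_of_real (1 / sqrt 2) else 0)"

lemma half_eq: "complex_of_real (1 / sqrt 2) * complex_of_real (1 / sqrt 2) = 1 / 2"
  by (simp flip: of_real_mult)

lemma index_phi_plus:
  assumes "p < 4"
  shows "phi_plus $ p = phi_coeff 0 (p div 2) (p mod 2)"
  by (rule less_4_cases[OF assms]) (simp_all add: phi_plus_def ket_def phi_coeff_def)

lemma dim_phi_plus: "dim_vec phi_plus = 4"
  by (simp add: phi_plus_def ket_def)

lemma index_Phi:
  assumes "p < 4" "q < 4"
  shows "Phi $$ (p, q) = phi_coeff 0 (p div 2) (p mod 2) * cnj (phi_coeff 0 (q div 2) (q mod 2))"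
  using assms by (simp add: Phi_def ket_bra_def dim_phi_plus index_phi_plus)

lemma Phi_eq: "Phi = weighted_gram 4 [(1/2, [1,0,0,1])]"
proof (rule eq_matI)
  fix p q assume "p < dim_row (weighted_gram 4 [(1/2, [1,0,0,1])])" "q < dim_col (weighted_gram 4 [(1/2, [1,0,0,1])])"
  then have pq: "p < 4" "q < 4" by simp_all
  show "Phi $$ (p, q) = weighted_gram 4 [(1/2, [1,0,0,1])] $$ (p, q)"
    unfolding index_Phi[OF pq]
    by ((rule less_4_cases[OF pq(1)]; rule less_4_cases[OF pq(2)]),
        simp_all add: phi_coeff_def half_eq index_weighted_gram del: of_real_divide, simp_all)
qed (simp_all add: Phi_def ket_bra_def dim_phi_plus)

text \<open>
  \<open>alice_isometry s\<close> and \<open>bob_isometry s\<close> take \<open>phi_plus\<close> to \<open>v1\<close> for \<open>s = 0\<close> and to \<open>v2\<close> for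
  \<open>s = 1\<close>, up to the factor \<open>1 / sqrt 2\<close> on Alice's side which accounts for the probability
  \<open>1 / 2\<close> of either choice.
\<close>
definition alice_isometry :: "nat \<Rightarrow> nat \<Rightarrow> nat \<Rightarrow> complex" where
  "alice_isometry s a i = complex_of_real (1 / sqrt 2) * (if a = (if i = 0 then 0 else Suc s) then 1 else 0)"

definition bob_isometry :: "nat \<Rightarrow> nat \<Rightarrow> nat \<Rightarrow> complex" where
  "bob_isometry s b j = (if j = 0 then (if b = Suc s then 1 else 0) else (if b = 0 then - 1 else 0))"

text \<open>For \<open>s\<close> equal to 0 and 1, the coefficients of \<open>v1\<close> and
  \<open>v2\<close> scaled by the square root of the probability 1/2, so that the rank-one terms add
  up to \<open>rho_v\<close>.\<close>

definition rho_v_coeff :: "nat \<Rightarrow> nat \<Rightarrow> nat \<Rightarrow> complex" where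
  "rho_v_coeff s a b = (1 / 2) * ((if a = 0 \<and> b = Suc s then 1 else 0) - (if a = Suc s \<and> b = 0 then 1 else 0))"

lemma sum_lessThan_2: "(\<Sum>i<2. f i) = f 0 + f (1 :: nat)" for f :: "nat \<Rightarrow> 'a :: comm_monoid_add"
  by (simp add: eval_nat_numeral)

lemma sum_lessThan_3: "(\<Sum>i<3. f i) = f 0 + f 1 + f (2 :: nat)" for f :: "nat \<Rightarrow> 'a :: comm_monoid_add"
  by (simp add: eval_nat_numeral)

lemma index_rho_v:
  assumes "p < 9" "q < 9"
  shows "rho_v $$ (p, q) = (\<Sum>s<2. rho_v_coeff s (p div 3) (p mod 3) * cnj (rho_v_coeff s (q div 3) (q mod 3)))"
  by (rule less_9_cases[OF assms(1)]; rule less_9_cases[OF assms(2)])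
    (simp_all add: rho_v_eq index_weighted_gram sum_lessThan_2 rho_v_coeff_def)

lemma isometries_contract:
  assumes "s < 2" "a < 3" "b < 3"
  shows "(\<Sum>i<2. \<Sum>j<2. alice_isometry s a i * bob_isometry s b j * phi_coeff 0 i j) = rho_v_coeff s a b"
proof -
  have "(\<Sum>i<2. \<Sum>j<2. alice_isometry s a i * bob_isometry s b j * phi_coeff 0 i j) =
      (complex_of_real (1 / sqrt 2) * complex_of_real (1 / sqrt 2)) *
      ((if a = 0 \<and> b = Suc s then 1 else 0) - (if a = Suc s \<and> b = 0 then 1 else 0))"
    by (simp add: sum_lessThan_2 alice_isometry_def bob_isometry_def phi_coeff_def)
  then show ?thesis unfolding half_eq rho_v_coeff_def .
qed

lemma alice_isometry_iso:
  assumes "s < 2" "i < 2" "i' < 2"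
  shows "(\<Sum>a<3. alice_isometry s a i * cnj (alice_isometry s a i')) = (if i = i' then 1 / 2 else 0)"
proof -
  have "(\<Sum>a<3. alice_isometry s a i * cnj (alice_isometry s a i')) =
     (complex_of_real (1 / sqrt 2) * complex_of_real (1 / sqrt 2)) * (if i = i' then 1 else 0)"
    using assms by (auto simp: less_2_cases_iff sum_lessThan_3 alice_isometry_def)
  also have "\<dots> = (if i = i' then 1 / 2 else 0)" unfolding half_eq by simp
  finally show ?thesis .
qed

lemma bob_isometry_iso:
  assumes "s < 2" "i < 2" "i' < 2"
  shows "(\<Sum>a<3. bob_isometry s a i * cnj (bob_isometry s a i')) = (if i = i' then 1 else 0)"
  using assms by (auto simp: less_2_cases_iff sum_lessThan_3 bob_isometry_def)

lemma rho_v_formation_exact: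
  "\<exists>L. ppt_operation (2 ^ n) (2 ^ n) (3 ^ n) (3 ^ n) L \<and> L (bip_power 2 2 Phi n) = bip_power 3 3 rho_v n"
proof -
  let ?A = "family_power 2 3 2 alice_isometry n" and ?B = "family_power 2 3 2 bob_isometry n"
  let ?L = "kraus_map (2 ^ n * 2 ^ n) (3 ^ n * 3 ^ n) {..<2 ^ n} (product_kraus (2 ^ n) (3 ^ n) ?A ?B)"
  have "ppt_operation (2 ^ n) (2 ^ n) (3 ^ n) (3 ^ n) ?L"
  proof (rule ppt_operation_product_kraus)
    show "cnj (?B s b j) = ?B s b j" for s b j
      by (rule family_power_cnj) (simp add: bob_isometry_def)
    fix i i' j j' :: nat assume ij: "i < 2 ^ n" "i' < 2 ^ n" "j < 2 ^ n" "j' < 2 ^ n"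
    have "(\<Sum>s<2 ^ n. (\<Sum>a<3 ^ n. ?A s a i * cnj (?A s a i')) * (\<Sum>b<3 ^ n. ?B s b j * cnj (?B s b j'))) =
        (\<Sum>s<(2 :: nat) ^ n. (if i = i' then (1 / 2) ^ n else 0) * (if j = j' then 1 ^ n else (0 :: complex)))"
    proof (intro sum.cong refl arg_cong2[where f = "(*)"])
      fix s :: nat assume "s \<in> {..<2 ^ n}"
      then have s: "s < 2 ^ n" by simp
      show "(\<Sum>a<3 ^ n. ?A s a i * cnj (?A s a i')) = (if i = i' then (1 / 2) ^ n else 0)"
        by (rule family_power_isometry[OF alice_isometry_iso s ij(1,2)])
      show "(\<Sum>b<3 ^ n. ?B s b j * cnj (?B s b j')) = (if j = j' then 1 ^ n else 0)"
        by (rule family_power_isometry[OF bob_isometry_iso s ij(3,4)])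
    qed
    \<comment> \<open>The 2^n choices of isometries each carry the factor (1/2)^n from Alice's side,
      which together give trace preservation.\<close>
    also have "\<dots> = (if i = i' \<and> j = j' then 1 else 0)"
      by (simp flip: power_mult_distrib)
    finally show "(\<Sum>s<2 ^ n. (\<Sum>a<3 ^ n. ?A s a i * cnj (?A s a i')) * (\<Sum>b<3 ^ n. ?B s b j * cnj (?B s b j'))) =
        (if i = i' \<and> j = j' then 1 else 0)" .
  qed auto
  moreover have "?L (bip_power 2 2 Phi n) = bip_power 3 3 rho_v n"
    by (rule product_kraus_family_output[where F = phi_coeff and C = rho_v_coeff])
      (simp_all add: isometries_contract index_Phi index_rho_v)
  ultimately show ?thesis by blast
qed

section \<open>Lower bound on the formation error\<close>

lemma completely_positive_psd:
  assumes "completely_positive d d' L" "psd d X"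
  shows "psd d' (L X)"
proof -
  have X: "X \<in> carrier_mat d d" using assms(2) by (simp add: psd_def)
  then have LX: "L X \<in> carrier_mat d' d'"
    using assms(1) by (simp add: completely_positive_def linear_op_map_def)
  have "Matrix.mat d d (\<lambda>(s, t). X $$ (s, t)) = X" using X by (intro eq_matI) auto
  then have "ampliation 1 d d' L X = L X"
    using LX by (intro eq_matI) (auto simp: ampliation_def)
  then show ?thesis using assms unfolding completely_positive_def by (metis mult_1)
qed

lemma ppt_operation_psd:
  assumes "ppt_operation dA dB dA' dB' L" "psd (dA * dB) X"
  shows "psd (dA' * dB') (L X)"
  using assms completely_positive_psd by (auto simp: ppt_operation_def cptp_def)

lemma ppt_operation_preserves_ppt_state:
  assumes L: "ppt_operation dA dB dA' dB' L"
    and \<sigma>: "is_state (dA * dB) \<sigma>" "psd (dA * dB) (ptranspose dA dB \<sigma>)"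
  shows "is_state (dA' * dB') (L \<sigma>)" "psd (dA' * dB') (ptranspose dA' dB' (L \<sigma>))"
proof -
  have c: "\<sigma> \<in> carrier_mat (dA * dB) (dA * dB)" using \<sigma> by (simp add: is_state_def psd_def)
  show "is_state (dA' * dB') (L \<sigma>)"
    using ppt_operation_psd[OF L, of \<sigma>] L \<sigma> c by (simp add: is_state_def ppt_operation_def cptp_def)
  have "completely_positive (dA * dB) (dA' * dB') (ptranspose dA' dB' \<circ> L \<circ> ptranspose dA dB)"
    using L by (simp add: ppt_operation_def)
  from completely_positive_psd[OF this \<sigma>(2)] show "psd (dA' * dB') (ptranspose dA' dB' (L \<sigma>))"
    by (simp add: ptranspose_ptranspose[OF c])
qed

lemma psd_projection:
  assumes "P \<in> carrier_mat d d" "mat_adjoint P = P" "P * P = P"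
  shows "psd d P"
proof (rule psd_gramI[where K = "{..<d}" and Z = "\<lambda>p l. P $$ (p, l)"])
  fix p q assume pq: "p < d" "q < d"
  have "P $$ (p, q) = (P * P) $$ (p, q)" by (simp add: assms(3))
  also have "\<dots> = (\<Sum>l<d. P $$ (p, l) * cnj (P $$ (q, l)))"
    unfolding index_mult_mat_sum[OF assms(1,1) pq]
    by (intro sum.cong refl) (use hermitian_index[OF assms(1,2)] pq in auto)
  finally show "P $$ (p, q) = (\<Sum>l<d. P $$ (p, l) * cnj (P $$ (q, l)))" .
qed (use assms in auto)

lemma psd_one_minus_projection:
  assumes P: "P \<in> carrier_mat d d" "mat_adjoint P = P" "P * P = P"
  shows "psd d (1\<^sub>m d - P)"
proof (rule psd_projection)
  show "mat_adjoint (1\<^sub>m d - P) = 1\<^sub>m d - P"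
    by (rule eq_matI) (use P hermitian_index[OF P(1,2)] in auto)
  have "(1\<^sub>m d - P) * (1\<^sub>m d - P) = 1\<^sub>m d * (1\<^sub>m d - P) - P * (1\<^sub>m d - P)"
    by (rule minus_mult_distrib_mat[of _ d d _ _ d]) (use P in auto)
  also have "P * (1\<^sub>m d - P) = P * 1\<^sub>m d - P * P"
    by (rule mult_minus_distrib_mat[of _ d d _ d]) (use P in auto)
  also have "1\<^sub>m d * (1\<^sub>m d - P) - (P * 1\<^sub>m d - P * P) = 1\<^sub>m d - P"
    unfolding P(3) using P(1) by (intro eq_matI) (auto simp: left_mult_one_mat[of _ d d])
  finally show "(1\<^sub>m d - P) * (1\<^sub>m d - P) = 1\<^sub>m d - P" .
qed (use P in auto)

text \<open>Twice the perfectly correlated classical bit. The factor makes it dominate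
  \<open>Phi\<close> directly, with the multiple of |00> - |11> as the difference, and m copies then
  have trace 2^m.\<close>

definition classical_pair :: "complex mat" where
  "classical_pair = weighted_gram 4 [(1, [1,0,0,0]), (1, [0,0,0,1])]"

lemma classical_pair_carrier [simp]: "classical_pair \<in> carrier_mat 4 4"
  by (simp add: classical_pair_def)

lemma psd_classical_pair: "psd 4 classical_pair"
  unfolding classical_pair_def by (rule psd_weighted_gram) simp

lemma mtrace_classical_pair: "mtrace classical_pair = 2"
  by (simp add: classical_pair_def mtrace_def index_weighted_gram eval_nat_numeral)

lemma classical_pair_dominates: "dominates 4 classical_pair Phi"
proof -
  have "classical_pair - Phi = weighted_gram 4 [(1/2, [1,0,0,-1])]" (is "?L = ?R")
  proof (rule eq_matI)
    fix p q assume "p < dim_row ?R" "q < dim_col ?R"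
    then have pq: "p < 4" "q < 4" by simp_all
    show "?L $$ (p, q) = ?R $$ (p, q)"
      by (rule less_4_cases[OF pq(1)]; rule less_4_cases[OF pq(2)])
        (simp_all add: classical_pair_def Phi_eq index_weighted_gram)
  qed (simp_all add: classical_pair_def Phi_eq)
  then have "psd 4 (classical_pair - Phi)" by (auto intro!: psd_weighted_gram)
  moreover have "psd 4 Phi" unfolding Phi_eq by (rule psd_weighted_gram) simp
  ultimately show ?thesis
    using psd_add[OF psd_classical_pair, of Phi] by (simp add: dominates_def Phi_eq)
qed

lemma ptranspose_classical_pair: "ptranspose 2 2 classical_pair = classical_pair"
proof (rule eq_matI)
  fix p q assume "p < dim_row classical_pair" "q < dim_col classical_pair"
  then have pq: "p < 4" "q < 4" by (simp_all add: classical_pair_def)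
  have "ptranspose 2 2 classical_pair $$ (p, q) = classical_pair $$ (p div 2 * 2 + q mod 2, q div 2 * 2 + p mod 2)"
    using pq by (simp add: index_ptranspose pt_index_def)
  also have "\<dots> = classical_pair $$ (p, q)"
    by (rule less_4_cases[OF pq(1)]; rule less_4_cases[OF pq(2)])
      (simp_all add: classical_pair_def index_weighted_gram)
  finally show "ptranspose 2 2 classical_pair $$ (p, q) = classical_pair $$ (p, q)" .
qed (simp_all add: classical_pair_def)

lemma Re_of_real_mult: "Re (complex_of_real a * z) = a * Re z"
  by simp

text \<open>Positivity of \<open>L\<close> carries the domination of the pairs over to the output,
  and the normalized dominating state stays PPT under \<open>L\<close>, so
  \<open>ppt_overlap_le\<close> applies to its image.\<close>

lemma rho_v_overlap_le:
  assumes L: "ppt_operation (2 ^ m) (2 ^ m) (3 ^ n) (3 ^ n) L"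
  shows "Re (mtrace (bip_power 3 3 rho_v n * L (bip_power 2 2 Phi m))) \<le> 2 ^ m * (1 / 4) ^ n"
proof -
  let ?d = "2 ^ m * 2 ^ m :: nat" and ?D = "3 ^ n * 3 ^ n :: nat"
  let ?R = "bip_power 3 3 rho_v n" and ?\<Phi> = "bip_power 2 2 Phi m" and ?C = "bip_power 2 2 classical_pair m"
  define c where "c = complex_of_real ((1 / 2) ^ m)"
  define \<sigma> where "\<sigma> = c \<cdot>\<^sub>m ?C"
  have cc: "classical_pair \<in> carrier_mat (2 * 2) (2 * 2)" by simp
  have C: "psd ?d ?C" by (rule psd_bip_power) (use psd_classical_pair in simp)
  have ptC: "ptranspose (2 ^ m) (2 ^ m) ?C = ?C"
    by (simp add: ptranspose_bip_power ptranspose_classical_pair)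
  have "psd ?d \<sigma>" unfolding \<sigma>_def c_def by (rule psd_smult[OF C]) simp
  moreover have "mtrace \<sigma> = 1"
    unfolding \<sigma>_def mtrace_smult[OF bip_power_carrier] mtrace_bip_power[OF cc] mtrace_classical_pair c_def
    by (simp flip: power_mult_distrib)
  ultimately have \<sigma>: "is_state ?d \<sigma>" by (simp add: is_state_def)
  have "ptranspose (2 ^ m) (2 ^ m) \<sigma> = c \<cdot>\<^sub>m ptranspose (2 ^ m) (2 ^ m) ?C"
    unfolding \<sigma>_def by (rule eq_matI) (simp_all add: index_ptranspose pt_index_less)
  then have "ptranspose (2 ^ m) (2 ^ m) \<sigma> = \<sigma>" unfolding ptC \<sigma>_def .
  then have pt\<sigma>: "psd ?d (ptranspose (2 ^ m) (2 ^ m) \<sigma>)" using \<open>psd ?d \<sigma>\<close> by simp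
  have lin: "linear_op_map ?d ?D L"
    using L by (simp add: ppt_operation_def cptp_def completely_positive_def)
  have carr: "?C \<in> carrier_mat ?d ?d" "?\<Phi> \<in> carrier_mat ?d ?d" "\<sigma> \<in> carrier_mat ?d ?d" "?R \<in> carrier_mat ?D ?D"
    by (simp_all add: \<sigma>_def)
  have Lc: "L X \<in> carrier_mat ?D ?D" if "X \<in> carrier_mat ?d ?d" for X
    using lin that by (simp add: linear_op_map_def)
  have "dominates ?d ?C ?\<Phi>" by (rule dominates_bip_power) (use classical_pair_dominates in simp)
  then have "psd ?d (?C - ?\<Phi>)" by (simp add: dominates_def)
  from ppt_operation_psd[OF L this] have psdL: "psd ?D (L (?C - ?\<Phi>))" .
  \<comment> \<open>\<open>linear_op_map\<close> speaks about sums and scalar multiples, so the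
    image of the difference is reached through this sum.\<close>
  have "?C = (?C - ?\<Phi>) + ?\<Phi>" using carr by (intro eq_matI) auto
  then have "L ?C = L (?C - ?\<Phi>) + L ?\<Phi>"
    using lin carr unfolding linear_op_map_def by (metis minus_carrier_mat)
  then have "L ?C - L ?\<Phi> = L (?C - ?\<Phi>)"
    using Lc[OF carr(2)] Lc[OF minus_carrier_mat[OF carr(2)], of ?C] by (auto intro!: eq_matI)
  then have le: "psd ?D (L ?C - L ?\<Phi>)" using psdL by simp
  have "Re (mtrace (?R * L ?\<Phi>)) = Re (mtrace (L ?\<Phi> * ?R))"
    using mtrace_comm[OF carr(4) Lc[OF carr(2)]] by simp
  also have "\<dots> \<le> Re (mtrace (L ?C * ?R))"
    by (rule mtrace_mult_psd_mono[OF le bip_power_rho_v(1)]) (use Lc carr in auto)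
  also have "L ?C = complex_of_real (2 ^ m) \<cdot>\<^sub>m L \<sigma>"
  proof -
    have "?C = complex_of_real (2 ^ m) \<cdot>\<^sub>m \<sigma>"
      by (rule eq_matI) (simp_all add: \<sigma>_def c_def power_one_over)
    then show ?thesis using lin carr(3) by (metis linear_op_map_def)
  qed
  also have "mtrace (complex_of_real (2 ^ m) \<cdot>\<^sub>m L \<sigma> * ?R) = complex_of_real (2 ^ m) * mtrace (?R * L \<sigma>)"
    unfolding mtrace_comm[OF carr(4) Lc[OF carr(3)]] mult_smult_assoc_mat[OF Lc[OF carr(3)] carr(4)]
    by (rule mtrace_smult[OF mult_carrier_mat[OF Lc[OF carr(3)] carr(4)]])
  also have "Re (complex_of_real (2 ^ m) * mtrace (?R * L \<sigma>)) = 2 ^ m * Re (mtrace (?R * L \<sigma>))"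
    by (rule Re_of_real_mult)
  also have "\<dots> \<le> 2 ^ m * (1 / 4) ^ n"
    using ppt_overlap_le[OF ppt_operation_preserves_ppt_state[OF L \<sigma> pt\<sigma>]] by simp
  finally show ?thesis .
qed

lemma output_difference_hermitian:
  assumes L: "ppt_operation (2 ^ m) (2 ^ m) (3 ^ n) (3 ^ n) L"
  defines "X \<equiv> bip_power 3 3 rho_v n - L (bip_power 2 2 Phi m)"
  shows "X \<in> carrier_mat (3 ^ n * 3 ^ n) (3 ^ n * 3 ^ n)" "mat_adjoint X = X"
proof -
  let ?D = "3 ^ n * 3 ^ n :: nat"
  have "psd 4 Phi" unfolding Phi_eq by (rule psd_weighted_gram) simp
  then have "psd (2 ^ m * 2 ^ m) (bip_power 2 2 Phi m)" by (intro psd_bip_power) simp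
  note Y = psd_hermitian[OF ppt_operation_psd[OF L this]]
  note R = psd_hermitian[OF bip_power_rho_v(1), of n]
  show "X \<in> carrier_mat ?D ?D" using Y by (auto simp: X_def)
  show "mat_adjoint X = X"
    by (rule eq_matI) (use Y(1) hermitian_index[OF Y] hermitian_index[OF R] in \<open>auto simp: X_def\<close>)
qed

text \<open>The test is the support projection \<open>Q\<close>, which is 2^n times the target. The
  target passes it with certainty, the produced state with probability at most 2^n * 2^m *
  4^-n.\<close>

lemma trace_norm_formation_ge:
  assumes L: "ppt_operation (2 ^ m) (2 ^ m) (3 ^ n) (3 ^ n) L"
  shows "1 - 2 ^ m / 2 ^ n \<le> trace_norm (3 ^ n * 3 ^ n) (bip_power 3 3 rho_v n - L (bip_power 2 2 Phi m))"
proof -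
  let ?D = "3 ^ n * 3 ^ n :: nat"
  let ?R = "bip_power 3 3 rho_v n" and ?Y = "L (bip_power 2 2 Phi m)"
  define c where "c = complex_of_real (2 ^ n)"
  define Q where "Q = c \<cdot>\<^sub>m ?R"
  note R = psd_hermitian[OF bip_power_rho_v(1), of n]
  have Y: "?Y \<in> carrier_mat ?D ?D"
    using L by (simp add: ppt_operation_def cptp_def completely_positive_def linear_op_map_def)
  have Q: "Q \<in> carrier_mat ?D ?D" by (simp add: Q_def)
  have psdQ: "psd ?D Q" unfolding Q_def c_def by (rule psd_smult[OF bip_power_rho_v(1)]) simp
  have sq: "?R * Q = ?R"
  proof -
    have "?R * Q = c \<cdot>\<^sub>m (?R * ?R)" unfolding Q_def by (rule mult_smult_distrib) auto
    also have "\<dots> = ?R" unfolding bip_power_rho_v(3)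
      by (rule eq_matI) (simp_all add: c_def power_one_over)
    finally show ?thesis .
  qed
  have "Q * Q = c \<cdot>\<^sub>m (?R * Q)" unfolding Q_def by (rule mult_smult_assoc_mat) auto
  then have "Q * Q = Q" unfolding sq by (simp add: Q_def)
  from psd_one_minus_projection[OF psd_hermitian[OF psdQ] this] have "psd ?D (1\<^sub>m ?D - Q)" .
  from mtrace_le_trace_norm[OF psdQ this output_difference_hermitian[OF L]]
  have "Re (mtrace (Q * (?R - ?Y))) \<le> trace_norm ?D (?R - ?Y)" .
  moreover have "mtrace (Q * (?R - ?Y)) = 1 - c * mtrace (?R * ?Y)"
  proof -
    have "mtrace (Q * (?R - ?Y)) = mtrace (Q * ?R) - mtrace (Q * ?Y)"
      using Q Y by (simp add: mult_minus_distrib_mat[of _ ?D ?D _ ?D] mtrace_minus[of _ ?D] mult_carrier_mat[of _ ?D ?D])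
    also have "mtrace (Q * ?R) = 1"
      using mtrace_comm[OF Q R(1)] by (simp add: sq bip_power_rho_v(2))
    also have "mtrace (Q * ?Y) = c * mtrace (?R * ?Y)"
      unfolding Q_def using Y by (simp add: mult_smult_assoc_mat[of _ ?D ?D] mtrace_smult[of _ ?D] mult_carrier_mat[of _ ?D ?D])
    finally show ?thesis .
  qed
  moreover have "Re (c * mtrace (?R * ?Y)) \<le> 2 ^ m / 2 ^ n"
  proof -
    have "Re (c * mtrace (?R * ?Y)) = 2 ^ n * Re (mtrace (?R * ?Y))"
      unfolding c_def by (rule Re_of_real_mult)
    also have "\<dots> \<le> 2 ^ n * (2 ^ m * (1 / 4) ^ n)"
      using rho_v_overlap_le[OF L] by simp
    also have "\<dots> = 2 ^ m / 2 ^ n"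
    proof -
      have "(4 :: real) ^ n = 2 ^ n * 2 ^ n" by (simp flip: power_mult_distrib)
      then show ?thesis by (simp add: power_one_over)
    qed
    finally show ?thesis .
  qed
  ultimately show ?thesis by simp
qed

lemma formation_error_rho_v_ge: "1 - 2 ^ m / 2 ^ n \<le> formation_error 3 3 rho_v n m"
  unfolding formation_error_def
proof (rule cINF_greatest)
  show "{L. ppt_operation (2 ^ m) (2 ^ m) (3 ^ n) (3 ^ n) L} \<noteq> {}"
    using ppt_operation_exists[of "2 ^ m" "3 ^ n" "3 ^ n" "2 ^ m"] by auto
qed (use trace_norm_formation_ge in auto)

lemma formation_error_rho_v_eq_0: "formation_error 3 3 rho_v n n = 0"
proof (rule antisym)
  show "0 \<le> formation_error 3 3 rho_v n n" using formation_error_rho_v_ge[of n n] by simp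
  obtain L where L: "ppt_operation (2 ^ n) (2 ^ n) (3 ^ n) (3 ^ n) L"
    "L (bip_power 2 2 Phi n) = bip_power 3 3 rho_v n"
    using rho_v_formation_exact by blast
  \<comment> \<open>With as many pairs as copies the general lower bound is 0, which supplies
    nonnegativity of these trace norms.\<close>
  have "bdd_below ((\<lambda>L. trace_norm (3 ^ n * 3 ^ n) (bip_power 3 3 rho_v n - L (bip_power 2 2 Phi n))) `
      {L. ppt_operation (2 ^ n) (2 ^ n) (3 ^ n) (3 ^ n) L})"
    using trace_norm_formation_ge[of n n] by (intro bdd_belowI[of _ 0]) auto
  then have "formation_error 3 3 rho_v n n \<le> trace_norm (3 ^ n * 3 ^ n) (bip_power 3 3 rho_v n - L (bip_power 2 2 Phi n))"
    unfolding formation_error_def using L(1) by (intro cINF_lower) auto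
  also have "\<dots> = 0"
  proof -
    have "bip_power 3 3 rho_v n - bip_power 3 3 rho_v n = 0\<^sub>m (3 ^ n * 3 ^ n) (3 ^ n * 3 ^ n)"
      by (rule eq_matI) auto
    then show ?thesis unfolding L(2) by (simp only: trace_norm_zero)
  qed
  finally show "formation_error 3 3 rho_v n n \<le> 0" .
qed

lemma entanglement_cost_rho_v: "entanglement_cost 3 3 rho_v = 1"
proof (rule antisym)
  show "entanglement_cost 3 3 rho_v \<le> 1"
    unfolding entanglement_cost_def one_ereal_def
    by (rule Inf_lower) (auto simp: formation_error_rho_v_eq_0)
  show "1 \<le> entanglement_cost 3 3 rho_v"
    unfolding entanglement_cost_def
  proof (rule Inf_greatest)
    fix x assume "x \<in> {ereal r | r. 0 \<le> r \<and> (\<lambda>n. formation_error 3 3 rho_v n (nat \<lfloor>r * real n\<rfloor>)) \<longlonglongrightarrow> 0}"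
    then obtain r where r: "x = ereal r" "0 \<le> r"
      "(\<lambda>n. formation_error 3 3 rho_v n (nat \<lfloor>r * real n\<rfloor>)) \<longlonglongrightarrow> 0" by auto
    have "1 \<le> r"
    proof (rule ccontr)
      assume "\<not> 1 \<le> r"
      then have r1: "0 < 1 - r" by simp
      have "\<forall>\<^sub>F n in sequentially. formation_error 3 3 rho_v n (nat \<lfloor>r * real n\<rfloor>) < 1 / 2"
        using order_tendstoD(2)[OF r(3), of "1 / 2"] by simp
      then obtain N where N: "\<And>n. n \<ge> N \<Longrightarrow> formation_error 3 3 rho_v n (nat \<lfloor>r * real n\<rfloor>) < 1 / 2"
        by (auto simp: eventually_sequentially)
      \<comment> \<open>Beyond \<open>M\<close> the gap between n and r n is at least 1, so at most
        n - 1 pairs are available and the error is at least 1 - 1/2, against the assumed convergence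
        to 0.\<close>
      obtain M :: nat where M: "1 / (1 - r) < real M" using reals_Archimedean2 by blast
      define n where "n = max N M"
      define m where "m = nat \<lfloor>r * real n\<rfloor>"
      have "1 / (1 - r) \<le> real n" using M by (simp add: n_def)
      then have "1 \<le> (1 - r) * real n" using r1 by (simp add: field_simps)
      then have "r * real n \<le> real n - 1" by (simp add: algebra_simps)
      moreover have "real m \<le> r * real n" using r(2) by (simp add: m_def)
      ultimately have "Suc m \<le> n" by linarith
      then have "(2 :: real) ^ Suc m \<le> 2 ^ n" by (rule power_increasing) simp
      then have "2 ^ m / 2 ^ n \<le> (1 / 2 :: real)" by (simp add: field_simps)
      then have "1 / 2 \<le> formation_error 3 3 rho_v n m"
        using formation_error_rho_v_ge[of m n] by linarith
      then show False using N[of n] by (simp add: n_def m_def)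
    qed
    then show "1 \<le> x" using r(1) by (simp add: one_ereal_def)
  qed
qed

theorem proposition2:
  shows "entanglement_cost 3 3 rho_v = reg_rel_entropy_ent 3 3 rho_v \<and>
         reg_rel_entropy_ent 3 3 rho_v = 1"
  using entanglement_cost_rho_v reg_rel_entropy_ent_rho_v by simp

end
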